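(* Let $K$ be an algebraically closed field of characteristic zero and $S=K[x_1,x_2,x_3,x_4]$. If $I=(f_1,f_2,f_3,f_4)\subset S$ is an ideal generated by a generic (regular) sequence of homogeneous polynomials of degree $3$, or if $f_1,f_2,f_3,f_4$ is a regular sequence of homogeneous polynomials of degree $3$ with $f_i\in K[x_i,\ldots,x_4]$ for $i=1,\ldots,4$ and $I=(f_1,\ldots,f_4)$, then the generic initial ideal $J=\operatorname{Gin}(I)$ of $I$ with respect to the reverse lexicographic order has one of the following forms: (I) $J=(\{x_1,x_2\}^3,\ x_3^2\{x_1,x_2\}^2,\ x_3^4\{x_1,x_2,x_3\},\ x_4x_3^3\{x_1,x_2,x_3\},\ x_4^3x_3\{x_1,x_2\}^2,\ x_4^3x_3^2\{x_1,x_2\},\ x_4^3x_3^3,\ x_4^5\{x_1,x_2,x_3\}^2,\ x_4^7\{x_1,x_2,x_3\},\ x_4^9)$; (II) $J=(\{x_1,x_2\}^3,\ x_3^2x_1\{x_1,x_2,x_3\},\ x_3^3x_2^2,\ x_3^4x_2,\ x_3^5,\ x_4x_3^2x_2^2,\ x_4x_3^3x_2,\ x_4x_3^4,\ x_4^3x_3\{x_1,x_2\}^2,\ x_4^3x_3^2\{x_1,x_2\},\ x_4^3x_3^3,\ x_4^5\{x_1,x_2,x_3\}^2,\ x_4^7\{x_1,x_2,x_3\},\ x_4^9)$.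
   Context: For a set $A$ of variables, $A^j$ denotes the set of all monomials of degree $j$ in the variables of $A$, and $mA^j$ the set of products of the monomial $m$ with elements of $A^j$. The generic initial ideal $\operatorname{Gin}(I)$ is the common initial ideal, with respect to the graded reverse lexicographic order with $x_1>x_2>x_3>x_4$, of $\alpha I$ for all $\alpha$ in a nonempty Zariski open subset of $GL_4(K)$ acting by linear changes of coordinates. A property holds for a generic sequence of four homogeneous polynomials of degree $3$ if there is a nonempty Zariski open subset $U\subset (S_3)^4$ such that it holds for every $(f_1,\ldots,f_4)\in U$. *)

theory Defs
  imports
    "HOL-Analysis.Analysis"
    "HOL-Library.Poly_Mapping"
    "HOL-Library.Numeral_Type"
    "HOL-Library.Set_Algebras"
    "HOL-Computational_Algebra.Polynomial"
begin

(* The polynomial ring S = K[x_1,x_2,x_3,x_4].  Monomials are exponent vectors indexed by the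
   four-element type 4, whose elements 0 < 1 < 2 < 3 index x_1, x_2, x_3, x_4 in this order
   (index i belongs to the variable x_(i+1)). *)

lemma type_4_order: "(0::4) < 1" "(1::4) < 2" "(2::4) < 3"
  by (simp_all add: less_bit0_def bit0.Rep_0 bit0.Rep_1 bit0.Rep_numeral)
lemma UNIV_type_4: "(UNIV :: 4 set) = {0, 1, 2, 3}"
proof -
  have "(4::4) = 0" by simp
  then show ?thesis using UNIV_4 by auto
qed

type_synonym mon = "4 \<Rightarrow>\<^sub>0 nat"
type_synonym 'k S = "mon \<Rightarrow>\<^sub>0 'k"

definition X :: "4 \<Rightarrow> 'k::comm_ring_1 S" where
  "X i = Poly_Mapping.single (Poly_Mapping.single i 1) 1"

abbreviation x1 :: "'k::comm_ring_1 S" where "x1 \<equiv> X 0"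
abbreviation x2 :: "'k::comm_ring_1 S" where "x2 \<equiv> X 1"
abbreviation x3 :: "'k::comm_ring_1 S" where "x3 \<equiv> X 2"
abbreviation x4 :: "'k::comm_ring_1 S" where "x4 \<equiv> X 3"

definition monomial :: "mon \<Rightarrow> 'k::comm_ring_1 S" where
  "monomial m = Poly_Mapping.single m 1"

definition mon_degree :: "mon \<Rightarrow> nat" where
  "mon_degree m = (\<Sum>i\<in>UNIV. Poly_Mapping.lookup m i)"

definition homogeneous :: "nat \<Rightarrow> 'k::zero S \<Rightarrow> bool" where
  "homogeneous d p \<longleftrightarrow> (\<forall>m\<in>Poly_Mapping.keys p. mon_degree m = d)"

(* The subring K[x_i | i : V]. *)
definition polys_in :: "4 set \<Rightarrow> 'k::zero S set" where
  "polys_in V = {p. \<forall>m\<in>Poly_Mapping.keys p. Poly_Mapping.keys m \<subseteq> V}"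

(* A^j for a set A of variables. *)
definition mons :: "'k::comm_ring_1 S set \<Rightarrow> nat \<Rightarrow> 'k S set" where
  "mons A j = {monomial m | m. mon_degree m = j \<and> (\<forall>i\<in>Poly_Mapping.keys m. X i \<in> A)}"

(* An ideal of a commutative ring is a submodule of the ring over itself. *)
abbreviation ideal_gen :: "'r::comm_ring_1 set \<Rightarrow> 'r set" where
  "ideal_gen \<equiv> module.span (*)"

lemma module_mult: "module ((*) :: 'r::comm_ring_1 \<Rightarrow> 'r \<Rightarrow> 'r)"
  by unfold_locales (simp_all add: algebra_simps)

definition regular_sequence :: "(4 \<Rightarrow> 'k::comm_ring_1 S) \<Rightarrow> bool" where
  "regular_sequence f \<longleftrightarrow>
     (\<forall>i g. g * f i \<in> ideal_gen (f ` {..<i}) \<longrightarrow> g \<in> ideal_gen (f ` {..<i})) \<and>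
     ideal_gen (range f) \<noteq> UNIV"

(* Graded reverse lexicographic order with x_1 > x_2 > x_3 > x_4: among monomials of the same
   degree, m is smaller than n iff m has the larger exponent at the last variable in which the
   two differ. *)
definition grevlex_less :: "mon \<Rightarrow> mon \<Rightarrow> bool" where
  "grevlex_less m n \<longleftrightarrow>
     mon_degree m < mon_degree n \<or>
     (mon_degree m = mon_degree n \<and>
       (\<exists>i. Poly_Mapping.lookup m i > Poly_Mapping.lookup n i \<and>
            (\<forall>j>i. Poly_Mapping.lookup m j = Poly_Mapping.lookup n j)))"

definition is_leading_mon :: "'k::zero S \<Rightarrow> mon \<Rightarrow> bool" where
  "is_leading_mon p m \<longleftrightarrow>
     m \<in> Poly_Mapping.keys p \<and> (\<forall>n\<in>Poly_Mapping.keys p. n \<noteq> m \<longrightarrow> grevlex_less n m)"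

definition initial_ideal :: "'k::comm_ring_1 S set \<Rightarrow> 'k S set" where
  "initial_ideal I = ideal_gen {monomial m | m. \<exists>p\<in>I. is_leading_mon p m}"

(* Evaluation of a polynomial in variables of an arbitrary type 'v at a point y of an algebra R
   over the coefficients, with structure map c. *)
definition eval_poly ::
  "('k::zero \<Rightarrow> 'r::comm_semiring_1) \<Rightarrow> ('v \<Rightarrow> 'r) \<Rightarrow> (('v \<Rightarrow>\<^sub>0 nat) \<Rightarrow>\<^sub>0 'k) \<Rightarrow> 'r" where
  "eval_poly c y p =
     (\<Sum>m\<in>Poly_Mapping.keys p.
        c (Poly_Mapping.lookup p m) *
        (\<Prod>v\<in>Poly_Mapping.keys m. y v ^ Poly_Mapping.lookup m v))"

(* The linear change of coordinates x_j |-> sum_i a_ij x_i. *)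
definition lin_change :: "'k::comm_ring_1^4^4 \<Rightarrow> 'k S \<Rightarrow> 'k S" where
  "lin_change a =
     eval_poly (Poly_Mapping.single 0)
       (\<lambda>j. \<Sum>i\<in>UNIV. Poly_Mapping.single 0 (a $ i $ j) * X i)"

(* U is relatively Zariski open in V, where V is regarded as a subset of an affine space by means
   of the coordinates: U is the part of V outside the common zero locus of a set P of
   polynomials in the coordinates. *)
definition zariski_open_in :: "('b \<Rightarrow> 'v \<Rightarrow> 'k::comm_ring_1) \<Rightarrow> 'b set \<Rightarrow> 'b set \<Rightarrow> bool" where
  "zariski_open_in coords V U \<longleftrightarrow>
     (\<exists>P. U = {b\<in>V. \<exists>p\<in>P. eval_poly id (coords b) p \<noteq> 0})"

definition GL4 :: "('k::comm_ring_1^4^4) set" where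
  "GL4 = {a. invertible a}"

(* J is the generic initial ideal of I.  Such a J is unique over an infinite field, since
   nonempty open subsets of GL4 then meet. *)
definition is_gin :: "'k::comm_ring_1 S set \<Rightarrow> 'k S set \<Rightarrow> bool" where
  "is_gin I J \<longleftrightarrow>
     (\<exists>U. zariski_open_in (\<lambda>a (i, j). a $ i $ j) GL4 U \<and> U \<noteq> {} \<and>
          (\<forall>a\<in>U. initial_ideal (lin_change a ` I) = J))"

(* (S_3)^4, with the coefficients as coordinates; those at monomials of degree other than 3
   vanish on it, so it is an affine space of dimension 80. *)
definition cubics4 :: "(4 \<Rightarrow> 'k::zero S) set" where
  "cubics4 = {f. \<forall>i. homogeneous 3 (f i)}"

definition holds_for_generic_cubics :: "((4 \<Rightarrow> 'k::comm_ring_1 S) \<Rightarrow> bool) \<Rightarrow> bool" where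
  "holds_for_generic_cubics Q \<longleftrightarrow>
     (\<exists>U. zariski_open_in (\<lambda>f (i, m). Poly_Mapping.lookup (f i) m) cubics4 U \<and> U \<noteq> {} \<and>
          (\<forall>f\<in>U. Q f))"

definition form_I :: "'k::comm_ring_1 S set" where
  "form_I = ideal_gen
     (mons {x1, x2} 3 \<union>
      x3^2 *o mons {x1, x2} 2 \<union>
      x3^4 *o mons {x1, x2, x3} 1 \<union>
      (x4 * x3^3) *o mons {x1, x2, x3} 1 \<union>
      (x4^3 * x3) *o mons {x1, x2} 2 \<union>
      (x4^3 * x3^2) *o mons {x1, x2} 1 \<union>
      {x4^3 * x3^3} \<union>
      x4^5 *o mons {x1, x2, x3} 2 \<union>
      x4^7 *o mons {x1, x2, x3} 1 \<union>
      {x4^9})"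

definition form_II :: "'k::comm_ring_1 S set" where
  "form_II = ideal_gen
     (mons {x1, x2} 3 \<union>
      (x3^2 * x1) *o mons {x1, x2, x3} 1 \<union>
      {x3^3 * x2^2} \<union>
      {x3^4 * x2} \<union>
      {x3^5} \<union>
      {x4 * x3^2 * x2^2} \<union>
      {x4 * x3^3 * x2} \<union>
      {x4 * x3^4} \<union>
      (x4^3 * x3) *o mons {x1, x2} 2 \<union>
      (x4^3 * x3^2) *o mons {x1, x2} 1 \<union>
      {x4^3 * x3^3} \<union>
      x4^5 *o mons {x1, x2, x3} 2 \<union>
      x4^7 *o mons {x1, x2, x3} 1 \<union>
      {x4^9})"

end

theory Submission
  imports Defs
begin

text \<open>
  Write A = S/I, graded by degree. If multiplication by x4^(8-2d) maps A_d onto A_(8-d) for d < 4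
  and A_9 = 0, if I contains no cubic of the ideal (x3, x4), and if x2^2 x3^2, x2 x3^3, x3^4 span
  A_4 modulo x4, then every generator of form (I) or form (II) is a leading monomial of I; which form occurs
  depends only on whether x1 x3^3, x2 x3^3, x3^4 still span A_4 modulo x4. Both forms have 81
  standard monomials, and dim A is at least 81 by the division of monomials by f_1, ..., f_4, so
  there are no further leading monomials. All these conditions say that finitely many polynomials
  span a homogeneous component, so they are Zariski open, and it remains to verify them for one
  coordinate change of the ideal of the cubes of the variables. There the Lefschetz condition
  follows from the representation theory of sl2, and the others are a computation. A regular
  sequence with f_i in K[x_i, ..., x4] degenerates to the cubes under a one-parameter torus.
\<close>

section \<open>Polynomial functions and Zariski open sets\<close>

text \<open>Genericity is needed twice, for f and, given f, for the coordinates alpha. One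
  polynomial function D whose nonvanishing forces general position serves both, as D(alpha f) is
  polynomial in f and in alpha; one nonzero value, at the cubes and the special coordinate change,
  makes both open sets nonempty. The dimension bound has its own function T; being insensitive to
  coordinates, it is tested before they are changed. Along the torus degeneration both become
  polynomials in t that are nonzero at t = 0, hence at some t \<noteq> 0.

  That Gin exists comes from a dichotomy: type I is itself an open condition, so it either holds on
  a nonempty open set of coordinates or fails wherever D is nonzero.

  The constants come from the Hilbert function 1, 4, 10, 16, 19, 16, 10, 4, 1, of sum 81 = 3^4. Its
  differences 1, 3, 6, 6, 3 up to degree 4 count the standard monomials free of x4; one of degree s
  carries the powers x4^0, ..., x4^(8-2s). In degree 4 three are left, and the two forms are the two
  possible choices of them.\<close>

definition mon_val :: "('v \<Rightarrow> 'r::comm_semiring_1) \<Rightarrow> ('v \<Rightarrow>\<^sub>0 nat) \<Rightarrow> 'r" where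
  "mon_val y m = (\<Prod>v\<in>Poly_Mapping.keys m. y v ^ Poly_Mapping.lookup m v)"

lemma mon_val_superset:
  assumes "finite A" "Poly_Mapping.keys m \<subseteq> A"
  shows "mon_val y m = (\<Prod>v\<in>A. y v ^ Poly_Mapping.lookup m v)"
  unfolding mon_val_def using assms
  by (intro prod.mono_neutral_left) (auto simp: in_keys_iff)

lemma mon_val_add: "mon_val y (m + n) = mon_val y m * mon_val y n"
proof -
  let ?A = "Poly_Mapping.keys m \<union> Poly_Mapping.keys n"
  have "Poly_Mapping.keys (m + n) \<subseteq> ?A" by (rule keys_add)
  then show ?thesis
    by (simp add: mon_val_superset[of ?A] lookup_add power_add prod.distrib)
qed

lemma mon_val_zero [simp]: "mon_val y 0 = 1"
  by (simp add: mon_val_def)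

lemma mon_val_single [simp]: "mon_val y (Poly_Mapping.single v k) = y v ^ k"
  by (cases "k = 0") (simp_all add: mon_val_def)

lemma poly_mapping_as_sum:
  assumes "finite A" "Poly_Mapping.keys p \<subseteq> A"
  shows "p = (\<Sum>m\<in>A. Poly_Mapping.single m (Poly_Mapping.lookup p m))"
proof (rule poly_mapping_eqI)
  fix k
  have "Poly_Mapping.lookup (\<Sum>m\<in>A. Poly_Mapping.single m (Poly_Mapping.lookup p m)) k =
    (\<Sum>m\<in>A. if k = m then Poly_Mapping.lookup p m else 0)"
    by (simp add: lookup_sum lookup_single when_def eq_commute)
  also have "\<dots> = Poly_Mapping.lookup p k"
    using assms by (auto simp: in_keys_iff)
  finally show "Poly_Mapping.lookup p k = Poly_Mapping.lookup (\<Sum>m\<in>A. Poly_Mapping.single m (Poly_Mapping.lookup p m)) k"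
    by simp
qed

text \<open>\<open>eval_poly\<close> occurs with two structure maps: the identity, for polynomial
  functions on a parameter space, and the embedding of constants into a polynomial ring, for
  substitutions of variables.\<close>

locale coeff_hom =
  fixes c :: "'k::comm_ring_1 \<Rightarrow> 'r::comm_ring_1"
  assumes c_add: "c (a + b) = c a + c b"
    and c_mult: "c (a * b) = c a * c b"
    and c_1: "c 1 = 1"
begin

lemma c_0: "c 0 = 0"
  using c_add[of 0 0] by simp

lemma eval_poly_superset:
  assumes "finite A" "Poly_Mapping.keys p \<subseteq> A"
  shows "eval_poly c y p = (\<Sum>m\<in>A. c (Poly_Mapping.lookup p m) * mon_val y m)"
  unfolding eval_poly_def mon_val_def[symmetric] using assms
  by (intro sum.mono_neutral_left) (auto simp: in_keys_iff c_0)

lemma eval_poly_add: "eval_poly c y (p + q) = eval_poly c y p + eval_poly c y q"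
proof -
  let ?A = "Poly_Mapping.keys p \<union> Poly_Mapping.keys q"
  have "Poly_Mapping.keys (p + q) \<subseteq> ?A" by (rule keys_add)
  then show ?thesis
    by (simp add: eval_poly_superset[of ?A] lookup_add c_add sum.distrib distrib_right)
qed

lemma eval_poly_zero [simp]: "eval_poly c y 0 = 0"
  by (simp add: eval_poly_def)

lemma eval_poly_single [simp]: "eval_poly c y (Poly_Mapping.single m a) = c a * mon_val y m"
  by (cases "a = 0") (simp_all add: eval_poly_def mon_val_def c_0)

lemma eval_poly_sum: "eval_poly c y (sum p A) = (\<Sum>x\<in>A. eval_poly c y (p x))"
  by (induction A rule: infinite_finite_induct) (simp_all add: eval_poly_add)

lemma eval_poly_mult: "eval_poly c y (p * q) = eval_poly c y p * eval_poly c y q"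
proof -
  let ?s = "\<lambda>p. (\<Sum>m\<in>Poly_Mapping.keys p. Poly_Mapping.single m (Poly_Mapping.lookup p m))"
  have p: "p = ?s p" and q: "q = ?s q"
    by (auto intro!: poly_mapping_as_sum)
  have "eval_poly c y (p * q) = eval_poly c y (?s p * ?s q)"
    using p q by simp
  also have "\<dots> = eval_poly c y (?s p) * eval_poly c y (?s q)"
    by (simp add: sum_product eval_poly_sum mult_single c_mult mon_val_add mult.assoc mult.left_commute)
  finally show ?thesis using p q by simp
qed

lemma eval_poly_one [simp]: "eval_poly c y 1 = 1"
  using eval_poly_single[of y 0 1] by (simp add: c_1)

lemma eval_poly_uminus: "eval_poly c y (- p) = - eval_poly c y p"
  using eval_poly_add[of y p "- p"] by (simp add: eq_neg_iff_add_eq_0 add.commute)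

lemma eval_poly_diff: "eval_poly c y (p - q) = eval_poly c y p - eval_poly c y q"
  using eval_poly_add[of y p "- q"] by (simp add: eval_poly_uminus)

lemma eval_poly_power: "eval_poly c y (p ^ n) = eval_poly c y p ^ n"
  by (induction n) (simp_all add: eval_poly_mult)

lemma eval_poly_numeral [simp]: "eval_poly c y (numeral n) = numeral n"
  by (induction n) (simp_all only: numeral.simps eval_poly_add eval_poly_one)

end

interpretation id_hom: coeff_hom "id :: 'k::comm_ring_1 \<Rightarrow> 'k"
  by unfold_locales simp_all

interpretation const_hom: coeff_hom "Poly_Mapping.single 0 :: 'k::comm_ring_1 \<Rightarrow> ('v \<Rightarrow>\<^sub>0 nat) \<Rightarrow>\<^sub>0 'k"
  by unfold_locales (simp_all add: single_add mult_single)

text \<open>Agreement with a polynomial is demanded on V only. The coordinates may be infinite in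
  number, as for coefficients of polynomials; a single p involves finitely many of them.\<close>

definition polyfun_on :: "('b \<Rightarrow> 'v \<Rightarrow> 'k::comm_ring_1) \<Rightarrow> 'b set \<Rightarrow> ('b \<Rightarrow> 'k) \<Rightarrow> bool" where
  "polyfun_on coords V F \<longleftrightarrow> (\<exists>p. \<forall>b\<in>V. F b = eval_poly id (coords b) p)"

lemma polyfun_on_const: "polyfun_on coords V (\<lambda>_. a)"
  unfolding polyfun_on_def by (rule exI[of _ "Poly_Mapping.single 0 a"]) simp

lemma polyfun_on_coord: "polyfun_on coords V (\<lambda>b. coords b v)"
  unfolding polyfun_on_def
  by (rule exI[of _ "Poly_Mapping.single (Poly_Mapping.single v 1) 1"]) simp

lemma polyfun_on_add:
  "polyfun_on coords V F \<Longrightarrow> polyfun_on coords V G \<Longrightarrow> polyfun_on coords V (\<lambda>b. F b + G b)"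
  unfolding polyfun_on_def by (metis id_hom.eval_poly_add)

lemma polyfun_on_mult:
  "polyfun_on coords V F \<Longrightarrow> polyfun_on coords V G \<Longrightarrow> polyfun_on coords V (\<lambda>b. F b * G b)"
  unfolding polyfun_on_def by (metis id_hom.eval_poly_mult)

lemma polyfun_on_diff:
  "polyfun_on coords V F \<Longrightarrow> polyfun_on coords V G \<Longrightarrow> polyfun_on coords V (\<lambda>b. F b - G b)"
  unfolding polyfun_on_def by (metis id_hom.eval_poly_diff)

lemma polyfun_on_sum:
  "(\<And>x. x \<in> A \<Longrightarrow> polyfun_on coords V (F x)) \<Longrightarrow> polyfun_on coords V (\<lambda>b. \<Sum>x\<in>A. F x b)"
  by (induction A rule: infinite_finite_induct)
    (auto intro: polyfun_on_const polyfun_on_add)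

lemma polyfun_on_prod:
  "(\<And>x. x \<in> A \<Longrightarrow> polyfun_on coords V (F x)) \<Longrightarrow> polyfun_on coords V (\<lambda>b. \<Prod>x\<in>A. F x b)"
  by (induction A rule: infinite_finite_induct)
    (auto intro: polyfun_on_const polyfun_on_mult)

lemma polyfun_on_power:
  "polyfun_on coords V F \<Longrightarrow> polyfun_on coords V (\<lambda>b. F b ^ n)"
  by (induction n) (auto intro: polyfun_on_const polyfun_on_mult)

lemma polyfun_on_cong:
  "polyfun_on coords V F \<Longrightarrow> (\<And>b. b \<in> V \<Longrightarrow> F b = G b) \<Longrightarrow> polyfun_on coords V G"
  unfolding polyfun_on_def by metis

lemma polyfun_on_compose:
  assumes F: "polyfun_on coords V F"
    and h: "\<And>b. b \<in> W \<Longrightarrow> h b \<in> V"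
    and c: "\<And>v. polyfun_on coords' W (\<lambda>b. coords (h b) v)"
  shows "polyfun_on coords' W (\<lambda>b. F (h b))"
proof -
  obtain p where p: "\<And>b. b \<in> V \<Longrightarrow> F b = eval_poly id (coords b) p"
    using F unfolding polyfun_on_def by auto
  have "polyfun_on coords' W (\<lambda>b. eval_poly id (coords (h b)) p)"
    unfolding eval_poly_def id_apply
    by (intro polyfun_on_sum polyfun_on_mult polyfun_on_const polyfun_on_prod polyfun_on_power c)
  then show ?thesis
    by (rule polyfun_on_cong) (simp add: p h)
qed

lemma zariski_open_in_polyfun:
  assumes "polyfun_on coords V D"
  shows "zariski_open_in coords V {b \<in> V. D b \<noteq> 0}"
proof -
  obtain p where p: "\<And>b. b \<in> V \<Longrightarrow> D b = eval_poly id (coords b) p"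
    using assms unfolding polyfun_on_def by auto
  show ?thesis
    unfolding zariski_open_in_def by (rule exI[of _ "{p}"]) (auto simp: p)
qed

lemma polyfun_on_line_imp_poly:
  fixes F :: "'k::comm_ring_1 \<Rightarrow> 'k"
  assumes "polyfun_on (\<lambda>t (_::unit). t) UNIV F"
  shows "\<exists>q. \<forall>t. F t = poly q t"
proof -
  obtain p where p: "\<And>t. F t = eval_poly id (\<lambda>_::unit. t) p"
    using assms unfolding polyfun_on_def by auto
  have "F t = poly (\<Sum>m\<in>Poly_Mapping.keys p.
      [:Poly_Mapping.lookup p m:] * (\<Prod>v\<in>Poly_Mapping.keys m. [:0, 1:] ^ Poly_Mapping.lookup m v)) t" for t
    by (simp add: p eval_poly_def poly_sum poly_prod)
  then show ?thesis by blast
qed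

text \<open>A nonzero polynomial in one variable has finitely many roots and a field of
  characteristic zero is infinite. This is what moves the parameter away from the special fibre of
  the torus degeneration.\<close>

lemma polyfun_on_line_nonzero:
  fixes F :: "'k::field_char_0 \<Rightarrow> 'k"
  assumes "polyfun_on (\<lambda>t (_::unit). t) UNIV F" "F a \<noteq> 0"
  shows "\<exists>t. t \<noteq> b \<and> F t \<noteq> 0"
proof -
  obtain q where q: "\<And>t. F t = poly q t"
    using polyfun_on_line_imp_poly[OF assms(1)] by auto
  with assms(2) have "q \<noteq> 0" by auto
  then have "finite {t. poly q t = 0}" by (rule poly_roots_finite)
  then have "finite (insert b {t. poly q t = 0})" by simp
  then have "\<exists>t. t \<notin> insert b {t. poly q t = 0}"
    using infinite_UNIV_char_0 by (rule ex_new_if_finite[rotated])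
  then show ?thesis by (auto simp: q)
qed

section \<open>Linear structure of the polynomial ring\<close>

text \<open>S carries two module structures: over K by \<open>smul\<close>, for spans and dimension
  counts, and over itself by multiplication, for ideals.\<close>

definition smul :: "'k::comm_ring_1 \<Rightarrow> 'k S \<Rightarrow> 'k S" where
  "smul c p = Poly_Mapping.single 0 c * p"

lemma lookup_smul [simp]: "Poly_Mapping.lookup (smul c p) m = c * Poly_Mapping.lookup p m"
  unfolding smul_def mult_map_scale_conv_mult[symmetric]
  by (simp add: Poly_Mapping.map.rep_eq when_def)

interpretation pm: vector_space "smul :: 'k::field \<Rightarrow> 'k S \<Rightarrow> 'k S"
  by unfold_locales (simp_all add: smul_def distrib_left distrib_right single_add
      mult.assoc[symmetric] mult_single)

interpretation idl: module "(*) :: 'k::comm_ring_1 S \<Rightarrow> 'k S \<Rightarrow> 'k S"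
  by (rule module_mult)

declare idl.scale_scale [simp del]

lemma smul_mult_left: "smul c p * q = smul c (p * q)"
  by (simp add: smul_def mult.assoc)

lemma smul_mult_right: "p * smul c q = smul c (p * q)"
  by (simp add: smul_def mult.left_commute)

lemma numeral_eq_smul: "numeral n * p = smul (numeral n) p"
  by (simp add: smul_def)

lemma monomial_add: "monomial (m + n) = monomial m * monomial n"
  by (simp add: monomial_def mult_single)

lemma monomial_0 [simp]: "monomial 0 = 1"
  by (simp add: monomial_def)

lemma X_eq_monomial: "X i = monomial (Poly_Mapping.single i 1)"
  by (simp add: X_def monomial_def)

lemma monomial_single_power: "monomial (Poly_Mapping.single i k) = X i ^ k"
proof (induction k)
  case (Suc k)
  have "Poly_Mapping.single i (Suc k) = Poly_Mapping.single i 1 + Poly_Mapping.single i k"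
    by (simp add: single_add[symmetric])
  then show ?case using Suc by (simp add: monomial_add X_eq_monomial)
qed simp

lemma lookup_monomial: "Poly_Mapping.lookup (monomial m) n = (if n = m then 1 else 0)"
  by (simp add: monomial_def lookup_single when_def eq_commute)

lemma keys_monomial [simp]: "Poly_Mapping.keys (monomial m :: 'k::comm_ring_1 S) = {m}"
  by (simp add: monomial_def)

lemma inj_monomial: "inj (monomial :: mon \<Rightarrow> 'k::comm_ring_1 S)"
  by (rule injI) (metis keys_monomial the_elem_eq)

lemma mon_degree_add [simp]: "mon_degree (m + n) = mon_degree m + mon_degree n"
  by (simp add: mon_degree_def lookup_add sum.distrib)

lemma mon_degree_zero [simp]: "mon_degree 0 = 0"
  by (simp add: mon_degree_def)

lemma mon_degree_single [simp]: "mon_degree (Poly_Mapping.single i k) = k"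
  by (simp add: mon_degree_def lookup_single when_def)

definition hmons :: "nat \<Rightarrow> mon set" where
  "hmons d = {m. mon_degree m = d}"

lemma lookup_le_mon_degree: "Poly_Mapping.lookup m i \<le> mon_degree m"
  unfolding mon_degree_def by (rule member_le_sum) auto

lemma finite_mon_degree_le: "finite {m. mon_degree m \<le> d}"
proof (rule finite_imageD)
  have "Poly_Mapping.lookup ` {m. mon_degree m \<le> d} \<subseteq> {f. \<forall>i. f i \<in> {..d}}"
    using lookup_le_mon_degree order_trans by fastforce
  moreover have "{f :: 4 \<Rightarrow> nat. \<forall>i. f i \<in> {..d}} = PiE UNIV (\<lambda>_. {..d})"
    by (auto simp: PiE_def Pi_def)
  moreover have "finite (PiE (UNIV :: 4 set) (\<lambda>_. {..d}))"
    by (rule finite_PiE) simp_all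
  ultimately show "finite (Poly_Mapping.lookup ` {m. mon_degree m \<le> d})"
    by (metis finite_subset)
qed (auto intro: inj_onI poly_mapping_eqI)

lemma finite_hmons [simp]: "finite (hmons d)"
  by (rule finite_subset[OF _ finite_mon_degree_le[of d]]) (auto simp: hmons_def)

lemma homogeneous_iff_span:
  fixes p :: "'k::field S"
  shows "homogeneous d p \<longleftrightarrow> p \<in> pm.span (monomial ` hmons d)"
proof
  assume h: "homogeneous d p"
  then have "Poly_Mapping.keys p \<subseteq> hmons d"
    by (auto simp: homogeneous_def hmons_def)
  then have "p = (\<Sum>m\<in>hmons d. Poly_Mapping.single m (Poly_Mapping.lookup p m))"
    by (rule poly_mapping_as_sum[rotated]) simp
  also have "\<dots> = (\<Sum>m\<in>hmons d. smul (Poly_Mapping.lookup p m) (monomial m))"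
    by (simp add: smul_def monomial_def mult_single)
  also have "\<dots> \<in> pm.span (monomial ` hmons d)"
    by (intro pm.span_sum pm.span_scale pm.span_base) auto
  finally show "p \<in> pm.span (monomial ` hmons d)" .
next
  assume "p \<in> pm.span (monomial ` hmons d)"
  then show "homogeneous d p"
  proof (induction rule: pm.span_induct_alt)
    case base
    then show ?case by (simp add: homogeneous_def)
  next
    case (step c x y)
    then show ?case
      by (auto simp: homogeneous_def hmons_def in_keys_iff lookup_add lookup_monomial split: if_splits)
  qed
qed

lemma homogeneous_as_sum:
  fixes p :: "'k::field S"
  assumes "homogeneous d p"
  shows "p = (\<Sum>m\<in>hmons d. smul (Poly_Mapping.lookup p m) (monomial m))"
proof -
  have "Poly_Mapping.keys p \<subseteq> hmons d"
    using assms by (auto simp: homogeneous_def hmons_def)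
  then have "p = (\<Sum>m\<in>hmons d. Poly_Mapping.single m (Poly_Mapping.lookup p m))"
    by (rule poly_mapping_as_sum[rotated]) simp
  then show ?thesis
    by (simp add: smul_def monomial_def mult_single)
qed

lemma as_sum_monomials:
  fixes p :: "'k::field S"
  shows "p = (\<Sum>m\<in>Poly_Mapping.keys p. smul (Poly_Mapping.lookup p m) (monomial m))"
  using poly_mapping_as_sum[of "Poly_Mapping.keys p" p]
  by (simp add: smul_def monomial_def mult_single)

lemma homogeneous_monomial: "mon_degree m = d \<Longrightarrow> homogeneous d (monomial m :: 'k::comm_ring_1 S)"
  by (simp add: homogeneous_def)

lemma homogeneous_add: "homogeneous d p \<Longrightarrow> homogeneous d q \<Longrightarrow> homogeneous d (p + q)"
  using keys_add[of p q] by (auto simp: homogeneous_def)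

lemma homogeneous_smul: "homogeneous d p \<Longrightarrow> homogeneous d (smul c p)"
  by (auto simp: homogeneous_def in_keys_iff)

lemma homogeneous_zero [simp]: "homogeneous d 0"
  by (simp add: homogeneous_def)

lemma homogeneous_diff: "homogeneous d p \<Longrightarrow> homogeneous d q \<Longrightarrow> homogeneous d (p - q)"
  by (auto simp: homogeneous_def in_keys_iff lookup_minus)

lemma homogeneous_sum: "(\<And>x. x \<in> A \<Longrightarrow> homogeneous d (f x)) \<Longrightarrow> homogeneous d (sum f A)"
  by (induction A rule: infinite_finite_induct) (auto intro: homogeneous_add)

lemma homogeneous_mult:
  "homogeneous d p \<Longrightarrow> homogeneous e q \<Longrightarrow> homogeneous (d + e) (p * q)"
  using keys_mult[of p q] by (fastforce simp: homogeneous_def)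

lemma homogeneous_power:
  "homogeneous d p \<Longrightarrow> homogeneous (n * d) (p ^ n)"
proof (induction n)
  case 0
  then show ?case by (simp add: homogeneous_def)
next
  case (Suc n)
  then show ?case using homogeneous_mult[of d p "n * d" "p ^ n"] by simp
qed

lemma homogeneous_X: "homogeneous 1 (X i)"
  by (simp add: homogeneous_def X_def)

definition hom_part :: "nat \<Rightarrow> 'k::comm_ring_1 S \<Rightarrow> 'k S" where
  "hom_part d p = (\<Sum>m\<in>hmons d. smul (Poly_Mapping.lookup p m) (monomial m))"

lemma lookup_hom_part [simp]:
  "Poly_Mapping.lookup (hom_part d p) m = (if mon_degree m = d then Poly_Mapping.lookup p m else 0)"
  by (simp add: hom_part_def lookup_sum lookup_monomial hmons_def[symmetric] if_distrib cong: if_cong)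
    (simp add: hmons_def)

lemma hom_part_homogeneous: "homogeneous d p \<Longrightarrow> hom_part e p = (if d = e then p else 0)"
  by (rule poly_mapping_eqI) (auto simp: homogeneous_def in_keys_iff)

lemma hom_part_linear: "module_hom smul smul (hom_part d :: 'k::field S \<Rightarrow> 'k S)"
  by unfold_locales (auto intro!: poly_mapping_eqI simp: lookup_add)

lemma mult_linear: "module_hom smul smul ((*) q :: 'k::field S \<Rightarrow> 'k S)"
  by unfold_locales (simp_all add: distrib_left smul_mult_right)

lemma mult_linear_right: "module_hom smul smul (\<lambda>p :: 'k::field S. p * q)"
  by unfold_locales (simp_all add: distrib_right smul_mult_left)

lemma linear_span_image:
  assumes "module_hom smul smul (h :: 'k::field S \<Rightarrow> 'k S)" "p \<in> pm.span B"
  shows "h p \<in> pm.span (h ` B)"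
  using module_hom.spans_image[OF assms(1), of "{p}" B] assms(2) by simp

lemma linear_span_into:
  assumes "module_hom smul smul (h :: 'k::field S \<Rightarrow> 'k S)" "p \<in> pm.span B"
    "\<And>b. b \<in> B \<Longrightarrow> h b \<in> pm.span C"
  shows "h p \<in> pm.span C"
proof -
  have "h p \<in> pm.span (h ` B)" by (rule linear_span_image) fact+
  also have "\<dots> \<subseteq> pm.span C" using assms(3) by (intro pm.span_minimal) auto
  finally show ?thesis .
qed

lemma ideal_gen_subspace: "pm.subspace (ideal_gen (A :: 'k::field S set))"
  by (intro pm.subspaceI) (auto simp: smul_def intro: idl.span_zero idl.span_add idl.span_scale)

text \<open>The span of the monomial multiples is stable under monomials, hence by linearity under
  all of S. This turns ideal membership into linear algebra over K.\<close>

lemma ideal_gen_eq_span: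
  "ideal_gen (A :: 'k::field S set) = pm.span {monomial n * a | n a. a \<in> A}" (is "_ = pm.span ?B")
proof
  show "pm.span ?B \<subseteq> ideal_gen A"
    by (rule pm.span_minimal) (auto intro: idl.span_scale idl.span_base ideal_gen_subspace)
  have "q * b \<in> pm.span ?B" if "b \<in> pm.span ?B" for q b
  proof -
    have "monomial n * b \<in> pm.span ?B" for n
      using that
    proof (rule linear_span_into[OF mult_linear])
      fix b assume "b \<in> ?B"
      then obtain k a where "b = monomial k * a" "a \<in> A" by auto
      then have "monomial n * b = monomial (n + k) * a" by (simp add: monomial_add mult.assoc)
      then show "monomial n * b \<in> pm.span ?B"
        using \<open>a \<in> A\<close> by (auto intro: pm.span_base)
    qed
    then have "(\<Sum>m\<in>Poly_Mapping.keys q. smul (Poly_Mapping.lookup q m) (monomial m * b)) \<in> pm.span ?B"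
      by (intro pm.span_sum pm.span_scale)
    also have "(\<Sum>m\<in>Poly_Mapping.keys q. smul (Poly_Mapping.lookup q m) (monomial m * b)) = q * b"
      by (subst (3) as_sum_monomials[of q]) (simp add: sum_distrib_right smul_mult_left)
    finally show ?thesis .
  qed
  then have "idl.subspace (pm.span ?B)"
    by (intro idl.subspaceI) (auto intro: pm.span_zero pm.span_add)
  moreover have "A \<subseteq> pm.span ?B"
  proof
    fix a assume "a \<in> A"
    then have "monomial 0 * a \<in> pm.span ?B" by (intro pm.span_base) blast
    then show "a \<in> pm.span ?B" by simp
  qed
  ultimately show "ideal_gen A \<subseteq> pm.span ?B"
    by (intro idl.span_minimal)
qed

section \<open>Linear substitutions of the variables\<close>

lemma lin_change_simps [simp]:
  "lin_change a (p + q) = lin_change a p + lin_change a q"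
  "lin_change a (p * q) = lin_change a p * lin_change a q"
  "lin_change a (p - q) = lin_change a p - lin_change a q"
  "lin_change a (p ^ n) = lin_change a p ^ n"
  "lin_change a (- p) = - lin_change a p"
  "lin_change a 0 = 0"
  "lin_change a 1 = 1"
  "lin_change a (numeral k) = numeral k"
  "lin_change a (Poly_Mapping.single 0 c) = Poly_Mapping.single 0 c"
  "lin_change a (smul c p) = smul c (lin_change a p)"
  by (simp_all add: lin_change_def smul_def const_hom.eval_poly_add const_hom.eval_poly_mult
      const_hom.eval_poly_diff const_hom.eval_poly_power const_hom.eval_poly_uminus)

lemma lin_change_sum: "lin_change a (sum f A) = (\<Sum>x\<in>A. lin_change a (f x))"
  by (simp add: lin_change_def const_hom.eval_poly_sum)

lemma lin_change_X: "lin_change a (X j) = (\<Sum>i\<in>UNIV. Poly_Mapping.single 0 (a $ i $ j) * X i)"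
  by (simp add: lin_change_def X_def)

lemma lin_change_monomial: "lin_change a (monomial m) = (\<Prod>j\<in>UNIV. lin_change a (X j) ^ Poly_Mapping.lookup m j)"
  unfolding lin_change_X
  by (simp add: lin_change_def monomial_def mon_val_superset[of UNIV])

lemma lin_change_linear: "module_hom smul smul (lin_change a :: 'k::field S \<Rightarrow> 'k S)"
  by unfold_locales simp_all

lemma monomial_eq_prod: "monomial m = (\<Prod>j\<in>UNIV. X j ^ Poly_Mapping.lookup m j)"
proof -
  have eq: "m = (\<Sum>j\<in>UNIV. Poly_Mapping.single j (Poly_Mapping.lookup m j))"
    by (rule poly_mapping_as_sum) auto
  have "monomial (\<Sum>j\<in>A. Poly_Mapping.single j (Poly_Mapping.lookup m j)) =
      (\<Prod>j\<in>A. X j ^ Poly_Mapping.lookup m j)" for A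
    by (induction A rule: infinite_finite_induct) (auto simp: monomial_add monomial_single_power)
  from this[of UNIV] show ?thesis by (simp flip: eq)
qed

lemma eq_on_X_imp_eq:
  fixes h h' :: "'k::field S \<Rightarrow> 'k S"
  assumes X: "\<And>j. h (X j) = h' (X j)"
    and h: "module_hom smul smul h" "\<And>p q. h (p * q) = h p * h q" "h 1 = 1"
    and h': "module_hom smul smul h'" "\<And>p q. h' (p * q) = h' p * h' q" "h' 1 = 1"
  shows "h p = h' p"
proof -
  have pow: "h (q ^ n) = h q ^ n" "h' (q ^ n) = h' q ^ n" for q n
    by (induction n) (simp_all add: h h')
  have prod: "h (prod f A) = (\<Prod>x\<in>A. h (f x))" "h' (prod f A) = (\<Prod>x\<in>A. h' (f x))" for f and A :: "4 set"
    by (induction A rule: infinite_finite_induct) (simp_all add: h h')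
  have "h (monomial m) = h' (monomial m)" for m
    by (simp add: monomial_eq_prod prod pow X)
  then show ?thesis
    by (subst (1 2) as_sum_monomials[of p])
      (simp add: module_hom.sum[OF h(1)] module_hom.sum[OF h'(1)] module_hom.scale[OF h(1)] module_hom.scale[OF h'(1)])
qed

lemma lin_change_lin_change:
  "lin_change a (lin_change b p) = lin_change (a ** b) (p :: 'k::field S)"
proof (rule eq_on_X_imp_eq[where h="\<lambda>p. lin_change a (lin_change b p)"])
  fix j
  show "lin_change a (lin_change b (X j)) = lin_change (a ** b) (X j :: 'k S)"
  proof (rule poly_mapping_eqI)
    fix m
    show "Poly_Mapping.lookup (lin_change a (lin_change b (X j))) m =
      Poly_Mapping.lookup (lin_change (a ** b) (X j :: 'k S)) m"
      unfolding lin_change_X lin_change_sum smul_def[symmetric] lin_change_simps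
      by (simp add: lin_change_X lookup_sum smul_def[symmetric] matrix_matrix_mult_def sum_distrib_left
          sum_distrib_right mult.assoc mult.left_commute) (rule sum.swap)
  qed
qed (auto intro!: lin_change_linear module_hom.intro module_hom_axioms.intro pm.module_axioms)

lemma lin_change_one: "lin_change (mat 1) p = (p :: 'k::field S)"
proof (rule eq_on_X_imp_eq[where h'="\<lambda>p. p"])
  fix j
  have "lin_change (mat 1) (X j :: 'k S) = (\<Sum>i\<in>UNIV. if i = j then X i else 0)"
    unfolding lin_change_X by (intro sum.cong) (auto simp: mat_def)
  then show "lin_change (mat 1) (X j) = (X j :: 'k S)" by simp
qed (auto intro!: lin_change_linear module_hom.intro module_hom_axioms.intro pm.module_axioms)

lemma lin_change_inverse:
  fixes a :: "'k::field^4^4"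
  assumes "a ** b = mat 1"
  shows "lin_change a (lin_change b p) = p"
  by (simp add: lin_change_lin_change assms lin_change_one)

lemma homogeneous_lin_change_X: "homogeneous 1 (lin_change a (X j))"
  unfolding lin_change_X smul_def[symmetric]
  by (intro homogeneous_sum homogeneous_smul homogeneous_X)

lemma homogeneous_one [simp]: "homogeneous 0 1"
  by (simp add: homogeneous_def)

lemma homogeneous_prod:
  "(\<And>x. x \<in> A \<Longrightarrow> homogeneous (e x) (f x)) \<Longrightarrow> homogeneous (sum e A) (prod f A)"
  by (induction A rule: infinite_finite_induct) (auto intro: homogeneous_mult)

lemma homogeneous_lin_change:
  fixes p :: "'k::field S"
  assumes "homogeneous d p"
  shows "homogeneous d (lin_change a p)"
proof -
  have "homogeneous (mon_degree m) (lin_change a (monomial m :: 'k S))" for m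
    unfolding lin_change_monomial mon_degree_def
    using homogeneous_power[OF homogeneous_lin_change_X] by (intro homogeneous_prod) simp
  then have "homogeneous d (\<Sum>m\<in>hmons d. smul (Poly_Mapping.lookup p m) (lin_change a (monomial m)))"
    by (intro homogeneous_sum homogeneous_smul) (auto simp: hmons_def)
  then show ?thesis
    by (subst homogeneous_as_sum[OF assms]) (simp add: lin_change_sum)
qed

lemma hom_part_lin_change:
  fixes p :: "'k::field S"
  shows "hom_part d (lin_change a p) = lin_change a (hom_part d p)"
proof -
  have "hom_part d (lin_change a (monomial m)) = lin_change a (hom_part d (monomial m :: 'k S))" for m
    using homogeneous_lin_change[OF homogeneous_monomial[OF refl, of m], of a]
    by (simp add: hom_part_homogeneous[of "mon_degree m"] homogeneous_monomial)
  then show ?thesis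
    by (subst (1 2) as_sum_monomials[of p])
      (simp add: lin_change_sum module_hom.sum[OF hom_part_linear] module_hom.scale[OF hom_part_linear])
qed

section \<open>Openness of spanning conditions\<close>

lemma lookup_eq_0_on_span:
  assumes "p \<in> pm.span B" "\<And>b. b \<in> B \<Longrightarrow> Poly_Mapping.lookup b m = 0"
  shows "Poly_Mapping.lookup (p :: 'k::field S) m = 0"
  using assms by (induction rule: pm.span_induct_alt) (simp_all add: lookup_add)

lemma smul_in_span_iff:
  assumes "c \<noteq> (0 :: 'k::field)"
  shows "smul c p \<in> pm.span B \<longleftrightarrow> p \<in> pm.span B"
proof
  assume "smul c p \<in> pm.span B"
  then have "smul (1 / c) (smul c p) \<in> pm.span B" by (rule pm.span_scale)
  then show "p \<in> pm.span B" using assms by simp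
qed (rule pm.span_scale)

text \<open>Gaussian elimination: a nonzero coefficient of one member of the family serves as the pivot,
  and the pivots stay nonzero on a Zariski open set.\<close>
lemma spanning_is_open:
  fixes v :: "'i \<Rightarrow> 'b \<Rightarrow> 'k::field S"
  assumes "finite M"
    and "\<And>i b. i \<in> K \<Longrightarrow> b \<in> V \<Longrightarrow> Poly_Mapping.keys (v i b) \<subseteq> M"
    and "\<And>i m. i \<in> K \<Longrightarrow> polyfun_on coords V (\<lambda>b. Poly_Mapping.lookup (v i b) m)"
    and "b0 \<in> V" and "monomial ` M \<subseteq> pm.span ((\<lambda>i. v i b0) ` K)"
  shows "\<exists>D. polyfun_on coords V D \<and> D b0 \<noteq> 0 \<and>
    (\<forall>b\<in>V. D b \<noteq> 0 \<longrightarrow> monomial ` M \<subseteq> pm.span ((\<lambda>i. v i b) ` K))"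
  using assms
proof (induction M arbitrary: v rule: finite_induct)
  case empty
  show ?case by (rule exI[of _ "\<lambda>_. 1"]) (simp add: polyfun_on_const)
next
  case (insert m M)
  note keys = insert.prems(1) and pf = insert.prems(2) and b0 = insert.prems(3) and sp = insert.prems(4)
  have "\<exists>k\<in>K. Poly_Mapping.lookup (v k b0) m \<noteq> 0"
  proof (rule ccontr)
    assume none: "\<not> ?thesis"
    have "monomial m \<in> pm.span ((\<lambda>i. v i b0) ` K)" using sp by auto
    then have "Poly_Mapping.lookup (monomial m :: 'k S) m = 0"
      by (rule lookup_eq_0_on_span) (use none in auto)
    then show False by (simp add: lookup_monomial)
  qed
  then obtain k where k: "k \<in> K" "Poly_Mapping.lookup (v k b0) m \<noteq> 0" by blast
  \<comment> \<open>Cross-multiplication instead of division by the pivot keeps all coefficients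
    polynomial in b; the coefficient at m cancels.\<close>
  define w where "w i b = smul (Poly_Mapping.lookup (v k b) m) (v i b) -
    smul (Poly_Mapping.lookup (v i b) m) (v k b)" for i b
  have "\<exists>D. polyfun_on coords V D \<and> D b0 \<noteq> 0 \<and>
    (\<forall>b\<in>V. D b \<noteq> 0 \<longrightarrow> monomial ` M \<subseteq> pm.span ((\<lambda>i. w i b) ` K))"
  proof (rule insert.IH)
    fix i b assume ib: "i \<in> K" "b \<in> V"
    show "Poly_Mapping.keys (w i b) \<subseteq> M"
    proof
      fix n assume n: "n \<in> Poly_Mapping.keys (w i b)"
      then have "n \<in> Poly_Mapping.keys (v i b) \<union> Poly_Mapping.keys (v k b)"
        by (auto simp: w_def in_keys_iff lookup_minus)
      moreover have "n \<noteq> m" using n by (auto simp: w_def in_keys_iff lookup_minus)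
      ultimately show "n \<in> M" using keys[OF ib] keys[OF k(1) ib(2)] by auto
    qed
  next
    fix i n assume i: "i \<in> K"
    show "polyfun_on coords V (\<lambda>b. Poly_Mapping.lookup (w i b) n)"
      unfolding w_def lookup_minus lookup_smul
      by (intro polyfun_on_diff polyfun_on_mult pf i k)
  next
    show "b0 \<in> V" by (rule b0)
  next
    let ?a = "Poly_Mapping.lookup (v k b0) m"
    \<comment> \<open>This map sends \<open>v i b0\<close> to \<open>w i b0\<close> and multiplies
      every monomial of M by the pivot, so the spanning property passes from the family v to the
      family w.\<close>
    have lin: "module_hom smul smul (\<lambda>x. smul ?a x - smul (Poly_Mapping.lookup x m) (v k b0))"
      by unfold_locales (auto intro!: poly_mapping_eqI simp: lookup_add lookup_minus algebra_simps)
    show "monomial ` M \<subseteq> pm.span ((\<lambda>i. w i b0) ` K)"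
    proof
      fix x :: "'k S" assume "x \<in> monomial ` M"
      then obtain n where n: "n \<in> M" "x = monomial n" by auto
      have "x \<in> pm.span ((\<lambda>i. v i b0) ` K)" using sp n by auto
      then have "smul ?a x - smul (Poly_Mapping.lookup x m) (v k b0) \<in> pm.span ((\<lambda>i. w i b0) ` K)"
        by (rule linear_span_into[OF lin]) (auto simp: w_def intro!: pm.span_base)
      moreover have "n \<noteq> m" using n insert.hyps by auto
      ultimately show "x \<in> pm.span ((\<lambda>i. w i b0) ` K)"
        using k(2) by (simp add: n(2) lookup_monomial smul_in_span_iff)
    qed
  qed
  then obtain D where D: "polyfun_on coords V D" "D b0 \<noteq> 0"
    "\<And>b. b \<in> V \<Longrightarrow> D b \<noteq> 0 \<Longrightarrow> monomial ` M \<subseteq> pm.span ((\<lambda>i. w i b) ` K)" by blast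
  show ?case
  proof (intro exI[of _ "\<lambda>b. Poly_Mapping.lookup (v k b) m * D b"] conjI ballI impI)
    show "polyfun_on coords V (\<lambda>b. Poly_Mapping.lookup (v k b) m * D b)"
      by (intro polyfun_on_mult pf k D)
    show "Poly_Mapping.lookup (v k b0) m * D b0 \<noteq> 0" using k D by simp
    fix b assume b: "b \<in> V" "Poly_Mapping.lookup (v k b) m * D b \<noteq> 0"
    let ?U = "pm.span ((\<lambda>i. v i b) ` K)"
    have "w i b \<in> ?U" if "i \<in> K" for i
      unfolding w_def using that k(1) by (intro pm.span_diff pm.span_scale pm.span_base) auto
    then have "pm.span ((\<lambda>i. w i b) ` K) \<subseteq> ?U"
      by (intro pm.span_minimal) auto
    then have M: "monomial ` M \<subseteq> ?U" using D(3)[OF b(1)] b(2) by auto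
    \<comment> \<open>Back substitution: once the monomials of M are in the span, the pivot row
      \<open>v k b\<close> yields the monomial m.\<close>
    have "v k b = (\<Sum>n\<in>insert m M. Poly_Mapping.single n (Poly_Mapping.lookup (v k b) n))"
      by (rule poly_mapping_as_sum) (use insert.hyps keys[OF k(1) b(1)] in auto)
    also have "\<dots> = smul (Poly_Mapping.lookup (v k b) m) (monomial m) +
        (\<Sum>n\<in>M. smul (Poly_Mapping.lookup (v k b) n) (monomial n))"
      using insert.hyps by (simp add: smul_def monomial_def mult_single)
    finally have "smul (Poly_Mapping.lookup (v k b) m) (monomial m) =
        v k b - (\<Sum>n\<in>M. smul (Poly_Mapping.lookup (v k b) n) (monomial n))"
      unfolding eq_diff_eq by (rule sym)
    also have "\<dots> \<in> ?U"
      using M k(1) by (intro pm.span_diff pm.span_sum pm.span_scale) (auto intro: pm.span_base)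
    finally have "monomial m \<in> ?U"
      using b(2) by (simp add: smul_in_span_iff)
    then show "monomial ` insert m M \<subseteq> ?U" using M by simp
  qed
qed

text \<open>A fixed degree is part of the notion because it confines the support to the finite set
  \<open>hmons d\<close> for all b at once; products and linear images are then finite sums with
  polynomial coefficients.\<close>

definition coeffs_polyfun_on ::
  "('b \<Rightarrow> 'v \<Rightarrow> 'k::field) \<Rightarrow> 'b set \<Rightarrow> nat \<Rightarrow> ('b \<Rightarrow> 'k S) \<Rightarrow> bool" where
  "coeffs_polyfun_on coords V d F \<longleftrightarrow>
     (\<forall>b\<in>V. homogeneous d (F b)) \<and> (\<forall>m. polyfun_on coords V (\<lambda>b. Poly_Mapping.lookup (F b) m))"

lemma coeffs_polyfun_on_const: "homogeneous d p \<Longrightarrow> coeffs_polyfun_on coords V d (\<lambda>_. p)"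
  by (simp add: coeffs_polyfun_on_def polyfun_on_const)

lemma coeffs_polyfun_on_sum:
  "(\<And>x. x \<in> A \<Longrightarrow> coeffs_polyfun_on coords V d (F x)) \<Longrightarrow>
     coeffs_polyfun_on coords V d (\<lambda>b. \<Sum>x\<in>A. F x b)"
  unfolding coeffs_polyfun_on_def
  by (auto simp: lookup_sum intro: homogeneous_sum polyfun_on_sum)

lemma coeffs_polyfun_on_smul:
  "polyfun_on coords V c \<Longrightarrow> coeffs_polyfun_on coords V d F \<Longrightarrow>
     coeffs_polyfun_on coords V d (\<lambda>b. smul (c b) (F b))"
  unfolding coeffs_polyfun_on_def
  by (auto intro: homogeneous_smul polyfun_on_mult)

lemma coeffs_polyfun_on_cong:
  "coeffs_polyfun_on coords V d F \<Longrightarrow> (\<And>b. b \<in> V \<Longrightarrow> F b = G b) \<Longrightarrow> coeffs_polyfun_on coords V d G"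
  unfolding coeffs_polyfun_on_def by (auto intro: polyfun_on_cong)

lemma coeffs_polyfun_on_mult:
  assumes "coeffs_polyfun_on coords V d F" "coeffs_polyfun_on coords V e G"
  shows "coeffs_polyfun_on coords V (d + e) (\<lambda>b. F b * G b)"
proof -
  have "coeffs_polyfun_on coords V (d + e) (\<lambda>b. \<Sum>m\<in>hmons d. smul (Poly_Mapping.lookup (F b) m)
      (\<Sum>n\<in>hmons e. smul (Poly_Mapping.lookup (G b) n) (monomial (m + n))))"
    using assms
    by (intro coeffs_polyfun_on_sum coeffs_polyfun_on_smul coeffs_polyfun_on_const)
      (auto simp: coeffs_polyfun_on_def hmons_def intro!: homogeneous_monomial)
  then show ?thesis
  proof (rule coeffs_polyfun_on_cong)
    fix b assume "b \<in> V"
    then have "homogeneous d (F b)" "homogeneous e (G b)"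
      using assms by (auto simp: coeffs_polyfun_on_def)
    then have "F b * G b = (\<Sum>m\<in>hmons d. smul (Poly_Mapping.lookup (F b) m) (monomial m)) *
        (\<Sum>n\<in>hmons e. smul (Poly_Mapping.lookup (G b) n) (monomial n))"
      by (simp flip: homogeneous_as_sum)
    then show "(\<Sum>m\<in>hmons d. smul (Poly_Mapping.lookup (F b) m)
      (\<Sum>n\<in>hmons e. smul (Poly_Mapping.lookup (G b) n) (monomial (m + n)))) = F b * G b"
      by (simp add: sum_product smul_mult_left smul_mult_right monomial_add pm.scale_sum_right mult.commute)
  qed
qed

lemma coeffs_polyfun_on_power:
  "coeffs_polyfun_on coords V d F \<Longrightarrow> coeffs_polyfun_on coords V (n * d) (\<lambda>b. F b ^ n)"
  by (induction n) (auto intro: coeffs_polyfun_on_const coeffs_polyfun_on_mult)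

lemma coeffs_polyfun_on_prod:
  "(\<And>x. x \<in> A \<Longrightarrow> coeffs_polyfun_on coords V (e x) (F x)) \<Longrightarrow>
     coeffs_polyfun_on coords V (sum e A) (\<lambda>b. \<Prod>x\<in>A. F x b)"
  by (induction A rule: infinite_finite_induct)
    (auto intro: coeffs_polyfun_on_const coeffs_polyfun_on_mult)

lemma coeffs_polyfun_on_linear:
  assumes "module_hom smul smul h" "\<And>p. homogeneous d p \<Longrightarrow> homogeneous e (h p)"
    and "coeffs_polyfun_on coords V d F"
  shows "coeffs_polyfun_on coords V e (\<lambda>b. h (F b))"
proof -
  have "coeffs_polyfun_on coords V e (\<lambda>b. \<Sum>m\<in>hmons d. smul (Poly_Mapping.lookup (F b) m) (h (monomial m)))"
    using assms
    by (intro coeffs_polyfun_on_sum coeffs_polyfun_on_smul coeffs_polyfun_on_const)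
      (auto simp: coeffs_polyfun_on_def hmons_def intro!: homogeneous_monomial)
  then show ?thesis
  proof (rule coeffs_polyfun_on_cong)
    fix b assume "b \<in> V"
    then have "homogeneous d (F b)"
      using assms by (auto simp: coeffs_polyfun_on_def)
    then show "(\<Sum>m\<in>hmons d. smul (Poly_Mapping.lookup (F b) m) (h (monomial m))) = h (F b)"
      by (subst (3) homogeneous_as_sum) (simp_all add: module_hom.sum[OF assms(1)] module_hom.scale[OF assms(1)])
  qed
qed

lemma coeffs_polyfun_on_lin_change:
  fixes p :: "'k::field S"
  assumes "homogeneous d p"
  shows "coeffs_polyfun_on (\<lambda>a (i, j). a $ i $ j) V d (\<lambda>a. lin_change a p)"
proof -
  have X: "coeffs_polyfun_on (\<lambda>a (i, j). a $ i $ j) V 1 (\<lambda>a. lin_change a (X j :: 'k S))" for j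
    unfolding lin_change_X smul_def[symmetric]
    using polyfun_on_coord[of "\<lambda>a (i, j). a $ i $ j" V "(_, j)"]
    by (intro coeffs_polyfun_on_sum coeffs_polyfun_on_smul coeffs_polyfun_on_const homogeneous_X) simp
  have m: "coeffs_polyfun_on (\<lambda>a (i, j). a $ i $ j) V (mon_degree m) (\<lambda>a. lin_change a (monomial m :: 'k S))" for m
    unfolding lin_change_monomial mon_degree_def
    using coeffs_polyfun_on_power[OF X] by (intro coeffs_polyfun_on_prod) simp
  have "coeffs_polyfun_on (\<lambda>a (i, j). a $ i $ j) V d
      (\<lambda>a. \<Sum>m\<in>hmons d. smul (Poly_Mapping.lookup p m) (lin_change a (monomial m)))"
    using m by (intro coeffs_polyfun_on_sum coeffs_polyfun_on_smul polyfun_on_const) (auto simp: hmons_def)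
  then show ?thesis
    by (rule coeffs_polyfun_on_cong) (subst (2) homogeneous_as_sum[OF assms], simp add: lin_change_sum)
qed

definition cubic_coords :: "(4 \<Rightarrow> 'k::zero S) \<Rightarrow> 4 \<times> mon \<Rightarrow> 'k" where
  "cubic_coords = (\<lambda>f (i, m). Poly_Mapping.lookup (f i) m)"

lemma coeffs_polyfun_on_cubic: "coeffs_polyfun_on cubic_coords cubics4 3 (\<lambda>f. f i)"
  using polyfun_on_coord[of cubic_coords cubics4 "(i, _)"]
  by (auto simp: coeffs_polyfun_on_def cubics4_def cubic_coords_def)

text \<open>For cubics g and V of degree d + 3 this is the component of degree d + 3 of the ideal of
  the g i, enlarged by V. That it contains all monomials of this degree says that V spans the
  component modulo the ideal.\<close>

definition cubic_span :: "nat \<Rightarrow> mon set \<Rightarrow> (4 \<Rightarrow> 'k::field S) \<Rightarrow> 'k S set" where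
  "cubic_span d V g = pm.span ({monomial n * g i | n i. n \<in> hmons d} \<union> monomial ` V)"

lemma cubic_span_is_open:
  assumes "V \<subseteq> hmons (d + 3)" "g0 \<in> cubics4" "monomial ` hmons (d + 3) \<subseteq> cubic_span d V g0"
  shows "\<exists>D. polyfun_on cubic_coords cubics4 D \<and> D g0 \<noteq> 0 \<and>
    (\<forall>g\<in>cubics4. D g \<noteq> 0 \<longrightarrow> monomial ` hmons (d + 3) \<subseteq> cubic_span d V g)"
proof -
  define v where "v = (\<lambda>x (g :: 4 \<Rightarrow> 'a S). case x of Inl (n, i) \<Rightarrow> monomial n * g i | Inr n \<Rightarrow> monomial n)"
  \<comment> \<open>\<open>spanning_is_open\<close> takes an indexed family, so the varying
    multiples of the g i and the constant monomials of V are put side by side in a sum type.\<close>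
  define K where "K = (hmons d \<times> (UNIV :: 4 set)) <+> V"
  have im: "(\<lambda>x. v x g) ` K = {monomial n * g i | n i. n \<in> hmons d} \<union> monomial ` V" for g
    unfolding K_def Plus_def image_Un image_image by (auto simp: v_def image_iff)
  have cp: "coeffs_polyfun_on cubic_coords cubics4 (d + 3) (v x)" if "x \<in> K" for x
  proof (cases x)
    case (Inl y)
    then obtain n i where x: "x = Inl (n, i)" by (cases y) auto
    with that have "mon_degree n = d" by (auto simp: K_def hmons_def)
    then show ?thesis
      unfolding v_def x using homogeneous_monomial[of n d]
      by (auto intro!: coeffs_polyfun_on_mult coeffs_polyfun_on_const coeffs_polyfun_on_cubic)
  next
    case (Inr n)
    with that assms(1) have "mon_degree n = d + 3" by (auto simp: K_def hmons_def)
    then show ?thesis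
      unfolding v_def Inr by (auto intro!: coeffs_polyfun_on_const homogeneous_monomial)
  qed
  have "\<exists>D. polyfun_on cubic_coords cubics4 D \<and> D g0 \<noteq> 0 \<and>
    (\<forall>g\<in>cubics4. D g \<noteq> 0 \<longrightarrow> monomial ` hmons (d + 3) \<subseteq> pm.span ((\<lambda>x. v x g) ` K))"
  proof (rule spanning_is_open[OF finite_hmons])
    show "Poly_Mapping.keys (v x g) \<subseteq> hmons (d + 3)" if "x \<in> K" "g \<in> cubics4" for x g
      using cp[OF that(1)] that(2) by (auto simp: coeffs_polyfun_on_def homogeneous_def hmons_def)
    show "polyfun_on cubic_coords cubics4 (\<lambda>g. Poly_Mapping.lookup (v x g) m)" if "x \<in> K" for x m
      using cp[OF that] by (simp add: coeffs_polyfun_on_def)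
  qed (use assms in \<open>simp_all add: im cubic_span_def\<close>)
  then show ?thesis by (simp add: im cubic_span_def)
qed

section \<open>Leading monomials and standard monomials\<close>

lemma grevlex_less_irrefl: "\<not> grevlex_less m m"
  by (simp add: grevlex_less_def)

lemma grevlex_less_trans:
  assumes "grevlex_less l m" "grevlex_less m n"
  shows "grevlex_less l n"
proof (cases "mon_degree l = mon_degree m \<and> mon_degree m = mon_degree n")
  case False
  then show ?thesis using assms by (auto simp: grevlex_less_def)
next
  case True
  let ?l = "Poly_Mapping.lookup l" and ?m = "Poly_Mapping.lookup m" and ?n = "Poly_Mapping.lookup n"
  obtain i where i: "?l i > ?m i" "\<forall>j>i. ?l j = ?m j"
    using assms(1) True by (auto simp: grevlex_less_def)
  obtain k where k: "?m k > ?n k" "\<forall>j>k. ?m j = ?n j"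
    using assms(2) True by (auto simp: grevlex_less_def)
  have "?l (max i k) > ?n (max i k) \<and> (\<forall>j>max i k. ?l j = ?n j)"
    using i k by (cases i k rule: linorder_cases) (auto simp: max_def)
  then show ?thesis using True by (auto simp: grevlex_less_def)
qed

lemma grevlex_less_add: "grevlex_less m n \<Longrightarrow> grevlex_less (m + k) (n + k)"
  by (auto simp: grevlex_less_def lookup_add)

lemma finite_grevlex_less: "finite {n. grevlex_less n m}"
  by (rule finite_subset[OF _ finite_mon_degree_le[of "mon_degree m"]]) (auto simp: grevlex_less_def)

text \<open>Degrees are compared before anything else, so only finitely many monomials lie below a
  given one; their number is the induction measure.\<close>

lemma grevlex_induct [case_names less]:
  assumes "\<And>m. (\<And>n. grevlex_less n m \<Longrightarrow> P n) \<Longrightarrow> P m"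
  shows "P m"
proof (induction "card {n. grevlex_less n m}" arbitrary: m rule: less_induct)
  case less
  show ?case
  proof (rule assms)
    fix n assume n: "grevlex_less n m"
    have "{k. grevlex_less k n} \<subset> {k. grevlex_less k m}"
      using n grevlex_less_trans grevlex_less_irrefl by blast
    then show "P n"
      by (intro less psubset_card_mono finite_grevlex_less)
  qed
qed

definition leading_mons :: "'k::zero S set \<Rightarrow> mon set" where
  "leading_mons I = {m. \<exists>p\<in>I. is_leading_mon p m}"

text \<open>The monomial is an element of I plus a combination of smaller monomials, and that
  element has leading monomial m. Every generator of the two forms is found in this way.\<close>

lemma leading_monI:
  fixes I :: "'k::field S set"
  assumes "pm.subspace I" and m: "monomial m \<in> pm.span (I \<union> monomial ` V)"
    and V: "\<And>n. n \<in> V \<Longrightarrow> grevlex_less n m"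
  shows "m \<in> leading_mons I"
proof -
  obtain x y where xy: "monomial m = x + y" "x \<in> pm.span I" "y \<in> pm.span (monomial ` V)"
    using m unfolding pm.span_Un by auto
  have y: "Poly_Mapping.lookup y n = 0" if "n \<notin> V" for n
    by (rule lookup_eq_0_on_span[OF xy(3)]) (use that in \<open>auto simp: lookup_monomial\<close>)
  have "x \<in> I" using xy(2) assms(1) by (metis pm.span_eq_iff)
  have x: "Poly_Mapping.lookup x n = (if n = m then 1 else 0) - Poly_Mapping.lookup y n" for n
    using arg_cong[OF xy(1), of "\<lambda>p. Poly_Mapping.lookup p n"]
    by (simp add: lookup_add lookup_monomial algebra_simps)
  have "m \<notin> V" using V grevlex_less_irrefl by blast
  have "is_leading_mon x m"
    unfolding is_leading_mon_def
  proof (intro conjI ballI impI)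
    show "m \<in> Poly_Mapping.keys x"
      using x[of m] y[OF \<open>m \<notin> V\<close>] by (simp add: in_keys_iff)
    fix n assume "n \<in> Poly_Mapping.keys x" "n \<noteq> m"
    then have "n \<in> V" using x[of n] y[of n] by (auto simp: in_keys_iff)
    then show "grevlex_less n m" by (rule V)
  qed
  then show ?thesis using \<open>x \<in> I\<close> by (auto simp: leading_mons_def)
qed

lemma lookup_monomial_mult_add:
  "Poly_Mapping.lookup (monomial k * p) (k + n) = Poly_Mapping.lookup (p :: 'k::field S) n"
proof -
  have "Poly_Mapping.lookup (monomial k * p) (k + n) =
      (\<Sum>m\<in>Poly_Mapping.keys p. Poly_Mapping.lookup p m * (if m = n then 1 else 0))"
    by (subst as_sum_monomials[of p])
      (simp add: sum_distrib_left smul_mult_right lookup_sum lookup_monomial monomial_add[symmetric] eq_commute)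
  also have "\<dots> = Poly_Mapping.lookup p n"
    by (auto simp: if_distrib in_keys_iff cong: if_cong)
  finally show ?thesis .
qed

lemma leading_mons_add:
  fixes I :: "'k::field S set"
  assumes "\<And>p k. p \<in> I \<Longrightarrow> monomial k * p \<in> I" and "m \<in> leading_mons I"
  shows "k + m \<in> leading_mons I"
proof -
  obtain p where p: "p \<in> I" "is_leading_mon p m"
    using assms(2) by (auto simp: leading_mons_def)
  have "is_leading_mon (monomial k * p) (k + m)"
    unfolding is_leading_mon_def
  proof (intro conjI ballI impI)
    show "k + m \<in> Poly_Mapping.keys (monomial k * p)"
      using p(2) by (simp add: is_leading_mon_def in_keys_iff lookup_monomial_mult_add)
    fix n assume n: "n \<in> Poly_Mapping.keys (monomial k * p)" "n \<noteq> k + m"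
    then obtain l where l: "n = k + l" "l \<in> Poly_Mapping.keys p"
      using keys_mult[of "monomial k :: 'k S" p] by auto
    then show "grevlex_less n (k + m)"
      using n(2) p(2) grevlex_less_add[of l m k] by (auto simp: is_leading_mon_def add.commute)
  qed
  then show ?thesis using assms(1) p(1) by (auto simp: leading_mons_def)
qed

text \<open>Macaulay's reduction: a monomial outside B leads some p in I and is thus congruent to a
  combination of the other, smaller monomials of p, to which induction applies.\<close>

lemma monomials_span_mod:
  fixes I :: "'k::field S set"
  assumes I: "pm.subspace I" and B: "\<And>m. m \<in> leading_mons I \<or> m \<in> B"
  shows "monomial m \<in> pm.span (I \<union> monomial ` B)"
proof (induction m rule: grevlex_induct)
  case (less m)
  show ?case
  proof (cases "m \<in> B")
    case True
    then show ?thesis by (intro pm.span_base) auto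
  next
    case False
    then obtain p where p: "p \<in> I" "is_leading_mon p m"
      using B[of m] by (auto simp: leading_mons_def)
    let ?c = "Poly_Mapping.lookup p"
    have m: "m \<in> Poly_Mapping.keys p" using p(2) by (simp add: is_leading_mon_def)
    have "p = smul (?c m) (monomial m) + (\<Sum>n\<in>Poly_Mapping.keys p - {m}. smul (?c n) (monomial n))"
      using as_sum_monomials[of p] m by (simp add: sum.remove)
    then have "smul (?c m) (monomial m) = p - (\<Sum>n\<in>Poly_Mapping.keys p - {m}. smul (?c n) (monomial n))"
      unfolding eq_diff_eq by (rule sym)
    also have "\<dots> \<in> pm.span (I \<union> monomial ` B)"
      using p less by (intro pm.span_diff pm.span_sum pm.span_scale)
        (auto simp: is_leading_mon_def intro: pm.span_base)
    finally show ?thesis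
      using m by (simp add: smul_in_span_iff in_keys_iff)
  qed
qed

definition cube_mons :: "nat \<Rightarrow> mon set" where
  "cube_mons d = {m \<in> hmons d. \<exists>i. 3 \<le> Poly_Mapping.lookup m i}"

text \<open>The Hilbert function of S/I dominates that of S modulo the four cubes.\<close>
definition dim_bounded :: "'k::field S set \<Rightarrow> bool" where
  "dim_bounded I \<longleftrightarrow> (\<forall>d\<le>8. \<exists>F. finite F \<and> card F \<le> card (cube_mons d) \<and> hom_part d ` I \<subseteq> pm.span F)"

lemma independent_monomials: "pm.independent (monomial ` A :: 'k::field S set)"
proof
  assume "pm.dependent (monomial ` A :: 'k S set)"
  then obtain m where m: "m \<in> A" "monomial m \<in> pm.span (monomial ` A - {monomial m :: 'k S})"
    unfolding pm.dependent_def by auto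
  have "Poly_Mapping.lookup (monomial m :: 'k S) m = 0"
    by (rule lookup_eq_0_on_span[OF m(2)]) (auto simp: lookup_monomial)
  then show False by (simp add: lookup_monomial)
qed

lemma card_cube_free_mons: "card {m :: mon. \<forall>i. Poly_Mapping.lookup m i < 3} = 81"
proof -
  let ?A = "{m :: mon. \<forall>i. Poly_Mapping.lookup m i < 3}"
  have "bij_betw Poly_Mapping.lookup ?A (PiE UNIV (\<lambda>_. {..<3}))"
    unfolding bij_betw_def
  proof
    show "inj_on Poly_Mapping.lookup ?A" by (auto intro: inj_onI poly_mapping_eqI)
    show "Poly_Mapping.lookup ` ?A = PiE UNIV (\<lambda>_. {..<3})"
    proof
      show "PiE UNIV (\<lambda>_. {..<3}) \<subseteq> Poly_Mapping.lookup ` ?A"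
      proof
        fix f :: "4 \<Rightarrow> nat" assume f: "f \<in> PiE UNIV (\<lambda>_. {..<3})"
        have "finite {x. f x \<noteq> 0}" by simp
        then have eq: "f = Poly_Mapping.lookup (Abs_poly_mapping f)" by simp
        have "f i < 3" for i using f by (auto simp: PiE_iff)
        then have "Abs_poly_mapping f \<in> ?A" by (simp flip: eq)
        with eq show "f \<in> Poly_Mapping.lookup ` ?A" by (rule image_eqI)
      qed
    qed auto
  qed
  then have "card ?A = card (PiE (UNIV :: 4 set) (\<lambda>_. {..<3::nat}))"
    by (rule bij_betw_same_card)
  then show ?thesis by (simp add: card_PiE)
qed

lemma mon_degree_cube_free:
  assumes "\<forall>i. Poly_Mapping.lookup m i < 3"
  shows "mon_degree m \<le> 8"
proof -
  have "mon_degree m \<le> (\<Sum>i\<in>(UNIV :: 4 set). 2)"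
    unfolding mon_degree_def using assms by (intro sum_mono) (simp add: less_Suc_eq_le numeral_eq_Suc)
  then show ?thesis by simp
qed

text \<open>In degree d the set F, whose span contains the degree d part of I, and the monomials of
  B together span everything. So B has at least as many members of degree d as there are monomials
  with all exponents below 3. These end in degree 8 and number 3^4 in all.\<close>

lemma card_standard_ge:
  fixes I :: "'k::field S set"
  assumes I: "pm.subspace I" and dim: "dim_bounded I"
    and B: "finite B" "\<And>m. m \<in> leading_mons I \<or> m \<in> B"
  shows "81 \<le> card B"
proof -
  define free where "free d = {m \<in> hmons d. \<forall>i. Poly_Mapping.lookup m i < 3}" for d
  have step: "card (free d) \<le> card (B \<inter> hmons d)" if d: "d \<le> 8" for d
  proof -
    obtain F where F: "finite F" "card F \<le> card (cube_mons d)" "hom_part d ` I \<subseteq> pm.span F"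
      using dim d unfolding dim_bounded_def by blast
    let ?T = "F \<union> monomial ` (B \<inter> hmons d)"
    have "monomial ` hmons d \<subseteq> pm.span ?T"
    proof
      fix x :: "'k S" assume "x \<in> monomial ` hmons d"
      then obtain m where m: "mon_degree m = d" "x = monomial m" by (auto simp: hmons_def)
      have "hom_part d (monomial m) \<in> pm.span ?T"
      proof (rule linear_span_into[OF hom_part_linear monomials_span_mod[OF I B(2)]])
        fix b :: "'k S" assume "b \<in> I \<union> monomial ` B"
        then consider "b \<in> I" | n where "n \<in> B" "b = monomial n" by auto
        then show "hom_part d b \<in> pm.span ?T"
        proof cases
          case 1
          then show ?thesis using F(3) pm.span_mono[of F ?T] by auto
        next
          case 2
          then show ?thesis
            using homogeneous_monomial[OF refl, of n, where ?'k='k]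
            by (auto simp: hom_part_homogeneous[of "mon_degree n"] hmons_def pm.span_zero intro!: pm.span_base)
        qed
      qed
      then show "x \<in> pm.span ?T"
        using homogeneous_monomial[OF m(1), where ?'k='k] by (simp add: hom_part_homogeneous m(2))
    qed
    from pm.independent_span_bound[OF _ independent_monomials this]
    have "card (monomial ` hmons d :: 'k S set) \<le> card ?T"
      using F(1) B(1) by simp
    also have "\<dots> \<le> card F + card (monomial ` (B \<inter> hmons d) :: 'k S set)" by (rule card_Un_le)
    also have "card (monomial ` (B \<inter> hmons d) :: 'k S set) = card (B \<inter> hmons d)"
      by (intro card_image inj_on_subset[OF inj_monomial]) simp
    also have "card (monomial ` hmons d :: 'k S set) = card (hmons d)"
      by (intro card_image inj_on_subset[OF inj_monomial]) simp
    also have "hmons d = cube_mons d \<union> free d"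
      unfolding cube_mons_def free_def by (auto simp flip: not_less)
    also have "card (cube_mons d \<union> free d) = card (cube_mons d) + card (free d)"
      by (rule card_Un_disjoint) (auto simp: cube_mons_def free_def simp flip: not_less)
    finally show ?thesis using F(2) \<open>hmons d = cube_mons d \<union> free d\<close> by simp
  qed
  have "{m :: mon. \<forall>i. Poly_Mapping.lookup m i < 3} = (\<Union>d\<le>8. free d)"
    using mon_degree_cube_free by (auto simp: free_def hmons_def)
  then have "81 = card (\<Union>d\<le>8. free d)"
    by (simp flip: card_cube_free_mons)
  also have "\<dots> = (\<Sum>d\<le>8. card (free d))"
  proof (rule card_UN_disjoint)
    show "\<forall>d\<in>{..8}. finite (free d)" by (simp add: free_def)
  qed (auto simp: free_def hmons_def)
  also have "\<dots> \<le> (\<Sum>d\<le>8. card (B \<inter> hmons d))"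
    using step by (intro sum_mono) auto
  also have "\<dots> = card (\<Union>d\<le>8. B \<inter> hmons d)"
    using B(1) by (intro card_UN_disjoint[symmetric]) (auto simp: hmons_def)
  also have "\<dots> \<le> card B" using B(1) by (intro card_mono) auto
  finally show ?thesis .
qed

definition standard_mons :: "mon set \<Rightarrow> mon set" where
  "standard_mons G = {m. \<forall>g\<in>G. \<forall>k. m \<noteq> k + g}"

text \<open>If a standard monomial m of G were leading for I, the standard monomials other than m
  would still cover all non-leading monomials, with fewer than 81 elements. The upper bound for G
  and the lower bound for I thus leave no room for further leading monomials.\<close>

lemma initial_ideal_eqI:
  fixes I :: "'k::field S set"
  assumes I: "pm.subspace I" "\<And>p k. p \<in> I \<Longrightarrow> monomial k * p \<in> I" and dim: "dim_bounded I"
    and G: "G \<subseteq> leading_mons I"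
    and std: "finite (standard_mons G)" "card (standard_mons G) \<le> 81"
  shows "initial_ideal I = ideal_gen (monomial ` G)"
proof -
  have covered: "m \<in> leading_mons I \<or> m \<in> standard_mons G" for m
    using G leading_mons_add[OF I(2)] by (auto simp: standard_mons_def)
  have disj: "m \<notin> standard_mons G" if "m \<in> leading_mons I" for m
  proof
    assume m: "m \<in> standard_mons G"
    have "81 \<le> card (standard_mons G - {m})"
      using covered that std(1) by (intro card_standard_ge[OF I(1) dim]) auto
    moreover have "card (standard_mons G - {m}) < card (standard_mons G)"
      using std(1) m by (rule card_Diff1_less)
    ultimately show False using std(2) by simp
  qed
  have "ideal_gen (monomial ` leading_mons I) = ideal_gen (monomial ` G :: 'k S set)"
  proof
    show "ideal_gen (monomial ` leading_mons I) \<subseteq> ideal_gen (monomial ` G :: 'k S set)"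
    proof (rule idl.span_minimal)
      show "monomial ` leading_mons I \<subseteq> ideal_gen (monomial ` G :: 'k S set)"
      proof
        fix x :: "'k S" assume "x \<in> monomial ` leading_mons I"
        then obtain m where m: "x = monomial m" "m \<in> leading_mons I" by auto
        then obtain g k where "g \<in> G" "m = k + g"
          using disj unfolding standard_mons_def by blast
        then show "x \<in> ideal_gen (monomial ` G)"
          by (auto simp: m(1) monomial_add intro: idl.span_scale idl.span_base)
      qed
    qed simp
    show "ideal_gen (monomial ` G :: 'k S set) \<subseteq> ideal_gen (monomial ` leading_mons I)"
      by (intro idl.span_mono image_mono G)
  qed
  moreover have "{monomial m | m. \<exists>p\<in>I. is_leading_mon p m} = (monomial ` leading_mons I :: 'k S set)"
    by (auto simp: leading_mons_def)
  ultimately show ?thesis by (simp add: initial_ideal_def)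
qed

section \<open>The dimension bound\<close>

definition cube_index :: "mon \<Rightarrow> 4" where
  "cube_index m = (LEAST i. 3 \<le> Poly_Mapping.lookup m i)"

text \<open>The division of m by the cubes of the variables, with f i in place of the cube of the
  variable i.\<close>
definition cube_subst :: "(4 \<Rightarrow> 'k::field S) \<Rightarrow> mon \<Rightarrow> 'k S" where
  "cube_subst f m = monomial (m - Poly_Mapping.single (cube_index m) 3) * f (cube_index m)"

definition partial_cube_subst :: "4 \<Rightarrow> (4 \<Rightarrow> 'k::field S) \<Rightarrow> mon \<Rightarrow> 'k S" where
  "partial_cube_subst j f m = (if \<exists>i<j. 3 \<le> Poly_Mapping.lookup m i then cube_subst f m else monomial m)"

text \<open>Modulo multiples of the f i with i < j, the monomials whose exponents at these i stay
  below 3 span degree e, as they do for the cubes. This is a spanning condition, hence open. The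
  bound 5 on e matches the bound 8 in \<open>dim_bounded\<close>, after multiplication by a
  cubic.\<close>

definition cube_like :: "(4 \<Rightarrow> 'k::field S) \<Rightarrow> bool" where
  "cube_like f \<longleftrightarrow> (\<forall>j. \<forall>e\<le>5. monomial ` hmons e \<subseteq> pm.span (partial_cube_subst j f ` hmons e))"

lemma minus_single_add:
  assumes "3 \<le> Poly_Mapping.lookup m i"
  shows "m - Poly_Mapping.single i 3 + Poly_Mapping.single i 3 = (m :: mon)"
  by (rule poly_mapping_eqI) (use assms in \<open>auto simp: lookup_add lookup_minus lookup_single when_def\<close>)

lemma cube_index_le: "3 \<le> Poly_Mapping.lookup m i \<Longrightarrow> 3 \<le> Poly_Mapping.lookup m (cube_index m)"
  unfolding cube_index_def by (rule LeastI)

text \<open>The induction on j absorbs the Koszul relations. After n is rewritten by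
  \<open>cube_like\<close>, a term k f_i with i < j gives (k f_j) f_i, where k f_j is a combination
  of monomials and the index has dropped to i. Any other term times f_j is itself a substituted
  monomial, with j as first index of exponent at least 3.\<close>

lemma mult_mem_cube_subst_span:
  fixes f :: "4 \<Rightarrow> 'k::field S"
  assumes f: "f \<in> cubics4" and cl: "cube_like f" and e: "e \<le> 5"
  shows "n \<in> hmons e \<Longrightarrow> monomial n * f j \<in> pm.span (cube_subst f ` cube_mons (e + 3))"
proof (induction j arbitrary: n rule: less_induct)
  case (less j)
  let ?R = "pm.span (cube_subst f ` cube_mons (e + 3))"
  have "monomial n \<in> pm.span (partial_cube_subst j f ` hmons e)"
    using cl e less.prems unfolding cube_like_def by blast
  then show ?case
  proof (rule linear_span_into[OF mult_linear_right])
    fix b assume "b \<in> partial_cube_subst j f ` hmons e"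
    then obtain m where m: "m \<in> hmons e" "b = partial_cube_subst j f m" by auto
    show "b * f j \<in> ?R"
    proof (cases "\<exists>i<j. 3 \<le> Poly_Mapping.lookup m i")
      case True
      define i where "i = cube_index m"
      have i: "3 \<le> Poly_Mapping.lookup m i" using True cube_index_le i_def by blast
      have "i < j" using True unfolding i_def cube_index_def by (meson Least_le le_less_trans)
      let ?k = "m - Poly_Mapping.single i 3"
      have "mon_degree (?k + Poly_Mapping.single i 3) = e"
        using m(1) i by (simp add: minus_single_add hmons_def)
      then have "homogeneous e (monomial ?k * f j)"
        using homogeneous_mult[OF homogeneous_monomial[OF refl], of 3 "f j" ?k] f
        by (simp add: cubics4_def)
      then have "monomial ?k * f j \<in> pm.span (monomial ` hmons e)"
        by (simp add: homogeneous_iff_span)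
      then have "(monomial ?k * f j) * f i \<in> ?R"
        by (rule linear_span_into[OF mult_linear_right]) (auto intro: less.IH \<open>i < j\<close>)
      then show ?thesis
        using True by (simp add: m(2) partial_cube_subst_def cube_subst_def i_def mult.commute mult.left_commute)
    next
      case False
      let ?m = "m + Poly_Mapping.single j 3"
      have "cube_index ?m = j"
        unfolding cube_index_def
      proof (rule Least_equality)
        fix i assume "3 \<le> Poly_Mapping.lookup ?m i"
        then show "j \<le> i"
          using False by (cases "i = j") (auto simp: lookup_add lookup_single when_def not_less[symmetric])
      qed (simp add: lookup_add)
      then have "b * f j = cube_subst f ?m"
        unfolding m(2) partial_cube_subst_def if_not_P[OF False] by (simp add: cube_subst_def)
      moreover have "3 \<le> Poly_Mapping.lookup ?m j" by (simp add: lookup_add)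
      then have "?m \<in> cube_mons (e + 3)"
        using m(1) by (auto simp: cube_mons_def hmons_def)
      ultimately show ?thesis by (auto intro: pm.span_base)
    qed
  qed
qed

lemma hom_part_ideal_gen:
  fixes g :: "4 \<Rightarrow> 'k::field S"
  assumes "g \<in> cubics4" "p \<in> ideal_gen (range g)"
  shows "hom_part (d + 3) p \<in> pm.span {monomial n * g i | n i. n \<in> hmons d}"
    and "d < 3 \<Longrightarrow> hom_part d p = 0"
proof -
  have p: "p \<in> pm.span {monomial n * a | n a. a \<in> range g}"
    using assms(2) by (simp add: ideal_gen_eq_span)
  have h: "homogeneous (mon_degree n + 3) (monomial n * g i)" for n i
    using assms(1) by (intro homogeneous_mult homogeneous_monomial) (auto simp: cubics4_def)
  show "hom_part (d + 3) p \<in> pm.span {monomial n * g i | n i. n \<in> hmons d}"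
    using p
  proof (rule linear_span_into[OF hom_part_linear])
    fix b assume "b \<in> {monomial n * a | n a. a \<in> range g}"
    then obtain n i where b: "b = monomial n * g i" by auto
    show "hom_part (d + 3) b \<in> pm.span {monomial n * g i | n i. n \<in> hmons d}"
      unfolding b hom_part_homogeneous[OF h]
      by (cases "mon_degree n = d") (auto simp: hmons_def intro: pm.span_base pm.span_zero)
  qed
  show "hom_part d p = 0" if "d < 3"
  proof -
    have "hom_part d p \<in> pm.span {}"
      using p
    proof (rule linear_span_into[OF hom_part_linear])
      fix b assume "b \<in> {monomial n * a | n a. a \<in> range g}"
      then obtain n i where b: "b = monomial n * g i" by auto
      show "hom_part d b \<in> pm.span {}"
        unfolding b hom_part_homogeneous[OF h] using that by simp
    qed
    then show ?thesis by simp
  qed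
qed

lemma dim_bounded_ideal_gen:
  fixes f :: "4 \<Rightarrow> 'k::field S"
  assumes f: "f \<in> cubics4" and cl: "cube_like f"
  shows "dim_bounded (ideal_gen (range f))"
  unfolding dim_bounded_def
proof (intro allI impI)
  fix d :: nat assume d: "d \<le> 8"
  have fin: "finite (cube_mons d)" by (simp add: cube_mons_def)
  show "\<exists>F. finite F \<and> card F \<le> card (cube_mons d) \<and> hom_part d ` ideal_gen (range f) \<subseteq> pm.span F"
  proof (cases "d < 3")
    case True
    then have "hom_part d ` ideal_gen (range f) \<subseteq> pm.span {}"
      using hom_part_ideal_gen(2)[OF f] by auto
    then show ?thesis by (intro exI[of _ "{}"]) simp
  next
    case False
    then obtain e where e: "d = e + 3" by (metis add.commute le_Suc_ex not_less)
    have "hom_part d ` ideal_gen (range f) \<subseteq> pm.span (cube_subst f ` cube_mons d)"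
    proof
      fix x assume "x \<in> hom_part d ` ideal_gen (range f)"
      then have "x \<in> pm.span {monomial n * f i | n i. n \<in> hmons e}"
        using hom_part_ideal_gen(1)[OF f] e by auto
      moreover have "{monomial n * f i | n i. n \<in> hmons e} \<subseteq> pm.span (cube_subst f ` cube_mons d)"
        using mult_mem_cube_subst_span[OF f cl] d e by auto
      ultimately show "x \<in> pm.span (cube_subst f ` cube_mons d)"
        using pm.span_minimal[OF _ pm.subspace_span] by blast
    qed
    then show ?thesis using fin by (meson card_image_le finite_imageI)
  qed
qed

lemma dim_bounded_lin_change:
  assumes "dim_bounded I"
  shows "dim_bounded (lin_change a ` I)"
  unfolding dim_bounded_def
proof (intro allI impI)
  fix d :: nat assume "d \<le> 8"
  then obtain F where F: "finite F" "card F \<le> card (cube_mons d)" "hom_part d ` I \<subseteq> pm.span F"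
    using assms unfolding dim_bounded_def by blast
  have "hom_part d ` lin_change a ` I = lin_change a ` hom_part d ` I"
    by (simp add: image_image hom_part_lin_change)
  also have "\<dots> \<subseteq> pm.span (lin_change a ` F)"
    using F(3) linear_span_image[OF lin_change_linear] by blast
  finally show "\<exists>F. finite F \<and> card F \<le> card (cube_mons d) \<and> hom_part d ` lin_change a ` I \<subseteq> pm.span F"
    using F(1,2) by (meson card_image_le finite_imageI order_trans)
qed

lemma cube_like_cubes: "cube_like (\<lambda>i. X i ^ 3 :: 'k::field S)"
proof -
  have "partial_cube_subst j (\<lambda>i. X i ^ 3) m = (monomial m :: 'k S)" for j m
    using cube_index_le[of m]
    by (auto simp: partial_cube_subst_def cube_subst_def minus_single_add
        monomial_single_power[symmetric] monomial_add[symmetric])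
  then show ?thesis by (auto simp: cube_like_def intro: pm.span_base)
qed

text \<open>The product of the finitely many witnesses is nonzero exactly where all of them are, in
  particular at the common point b0.\<close>

lemma polyfun_on_fun_prod:
  assumes "finite A" "\<And>x. x \<in> A \<Longrightarrow> \<exists>D. polyfun_on coords V D \<and> D b0 \<noteq> (0 :: 'k::field) \<and> (\<forall>b\<in>V. D b \<noteq> 0 \<longrightarrow> P x b)"
  shows "\<exists>D. polyfun_on coords V D \<and> D b0 \<noteq> (0 :: 'k) \<and> (\<forall>b\<in>V. D b \<noteq> 0 \<longrightarrow> (\<forall>x\<in>A. P x b))"
proof -
  obtain D where D: "\<And>x. x \<in> A \<Longrightarrow> polyfun_on coords V (D x) \<and> D x b0 \<noteq> 0 \<and> (\<forall>b\<in>V. D x b \<noteq> 0 \<longrightarrow> P x b)"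
    using assms(2) by metis
  show ?thesis
  proof (intro exI[of _ "\<lambda>b. \<Prod>x\<in>A. D x b"] conjI)
    show "polyfun_on coords V (\<lambda>b. \<Prod>x\<in>A. D x b)" using D by (intro polyfun_on_prod) auto
    show "(\<Prod>x\<in>A. D x b0) \<noteq> 0" using D assms(1) by simp
    show "\<forall>b\<in>V. (\<Prod>x\<in>A. D x b) \<noteq> 0 \<longrightarrow> (\<forall>x\<in>A. P x b)" using D assms(1) by simp
  qed
qed

lemma cube_like_is_open:
  assumes f0: "f0 \<in> cubics4" and cl: "cube_like (f0 :: 4 \<Rightarrow> 'k::field S)"
  shows "\<exists>D. polyfun_on cubic_coords cubics4 D \<and> D f0 \<noteq> 0 \<and> (\<forall>f\<in>cubics4. D f \<noteq> 0 \<longrightarrow> cube_like f)"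
proof -
  have "\<exists>D. polyfun_on cubic_coords cubics4 D \<and> D f0 \<noteq> 0 \<and>
      (\<forall>f\<in>cubics4. D f \<noteq> 0 \<longrightarrow> monomial ` hmons e \<subseteq> pm.span (partial_cube_subst j f ` hmons e))"
    if e: "e \<le> 5" for j e
  proof -
    have cp: "coeffs_polyfun_on cubic_coords cubics4 e (\<lambda>f :: 4 \<Rightarrow> 'k S. partial_cube_subst j f m)"
      if m: "m \<in> hmons e" for m
    proof (cases "\<exists>i<j. 3 \<le> Poly_Mapping.lookup m i")
      case True
      then have c: "3 \<le> Poly_Mapping.lookup m (cube_index m)" using cube_index_le by blast
      let ?k = "m - Poly_Mapping.single (cube_index m) 3"
      have "mon_degree ?k + 3 = e"
        using m arg_cong[OF minus_single_add[OF c], of mon_degree] by (simp add: hmons_def)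
      moreover have "coeffs_polyfun_on cubic_coords cubics4 (mon_degree ?k + 3)
          (\<lambda>f :: 4 \<Rightarrow> 'k S. monomial ?k * f (cube_index m))"
        by (intro coeffs_polyfun_on_mult coeffs_polyfun_on_const coeffs_polyfun_on_cubic homogeneous_monomial) simp
      ultimately show ?thesis
        using True by (simp add: partial_cube_subst_def cube_subst_def)
    next
      case False
      then show ?thesis
        using m unfolding partial_cube_subst_def if_not_P[OF False]
        by (simp add: coeffs_polyfun_on_const homogeneous_monomial hmons_def)
    qed
    show ?thesis
    proof (rule spanning_is_open[where v="\<lambda>m f. partial_cube_subst j f m", OF finite_hmons])
      show "Poly_Mapping.keys (partial_cube_subst j f m) \<subseteq> hmons e" if "m \<in> hmons e" "f \<in> cubics4"
        for m and f :: "4 \<Rightarrow> 'k S"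
        using cp[OF that(1)] that(2) by (auto simp: coeffs_polyfun_on_def homogeneous_def hmons_def)
      show "polyfun_on cubic_coords cubics4 (\<lambda>f :: 4 \<Rightarrow> 'k S. Poly_Mapping.lookup (partial_cube_subst j f n) m)"
        if "n \<in> hmons e" for n m
        using cp[OF that] by (simp add: coeffs_polyfun_on_def)
    qed (use f0 cl e in \<open>auto simp: cube_like_def\<close>)
  qed
  then have "\<exists>D. polyfun_on cubic_coords cubics4 D \<and> D f0 \<noteq> 0 \<and> (\<forall>f\<in>cubics4. D f \<noteq> 0 \<longrightarrow>
      (\<forall>x\<in>UNIV \<times> {..5}. monomial ` hmons (snd x) \<subseteq> pm.span (partial_cube_subst (fst x) f ` hmons (snd x))))"
    by (intro polyfun_on_fun_prod) auto
  then show ?thesis unfolding cube_like_def by fastforce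
qed

section \<open>The two monomial ideals\<close>

lemma type_4_neq [simp]: "(0::4) \<noteq> 1" "(0::4) \<noteq> 2" "(0::4) \<noteq> 3" "(1::4) \<noteq> 2" "(1::4) \<noteq> 3" "(2::4) \<noteq> 3"
  "(1::4) \<noteq> 0" "(2::4) \<noteq> 0" "(3::4) \<noteq> 0" "(2::4) \<noteq> 1" "(3::4) \<noteq> 1" "(3::4) \<noteq> 2"
  using type_4_order by auto

lemma all_type_4: "(\<forall>i::4. P i) \<longleftrightarrow> P 0 \<and> P 1 \<and> P 2 \<and> P 3"
proof -
  have "(\<forall>i::4. P i) \<longleftrightarrow> (\<forall>i\<in>UNIV. P i)" by simp
  then show ?thesis unfolding UNIV_type_4 by simp
qed

lemma sum_type_4: "(\<Sum>i\<in>(UNIV::4 set). f i) = f 0 + f 1 + f 2 + (f 3 :: 'a::comm_monoid_add)"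
  unfolding UNIV_type_4 by (simp add: add.assoc)

definition mon4 :: "nat \<Rightarrow> nat \<Rightarrow> nat \<Rightarrow> nat \<Rightarrow> mon" where
  "mon4 a b c d = Poly_Mapping.single 0 a + Poly_Mapping.single 1 b +
     Poly_Mapping.single 2 c + Poly_Mapping.single 3 d"

lemma lookup_mon4 [simp]:
  "Poly_Mapping.lookup (mon4 a b c d) 0 = a" "Poly_Mapping.lookup (mon4 a b c d) 1 = b"
  "Poly_Mapping.lookup (mon4 a b c d) 2 = c" "Poly_Mapping.lookup (mon4 a b c d) 3 = d"
  by (simp_all add: mon4_def lookup_add lookup_single when_def)

lemma mon4_eqI:
  "Poly_Mapping.lookup m 0 = a \<Longrightarrow> Poly_Mapping.lookup m 1 = b \<Longrightarrow> Poly_Mapping.lookup m 2 = c \<Longrightarrow>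
   Poly_Mapping.lookup m 3 = d \<Longrightarrow> m = mon4 a b c d"
  by (simp add: poly_mapping_eq_iff fun_eq_iff all_type_4)

lemma mon4_lookup: "m = mon4 (Poly_Mapping.lookup m 0) (Poly_Mapping.lookup m 1)
    (Poly_Mapping.lookup m 2) (Poly_Mapping.lookup m 3)"
  by (rule mon4_eqI) simp_all

lemma mon4_eq_iff [simp]: "mon4 a b c d = mon4 a' b' c' d' \<longleftrightarrow> a = a' \<and> b = b' \<and> c = c' \<and> d = d'"
  by (metis lookup_mon4)

lemma mon_degree_eq: "mon_degree m = Poly_Mapping.lookup m 0 + Poly_Mapping.lookup m 1 +
    Poly_Mapping.lookup m 2 + Poly_Mapping.lookup m 3"
  by (simp add: mon_degree_def sum_type_4)

lemma mon4_add: "mon4 a b c d + mon4 a' b' c' d' = mon4 (a + a') (b + b') (c + c') (d + d')"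
  by (rule mon4_eqI) (simp_all add: lookup_add)

lemma monomial_mon4: "monomial (mon4 a b c d) = x1 ^ a * x2 ^ b * x3 ^ c * x4 ^ d"
  by (simp add: mon4_def monomial_add monomial_single_power)

lemma grevlex_less_lastI:
  "mon_degree m = mon_degree n \<Longrightarrow> Poly_Mapping.lookup m 3 > Poly_Mapping.lookup n 3 \<Longrightarrow> grevlex_less m n"
  using type_4_order unfolding grevlex_less_def
  by (intro disjI2 conjI exI[of _ 3]) (auto simp: all_type_4)

lemma grevlex_less_2I:
  "mon_degree m = mon_degree n \<Longrightarrow> Poly_Mapping.lookup m 3 = Poly_Mapping.lookup n 3 \<Longrightarrow>
   Poly_Mapping.lookup m 2 > Poly_Mapping.lookup n 2 \<Longrightarrow> grevlex_less m n"
  using type_4_order unfolding grevlex_less_def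
  by (intro disjI2 conjI exI[of _ 2]) (auto simp: all_type_4)

lemma grevlex_less_1I:
  "mon_degree m = mon_degree n \<Longrightarrow> Poly_Mapping.lookup m 3 = Poly_Mapping.lookup n 3 \<Longrightarrow>
   Poly_Mapping.lookup m 2 = Poly_Mapping.lookup n 2 \<Longrightarrow>
   Poly_Mapping.lookup m 1 > Poly_Mapping.lookup n 1 \<Longrightarrow> grevlex_less m n"
  using type_4_order unfolding grevlex_less_def
  by (intro disjI2 conjI exI[of _ 1]) (auto simp: all_type_4)

lemmas grevlex_less_mon4I = grevlex_less_lastI grevlex_less_2I grevlex_less_1I

lemma X_eq_iff [simp]: "(X i :: 'k::comm_ring_1 S) = X j \<longleftrightarrow> i = j"
proof
  assume "(X i :: 'k S) = X j"
  then have "Poly_Mapping.single i 1 = (Poly_Mapping.single j 1 :: mon)"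
    unfolding X_eq_monomial by (rule injD[OF inj_monomial])
  from arg_cong[OF this, of "\<lambda>m. Poly_Mapping.lookup m i"] show "i = j"
    by (simp add: lookup_single when_def split: if_splits)
qed simp

lemma mons_12: "mons {x1, x2} j = (monomial ` {mon4 a b 0 0 | a b. a + b = j} :: 'k::comm_ring_1 S set)"
proof -
  have "(\<forall>i\<in>Poly_Mapping.keys m. (X i :: 'k S) \<in> {x1, x2}) \<longleftrightarrow>
      Poly_Mapping.lookup m 2 = 0 \<and> Poly_Mapping.lookup m 3 = 0" for m :: mon
    by (simp add: Ball_def all_type_4 in_keys_iff)
  moreover have "mon_degree m = j \<and> Poly_Mapping.lookup m 2 = 0 \<and> Poly_Mapping.lookup m 3 = 0 \<longleftrightarrow>
      m \<in> {mon4 a b 0 0 | a b. a + b = j}" for m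
    using mon4_lookup[of m] by (auto simp: mon_degree_eq) metis
  ultimately show ?thesis unfolding mons_def by (simp add: image_def) blast
qed

lemma mons_123: "mons {x1, x2, x3} j = (monomial ` {mon4 a b c 0 | a b c. a + b + c = j} :: 'k::comm_ring_1 S set)"
proof -
  have "(\<forall>i\<in>Poly_Mapping.keys m. (X i :: 'k S) \<in> {x1, x2, x3}) \<longleftrightarrow>
      Poly_Mapping.lookup m 3 = 0" for m :: mon
    by (simp add: Ball_def all_type_4 in_keys_iff)
  moreover have "mon_degree m = j \<and> Poly_Mapping.lookup m 3 = 0 \<longleftrightarrow>
      m \<in> {mon4 a b c 0 | a b c. a + b + c = j}" for m
    using mon4_lookup[of m] by (auto simp: mon_degree_eq) metis
  ultimately show ?thesis unfolding mons_def by (simp add: image_def) blast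
qed

lemma monomial_elt_set_times: "monomial k *o (monomial ` A) = monomial ` ((+) k ` A)"
  by (auto simp: elt_set_times_def image_image monomial_add)

lemma plus_mon4_image:
  "(+) (mon4 a b c d) ` {mon4 a' b' 0 0 | a' b'. P a' b'} = {mon4 (a + a') (b + b') c d | a' b'. P a' b'}"
  "(+) (mon4 a b c d) ` {mon4 a' b' c' 0 | a' b' c'. Q a' b' c'} =
     {mon4 (a + a') (b + b') (c + c') d | a' b' c'. Q a' b' c'}"
  by (force simp: mon4_add image_def)+

text \<open>Sums such as 4 + c are left as \<open>plus_mon4_image\<close> produces them, so that the
  comparison with \<open>form_I\<close> is pure rewriting.\<close>

definition gens_I :: "mon set" where
  "gens_I =
     {mon4 a b 0 0 | a b. a + b = 3} \<union> {mon4 a b 2 0 | a b. a + b = 2} \<union>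
     {mon4 a b (4 + c) 0 | a b c. a + b + c = 1} \<union> {mon4 a b (3 + c) 1 | a b c. a + b + c = 1} \<union>
     {mon4 a b 1 3 | a b. a + b = 2} \<union> {mon4 a b 2 3 | a b. a + b = 1} \<union> {mon4 0 0 3 3} \<union>
     {mon4 a b c 5 | a b c. a + b + c = 2} \<union> {mon4 a b c 7 | a b c. a + b + c = 1} \<union> {mon4 0 0 0 9}"

definition gens_II :: "mon set" where
  "gens_II =
     {mon4 a b 0 0 | a b. a + b = 3} \<union> {mon4 (1 + a) b (2 + c) 0 | a b c. a + b + c = 1} \<union>
     {mon4 0 2 3 0} \<union> {mon4 0 1 4 0} \<union> {mon4 0 0 5 0} \<union>
     {mon4 0 2 2 1} \<union> {mon4 0 1 3 1} \<union> {mon4 0 0 4 1} \<union>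
     {mon4 a b 1 3 | a b. a + b = 2} \<union> {mon4 a b 2 3 | a b. a + b = 1} \<union> {mon4 0 0 3 3} \<union>
     {mon4 a b c 5 | a b c. a + b + c = 2} \<union> {mon4 a b c 7 | a b c. a + b + c = 1} \<union> {mon4 0 0 0 9}"

lemma form_I_eq: "form_I = ideal_gen (monomial ` gens_I :: 'k::comm_ring_1 S set)"
proof -
  have "x3 ^ 2 = (monomial (mon4 0 0 2 0) :: 'k S)" "x3 ^ 4 = (monomial (mon4 0 0 4 0) :: 'k S)"
    "x4 * x3 ^ 3 = (monomial (mon4 0 0 3 1) :: 'k S)" "x4 ^ 3 * x3 = (monomial (mon4 0 0 1 3) :: 'k S)"
    "x4 ^ 3 * x3 ^ 2 = (monomial (mon4 0 0 2 3) :: 'k S)" "x4 ^ 3 * x3 ^ 3 = (monomial (mon4 0 0 3 3) :: 'k S)"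
    "x4 ^ 5 = (monomial (mon4 0 0 0 5) :: 'k S)" "x4 ^ 7 = (monomial (mon4 0 0 0 7) :: 'k S)"
    "x4 ^ 9 = (monomial (mon4 0 0 0 9) :: 'k S)"
    by (simp_all add: monomial_mon4 mult.commute)
  then show ?thesis
    unfolding form_I_def gens_I_def
    by (simp only: mons_12 mons_123 monomial_elt_set_times plus_mon4_image image_Un image_insert image_empty add_0)
qed

lemma form_II_eq: "form_II = ideal_gen (monomial ` gens_II :: 'k::comm_ring_1 S set)"
proof -
  have "x3 ^ 2 * x1 = (monomial (mon4 1 0 2 0) :: 'k S)" 
    "x3 ^ 3 * x2 ^ 2 = (monomial (mon4 0 2 3 0) :: 'k S)" "x3 ^ 4 * x2 = (monomial (mon4 0 1 4 0) :: 'k S)"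
    "x3 ^ 5 = (monomial (mon4 0 0 5 0) :: 'k S)"
    "x4 * x3 ^ 2 * x2 ^ 2 = (monomial (mon4 0 2 2 1) :: 'k S)"
    "x4 * x3 ^ 3 * x2 = (monomial (mon4 0 1 3 1) :: 'k S)" "x4 * x3 ^ 4 = (monomial (mon4 0 0 4 1) :: 'k S)"
    "x4 ^ 3 * x3 = (monomial (mon4 0 0 1 3) :: 'k S)"
    "x4 ^ 3 * x3 ^ 2 = (monomial (mon4 0 0 2 3) :: 'k S)" "x4 ^ 3 * x3 ^ 3 = (monomial (mon4 0 0 3 3) :: 'k S)"
    "x4 ^ 5 = (monomial (mon4 0 0 0 5) :: 'k S)" "x4 ^ 7 = (monomial (mon4 0 0 0 7) :: 'k S)"
    "x4 ^ 9 = (monomial (mon4 0 0 0 9) :: 'k S)"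
    by (simp_all add: monomial_mon4 mult.commute mult.left_commute)
  then show ?thesis
    unfolding form_II_def gens_II_def
    by (simp only: mons_12 mons_123 monomial_elt_set_times plus_mon4_image image_Un image_insert image_empty add_0)
qed

lemma ex_sum_le_2: "j \<le> a + b \<Longrightarrow> \<exists>a'\<le>a. \<exists>b'\<le>b. a' + b' = (j::nat)"
  by (rule exI[of _ "min a j"]) (auto intro!: exI[of _ "j - min a j"])

lemma standard_monsD:
  assumes "m \<in> standard_mons G" "mon4 a b c d \<in> G"
    "a \<le> Poly_Mapping.lookup m 0" "b \<le> Poly_Mapping.lookup m 1" "c \<le> Poly_Mapping.lookup m 2"
    "d \<le> Poly_Mapping.lookup m 3"
  shows False
proof -
  have "m = mon4 (Poly_Mapping.lookup m 0 - a) (Poly_Mapping.lookup m 1 - b)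
      (Poly_Mapping.lookup m 2 - c) (Poly_Mapping.lookup m 3 - d) + mon4 a b c d"
    using assms(3-) by (subst mon4_add) (simp flip: mon4_lookup)
  then show False using assms(1,2) unfolding standard_mons_def by blast
qed

text \<open>P describes the exponents of x1, x2, x3 that can occur. Over a monomial of degree s in
  these variables x4 has at most 9 - 2s possible exponents. For both forms the enumeration amounts
  to 9 + 3*7 + 6*5 + 6*3 + 3*1 = 81.\<close>

lemma card_standard_le:
  assumes P: "\<And>m. m \<in> standard_mons G \<Longrightarrow> P (Poly_Mapping.lookup m 0) (Poly_Mapping.lookup m 1) (Poly_Mapping.lookup m 2)"
    and deg: "\<And>a b c. P a b c \<Longrightarrow> a \<le> 2 \<and> b \<le> 2 \<and> c \<le> 4"
    and last: "\<And>m. m \<in> standard_mons G \<Longrightarrow> Poly_Mapping.lookup m 3 +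
      2 * (Poly_Mapping.lookup m 0 + Poly_Mapping.lookup m 1 + Poly_Mapping.lookup m 2) \<le> 8"
    and len: "length [mon4 a b c d. a \<leftarrow> [0..<3], b \<leftarrow> [0..<3], c \<leftarrow> [0..<5],
        d \<leftarrow> [0..<9 - 2 * (a + b + c)], P a b c] = 81" (is "length ?L = 81")
  shows "finite (standard_mons G)" "card (standard_mons G) \<le> 81"
proof -
  have "standard_mons G \<subseteq> set ?L"
  proof
    fix m assume m: "m \<in> standard_mons G"
    have "mon4 a b c d \<in> set ?L" if "a < 3" "b < 3" "c < 5" "d < 9 - 2 * (a + b + c)" "P a b c" for a b c d
      using that by simp
    from this[of "Poly_Mapping.lookup m 0" "Poly_Mapping.lookup m 1" "Poly_Mapping.lookup m 2" "Poly_Mapping.lookup m 3"]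
    show "m \<in> set ?L"
      using P[OF m] deg[OF P[OF m]] last[OF m] unfolding mon4_lookup[symmetric] by linarith
  qed
  note sub = this
  show "finite (standard_mons G)" by (rule finite_subset[OF sub finite_set])
  have "card (standard_mons G) \<le> card (set ?L)" by (rule card_mono[OF finite_set sub])
  also have "\<dots> \<le> length ?L" by (rule card_length)
  finally show "card (standard_mons G) \<le> 81" unfolding len .
qed

text \<open>Both forms contain the cubics in x1, x2 and the same generators divisible by x4^3. These
  already settle the monomials of degree at most 3 in x1, x2, x3; the forms differ from degree 4
  on.\<close>

lemma standard_mons_common:
  assumes m: "m \<in> standard_mons G"
    and G: "{mon4 a b 0 0 | a b. a + b = 3} \<union> {mon4 a b 1 3 | a b. a + b = 2} \<union>
      {mon4 a b 2 3 | a b. a + b = 1} \<union> {mon4 0 0 3 3} \<union> {mon4 a b c 5 | a b c. a + b + c = 2} \<union>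
      {mon4 a b c 7 | a b c. a + b + c = 1} \<union> {mon4 0 0 0 9} \<subseteq> G"
    and a: "a = Poly_Mapping.lookup m 0" and b: "b = Poly_Mapping.lookup m 1"
    and c: "c = Poly_Mapping.lookup m 2" and d: "d = Poly_Mapping.lookup m 3"
  shows "a + b \<le> 2" "a + b + c \<le> 3 \<Longrightarrow> d + 2 * (a + b + c) \<le> 8"
proof -
  have nd: False if "mon4 a' b' c' d' \<in> G" "a' \<le> a" "b' \<le> b" "c' \<le> c" "d' \<le> d" for a' b' c' d'
    using standard_monsD[OF m that(1)] that(2-) unfolding a b c d by blast
  show ab: "a + b \<le> 2"
  proof (rule ccontr)
    assume "\<not> ?thesis"
    then obtain a' b' where ab': "a' \<le> a" "b' \<le> b" "a' + b' = 3" using ex_sum_le_2[of 3 a b] by auto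
    moreover have "mon4 a' b' 0 0 \<in> G" using ab'(3) by (intro subsetD[OF G]) simp
    ultimately show False using nd[of a' b' 0 0] by simp
  qed
  show "d + 2 * (a + b + c) \<le> 8" if le: "a + b + c \<le> 3"
  proof (rule ccontr)
    assume "\<not> ?thesis"
    \<comment> \<open>The exponent of x4 is at least 9 - 2s in degree s = a + b + c. In degree 3 the
      bound a + b \<le> 2 leaves c = 1, 2, 3.\<close>
    then have "(a + b + c = 0 \<and> d \<ge> 9) \<or> (a + b + c = 1 \<and> d \<ge> 7) \<or> (a + b + c = 2 \<and> d \<ge> 5) \<or> (a + b = 2 \<and> c = 1 \<and> d \<ge> 3) \<or> (a + b = 1 \<and> c = 2 \<and> d \<ge> 3) \<or> (a + b = 0 \<and> c = 3 \<and> d \<ge> 3)"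
using le ab by presburger
      then consider "a + b + c = 0" "d \<ge> 9" | "a + b + c = 1" "d \<ge> 7" | "a + b + c = 2" "d \<ge> 5" |
      "a + b = 2" "c = 1" "d \<ge> 3" | "a + b = 1" "c = 2" "d \<ge> 3" | "a + b = 0" "c = 3" "d \<ge> 3" by blast
    moreover have "mon4 0 0 0 9 \<in> G" "mon4 0 0 3 3 \<in> G" by (intro subsetD[OF G]; simp)+
    moreover have "a + b + c = 1 \<Longrightarrow> mon4 a b c 7 \<in> G" "a + b + c = 2 \<Longrightarrow> mon4 a b c 5 \<in> G"
      "a + b = 2 \<Longrightarrow> mon4 a b 1 3 \<in> G" "a + b = 1 \<Longrightarrow> mon4 a b 2 3 \<in> G" by (intro subsetD[OF G]; simp)+
    ultimately show False
      using nd[of 0 0 0 9] nd[of a b c 7] nd[of a b c 5] nd[of a b 1 3] nd[of a b 2 3] nd[of 0 0 3 3]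
      by cases auto
  qed
qed

lemma standard_mons_I:
  "finite (standard_mons gens_I)" "card (standard_mons gens_I) \<le> 81"
proof -
  \<comment> \<open>The last condition leaves x1 x3^3, x2 x3^3, x3^4 in degree 4.\<close>
  define P where "P = (\<lambda>a b c :: nat. a + b \<le> 2 \<and> a + b + c \<le> 4 \<and> (a + b = 2 \<longrightarrow> c \<le> 1))"
  have std: "P a b c \<and> d + 2 * (a + b + c) \<le> 8" if m: "m \<in> standard_mons gens_I"
    and abcd: "a = Poly_Mapping.lookup m 0" "b = Poly_Mapping.lookup m 1"
    "c = Poly_Mapping.lookup m 2" "d = Poly_Mapping.lookup m 3" for m a b c d
  proof -
    have nd: False if "mon4 a' b' c' d' \<in> gens_I" "a' \<le> a" "b' \<le> b" "c' \<le> c" "d' \<le> d" for a' b' c' d'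
      using standard_monsD[OF m that(1)] that(2-) unfolding abcd by blast
    have "{mon4 a b 0 0 | a b. a + b = 3} \<union> {mon4 a b 1 3 | a b. a + b = 2} \<union>
      {mon4 a b 2 3 | a b. a + b = 1} \<union> {mon4 0 0 3 3} \<union> {mon4 a b c 5 | a b c. a + b + c = 2} \<union>
      {mon4 a b c 7 | a b c. a + b + c = 1} \<union> {mon4 0 0 0 9} \<subseteq> gens_I"
      unfolding gens_I_def by (intro Un_least) (auto simp only: Un_iff)
    note common = standard_mons_common[OF m this abcd]
    have c: "c \<le> 1" if "a + b = 2"
      using that nd[of a b 2 0] by (cases "2 \<le> c") (auto simp: gens_I_def)
    have deg: "a + b + c \<le> 4"
    proof (rule ccontr)
      assume "\<not> ?thesis"
      then have "(c \<ge> 5) \<or> (c = 4 \<and> a + b = 1)"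
using common(1) c by presburger
      then consider "c \<ge> 5" | "c = 4" "a + b = 1" by blast
      then show False
        using nd[of 0 0 "4 + 1" 0] nd[of a b "4 + 0" 0] by cases (auto simp: gens_I_def)
    qed
    have "d = 0" if "a + b + c = 4"
    proof (rule ccontr)
      assume "d \<noteq> 0"
      have "(c = 4 \<and> a = 0 \<and> b = 0) \<or> (c = 3 \<and> a + b = 1)"
using that common(1) c by presburger
      then consider "c = 4" "a = 0" "b = 0" | "c = 3" "a + b = 1" by blast
      then show False
        using \<open>d \<noteq> 0\<close> nd[of 0 0 "3 + 1" 1] nd[of a b "3 + 0" 1] by cases (auto simp: gens_I_def)
    qed
    then show ?thesis using common c deg unfolding P_def by presburger
  qed
  have "length [mon4 a b c d. a \<leftarrow> [0..<3], b \<leftarrow> [0..<3], c \<leftarrow> [0..<5],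
      d \<leftarrow> [0..<9 - 2 * (a + b + c)], P a b c] = 81"
    by (simp add: upt_rec P_def)
  note card_standard_le[OF conjunct1 _ conjunct2 this, OF std _ std, OF _ refl refl refl refl _ _ refl refl refl refl]
  then show "finite (standard_mons gens_I)" "card (standard_mons gens_I) \<le> 81"
    unfolding P_def by auto
qed

lemma standard_mons_II:
  "finite (standard_mons gens_II)" "card (standard_mons gens_II) \<le> 81"
proof -
  \<comment> \<open>Here degree 4 is left with x2^2 x3^2, x2 x3^3, x3^4.\<close>
  define P where "P = (\<lambda>a b c :: nat. a + b \<le> 2 \<and> a + b + c \<le> 4 \<and> (a + b + c = 4 \<longrightarrow> a = 0))"
  have std: "P a b c \<and> d + 2 * (a + b + c) \<le> 8" if m: "m \<in> standard_mons gens_II"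
    and abcd: "a = Poly_Mapping.lookup m 0" "b = Poly_Mapping.lookup m 1"
    "c = Poly_Mapping.lookup m 2" "d = Poly_Mapping.lookup m 3" for m a b c d
  proof -
    have nd: False if "mon4 a' b' c' d' \<in> gens_II" "a' \<le> a" "b' \<le> b" "c' \<le> c" "d' \<le> d" for a' b' c' d'
      using standard_monsD[OF m that(1)] that(2-) unfolding abcd by blast
    have "{mon4 a b 0 0 | a b. a + b = 3} \<union> {mon4 a b 1 3 | a b. a + b = 2} \<union>
      {mon4 a b 2 3 | a b. a + b = 1} \<union> {mon4 0 0 3 3} \<union> {mon4 a b c 5 | a b c. a + b + c = 2} \<union>
      {mon4 a b c 7 | a b c. a + b + c = 1} \<union> {mon4 0 0 0 9} \<subseteq> gens_II"
      unfolding gens_II_def by (intro Un_least) (auto simp only: Un_iff)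
    note common = standard_mons_common[OF m this abcd]
    have a: "a = 0" if "a + b + c \<ge> 4"
    proof (rule ccontr)
      assume "a \<noteq> 0"
      then have "(a = 2 \<and> b = 0 \<and> c \<ge> 2) \<or> (a = 1 \<and> b = 1 \<and> c \<ge> 2) \<or> (a = 1 \<and> b = 0 \<and> c \<ge> 3)"
using that common(1) by presburger
      then consider "a = 2" "b = 0" "c \<ge> 2" | "a = 1" "b = 1" "c \<ge> 2" | "a = 1" "b = 0" "c \<ge> 3" by blast
      then show False
        using nd[of "1 + 1" 0 "2 + 0" 0] nd[of "1 + 0" 1 "2 + 0" 0] nd[of "1 + 0" 0 "2 + 1" 0]
        by cases (auto simp: gens_II_def)
    qed
    have deg: "a + b + c \<le> 4"
    proof (rule ccontr)
      assume *: "\<not> ?thesis"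
      then have "a = 0" using a by simp
      with * have "(b = 2 \<and> c \<ge> 3) \<or> (b = 1 \<and> c \<ge> 4) \<or> (b = 0 \<and> c \<ge> 5)"
using common(1) by presburger
      then consider "b = 2" "c \<ge> 3" | "b = 1" "c \<ge> 4" | "b = 0" "c \<ge> 5" by blast
      then show False
        using nd[of 0 2 3 0] nd[of 0 1 4 0] nd[of 0 0 5 0] by cases (auto simp: gens_II_def)
    qed
    have "d = 0" if "a + b + c = 4"
    proof (rule ccontr)
      assume "d \<noteq> 0"
      have "a = 0" using a that by simp
      then have "(b = 2 \<and> c = 2) \<or> (b = 1 \<and> c = 3) \<or> (b = 0 \<and> c = 4)"
using that common(1) by presburger
      then consider "b = 2" "c = 2" | "b = 1" "c = 3" | "b = 0" "c = 4" by blast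
      then show False
        using \<open>d \<noteq> 0\<close> \<open>a = 0\<close> nd[of 0 2 2 1] nd[of 0 1 3 1] nd[of 0 0 4 1] by cases (auto simp: gens_II_def)
    qed
    then show ?thesis using common a deg unfolding P_def by presburger
  qed
  have "length [mon4 a b c d. a \<leftarrow> [0..<3], b \<leftarrow> [0..<3], c \<leftarrow> [0..<5],
      d \<leftarrow> [0..<9 - 2 * (a + b + c)], P a b c] = 81"
    by (simp add: upt_rec P_def)
  note card_standard_le[OF conjunct1 _ conjunct2 this, OF std _ std, OF _ refl refl refl refl _ _ refl refl refl refl]
  then show "finite (standard_mons gens_II)" "card (standard_mons gens_II) \<le> 81"
    unfolding P_def by auto
qed

section \<open>Initial ideals in general position\<close>

text \<open>Apart from the multiples of x4 in degree 4, the parameters are k = 2e - 2 in degree e +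
  3, which describes x4^(8-2d) A_d inside A_(8-d) for d = 5 - e. For e = 6 the bound 10 exceeds the
  degree 9, so the set is empty and the condition reads A_9 = 0.\<close>

definition last_mons :: "nat \<Rightarrow> nat \<Rightarrow> mon set" where
  "last_mons k d = {n \<in> hmons d. k \<le> Poly_Mapping.lookup n 3}"

text \<open>The conditions that an ideal generated by four cubics has to satisfy for its initial ideal
  to be one of the two forms. The third one is the strong Lefschetz property for the last
  variable.\<close>
definition general_position :: "(4 \<Rightarrow> 'k::field S) \<Rightarrow> bool" where
  "general_position g \<longleftrightarrow>
     monomial ` hmons 3 \<subseteq> cubic_span 0 {n \<in> hmons 3. 0 < Poly_Mapping.lookup n 2 + Poly_Mapping.lookup n 3} g \<and>
     monomial ` hmons 4 \<subseteq> cubic_span 1 (insert (mon4 0 2 2 0) (insert (mon4 0 1 3 0) (insert (mon4 0 0 4 0) (last_mons 1 4)))) g \<and>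
     (\<forall>e\<in>{2..6}. monomial ` hmons (e + 3) \<subseteq> cubic_span e (last_mons (2 * e - 2) (e + 3)) g)"

text \<open>The three listed quartics are the smallest ones free of x4, and x2^2 x3^2 is the next.
  In general position x3^4, x2 x3^3 and x2^2 x3^2 span A_4 modulo x4, so the question is whether x1
  x3^3 can take the place of x2^2 x3^2.\<close>

definition type_I_position :: "(4 \<Rightarrow> 'k::field S) \<Rightarrow> bool" where
  "type_I_position g \<longleftrightarrow>
     monomial ` hmons 4 \<subseteq> cubic_span 1 (insert (mon4 1 0 3 0) (insert (mon4 0 1 3 0) (insert (mon4 0 0 4 0) (last_mons 1 4)))) g"

lemma general_position_is_open:
  assumes g0: "g0 \<in> cubics4" and gp: "general_position (g0 :: 4 \<Rightarrow> 'k::field S)"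
  shows "\<exists>D. polyfun_on cubic_coords cubics4 D \<and> D g0 \<noteq> 0 \<and> (\<forall>g\<in>cubics4. D g \<noteq> 0 \<longrightarrow> general_position g)"
proof -
  define V where "V e = (if e = 0 then {n \<in> hmons 3. 0 < Poly_Mapping.lookup n 2 + Poly_Mapping.lookup n 3}
    else if e = 1 then insert (mon4 0 2 2 0) (insert (mon4 0 1 3 0) (insert (mon4 0 0 4 0) (last_mons 1 4)))
    else last_mons (2 * e - 2) (e + 3))" for e :: nat
  have gp_iff: "general_position g \<longleftrightarrow> (\<forall>e\<in>{..6}. monomial ` hmons (e + 3) \<subseteq> cubic_span e (V e) g)"
    for g :: "4 \<Rightarrow> 'k S"
  proof -
    have "{..6::nat} = insert 0 (insert 1 {2..6})" by auto
    moreover have "V 0 = {n \<in> hmons 3. 0 < Poly_Mapping.lookup n 2 + Poly_Mapping.lookup n 3}"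
      "V 1 = insert (mon4 0 2 2 0) (insert (mon4 0 1 3 0) (insert (mon4 0 0 4 0) (last_mons 1 4)))"
      "\<forall>e\<in>{2..6}. V e = last_mons (2 * e - 2) (e + 3)"
      by (simp_all add: V_def)
    ultimately show ?thesis by (simp add: general_position_def)
  qed
  have "\<exists>D. polyfun_on cubic_coords cubics4 D \<and> D g0 \<noteq> 0 \<and>
      (\<forall>g\<in>cubics4. D g \<noteq> 0 \<longrightarrow> (\<forall>e\<in>{..6}. monomial ` hmons (e + 3) \<subseteq> cubic_span e (V e) g))"
  proof (rule polyfun_on_fun_prod)
    fix e :: nat assume "e \<in> {..6}"
    then show "\<exists>D. polyfun_on cubic_coords cubics4 D \<and> D g0 \<noteq> 0 \<and>
      (\<forall>g\<in>cubics4. D g \<noteq> 0 \<longrightarrow> monomial ` hmons (e + 3) \<subseteq> cubic_span e (V e) g)"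
      using gp by (intro cubic_span_is_open g0)
        (auto simp: gp_iff, auto simp: V_def last_mons_def hmons_def mon_degree_eq split: if_splits)
  qed simp
  then show ?thesis by (simp add: gp_iff)
qed

lemma type_I_position_is_open:
  assumes g0: "g0 \<in> cubics4" and gp: "type_I_position (g0 :: 4 \<Rightarrow> 'k::field S)"
  shows "\<exists>D. polyfun_on cubic_coords cubics4 D \<and> D g0 \<noteq> 0 \<and> (\<forall>g\<in>cubics4. D g \<noteq> 0 \<longrightarrow> type_I_position g)"
proof -
  let ?V = "insert (mon4 1 0 3 0) (insert (mon4 0 1 3 0) (insert (mon4 0 0 4 0) (last_mons 1 4)))"
  have "?V \<subseteq> hmons (1 + 3)"
    by (auto simp: last_mons_def hmons_def mon_degree_eq)
  moreover have "monomial ` hmons (1 + 3) \<subseteq> cubic_span 1 ?V g0"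
    using gp by (simp add: type_I_position_def)
  ultimately show ?thesis
    using cubic_span_is_open[OF _ g0, of ?V 1] by (simp add: type_I_position_def)
qed

text \<open>Only membership of the g i in I enters: here leading monomials are produced, and that
  there are no others is left to the dimension count.\<close>

locale cubic_ideal =
  fixes I :: "'k::field S set" and g :: "4 \<Rightarrow> 'k S"
  assumes sub: "pm.subspace I" and mult: "p \<in> I \<Longrightarrow> q * p \<in> I" and g_mem: "g i \<in> I"
begin

lemma leading_monI':
  assumes "monomial m \<in> cubic_span d V g" and V: "\<And>n. n \<in> V \<Longrightarrow> grevlex_less n m"
  shows "m \<in> leading_mons I"
proof (rule leading_monI[OF sub _ V])
  have "{monomial n * g i | n i. n \<in> hmons d} \<union> monomial ` V \<subseteq> I \<union> monomial ` V"
    using mult g_mem by auto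
  then show "monomial m \<in> pm.span (I \<union> monomial ` V)"
    using assms(1) pm.span_mono unfolding cubic_span_def by blast
qed

text \<open>Every monomial of \<open>last_mons\<close> has x4-exponent at least 2e - 2 > k, hence is
  smaller than m in the reverse lexicographic order.\<close>

lemma leading_last:
  assumes "general_position g" and m: "m = mon4 a b c k" and "a + b + c + k = e + 3" "k < 2 * e - 2" "e \<in> {2..6}"
  shows "m \<in> leading_mons I"
proof (rule leading_monI')
  have "m \<in> hmons (e + 3)" using assms by (simp add: hmons_def mon_degree_eq)
  then show "monomial m \<in> cubic_span e (last_mons (2 * e - 2) (e + 3)) g"
    using assms(1,5) unfolding general_position_def by blast
  show "grevlex_less n m" if "n \<in> last_mons (2 * e - 2) (e + 3)" for n
    using that \<open>m \<in> hmons (e + 3)\<close> assms(4) by (intro grevlex_less_lastI) (auto simp: last_mons_def hmons_def m)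
qed

lemma leading_12:
  assumes "general_position g" "a + b = 3"
  shows "mon4 a b 0 0 \<in> leading_mons I"
proof (rule leading_monI')
  show "monomial (mon4 a b 0 0) \<in>
      cubic_span 0 {n \<in> hmons 3. 0 < Poly_Mapping.lookup n 2 + Poly_Mapping.lookup n 3} g"
    using assms unfolding general_position_def by (auto simp: hmons_def mon_degree_eq)
  show "grevlex_less n (mon4 a b 0 0)"
    if "n \<in> {n \<in> hmons 3. 0 < Poly_Mapping.lookup n 2 + Poly_Mapping.lookup n 3}" for n
    using that assms(2)
    by (cases "Poly_Mapping.lookup n 3 = 0") (auto simp: hmons_def mon_degree_eq intro: grevlex_less_mon4I)
qed

lemma grevlex_less_last_mons: "n \<in> last_mons 1 4 \<Longrightarrow> a + b + c = 4 \<Longrightarrow> grevlex_less n (mon4 a b c 0)"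
  by (rule grevlex_less_lastI) (auto simp: last_mons_def hmons_def mon_degree_eq)

text \<open>The quartics x1^2 x3^2 and x1 x2 x3^2 lie above all three exceptional monomials. The
  quartic x1 x3^3 lies below x2^2 x3^2 and is not reached by this argument.\<close>

lemma leading_1:
  assumes "general_position g" "a + b = 1"
  shows "mon4 (1 + a) b 2 0 \<in> leading_mons I"
proof (rule leading_monI')
  show "monomial (mon4 (1 + a) b 2 0) \<in>
      cubic_span 1 (insert (mon4 0 2 2 0) (insert (mon4 0 1 3 0) (insert (mon4 0 0 4 0) (last_mons 1 4)))) g"
    using assms unfolding general_position_def by (auto simp: hmons_def mon_degree_eq)
  show "grevlex_less n (mon4 (1 + a) b 2 0)"
    if "n \<in> insert (mon4 0 2 2 0) (insert (mon4 0 1 3 0) (insert (mon4 0 0 4 0) (last_mons 1 4)))" for n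
    using that assms(2)
    by (elim insertE) (simp_all add: mon_degree_eq grevlex_less_last_mons grevlex_less_mon4I)
qed

lemma leading_type_I:
  assumes "type_I_position g"
  shows "mon4 0 2 2 0 \<in> leading_mons I"
proof (rule leading_monI')
  show "monomial (mon4 0 2 2 0) \<in>
      cubic_span 1 (insert (mon4 1 0 3 0) (insert (mon4 0 1 3 0) (insert (mon4 0 0 4 0) (last_mons 1 4)))) g"
    using assms unfolding type_I_position_def by (auto simp: hmons_def mon_degree_eq)
  show "grevlex_less n (mon4 0 2 2 0)"
    if "n \<in> insert (mon4 1 0 3 0) (insert (mon4 0 1 3 0) (insert (mon4 0 0 4 0) (last_mons 1 4)))" for n
    using that by (elim insertE) (simp_all add: mon_degree_eq grevlex_less_last_mons grevlex_less_mon4I)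
qed

text \<open>If the monomial x2^2 x3^2 occurred in the reduction of x1 x3^3, the two could be exchanged.\<close>
lemma leading_type_II:
  assumes gp: "general_position g" and not_I: "\<not> type_I_position g"
  shows "mon4 1 0 3 0 \<in> leading_mons I"
proof (rule leading_monI')
  let ?W = "{monomial n * g i | n i. n \<in> hmons 1}"
  let ?V = "insert (mon4 0 1 3 0) (insert (mon4 0 0 4 0) (last_mons 1 4))"
  let ?u = "monomial (mon4 1 0 3 0) :: 'k S" and ?q = "monomial (mon4 0 2 2 0) :: 'k S"
  have all: "monomial ` hmons 4 \<subseteq> pm.span (insert ?q (?W \<union> monomial ` ?V))"
    using gp unfolding general_position_def cubic_span_def by simp
  show "?u \<in> cubic_span 1 ?V g"
  proof (rule ccontr)
    assume "?u \<notin> cubic_span 1 ?V g"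
    moreover have "?u \<in> pm.span (insert ?q (?W \<union> monomial ` ?V))"
      using all by (auto simp: hmons_def mon_degree_eq)
    ultimately have q: "?q \<in> pm.span (insert ?u (?W \<union> monomial ` ?V))"
      unfolding cubic_span_def by (rule pm.in_span_insert[rotated])
    have "pm.span (insert ?q (?W \<union> monomial ` ?V)) \<subseteq> pm.span (insert ?u (?W \<union> monomial ` ?V))"
      using q by (intro pm.span_minimal) (auto intro: pm.span_base)
    then have "type_I_position g"
      using all unfolding type_I_position_def cubic_span_def by simp
    then show False using not_I by simp
  qed
  show "grevlex_less n (mon4 1 0 3 0)" if "n \<in> ?V" for n
    using that by (elim insertE) (simp_all add: mon_degree_eq grevlex_less_last_mons grevlex_less_mon4I)
qed

lemma leading_common:
  assumes "general_position g"
  shows "{mon4 a b 0 0 | a b. a + b = 3} \<union> {mon4 a b 1 3 | a b. a + b = 2} \<union>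
      {mon4 a b 2 3 | a b. a + b = 1} \<union> {mon4 0 0 3 3} \<union> {mon4 a b c 5 | a b c. a + b + c = 2} \<union>
      {mon4 a b c 7 | a b c. a + b + c = 1} \<union> {mon4 0 0 0 9} \<subseteq> leading_mons I"
proof (intro Un_least)
  show "{mon4 a b 0 0 | a b. a + b = 3} \<subseteq> leading_mons I"
    using leading_12[OF assms] by auto
  show "{mon4 a b 1 3 | a b. a + b = 2} \<subseteq> leading_mons I" "{mon4 a b 2 3 | a b. a + b = 1} \<subseteq> leading_mons I"
    "{mon4 0 0 3 3} \<subseteq> leading_mons I"
    \<comment> \<open>\<open>leading_last\<close> admits x4-exponents up to 2e - 3. For e = 3, 4, 5,
      6 these are 3, 5, 7, 9, the exponents in the generators.\<close>
    by (auto intro!: leading_last[OF assms refl, of _ _ _ _ 3])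
  show "{mon4 a b c 5 | a b c. a + b + c = 2} \<subseteq> leading_mons I"
    by (auto intro!: leading_last[OF assms refl, of _ _ _ _ 4])
  show "{mon4 a b c 7 | a b c. a + b + c = 1} \<subseteq> leading_mons I"
    by (auto intro!: leading_last[OF assms refl, of _ _ _ _ 5])
  show "{mon4 0 0 0 9} \<subseteq> leading_mons I"
    by (auto intro!: leading_last[OF assms refl, of _ _ _ _ 6])
qed

lemma gens_I_leading:
  assumes gp: "general_position g" and "type_I_position g"
  shows "gens_I \<subseteq> leading_mons I"
proof -
  have "mon4 a b 2 0 \<in> leading_mons I" if "a + b = 2" for a b
  proof (cases a)
    case 0
    then show ?thesis using that leading_type_I[OF assms(2)] by simp
  next
    case (Suc a')
    then show ?thesis using that leading_1[OF gp, of a' b] by simp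
  qed
  moreover have "mon4 a b (4 + c) 0 \<in> leading_mons I" "mon4 a b (3 + c) 1 \<in> leading_mons I" if "a + b + c = 1" for a b c
    using that by (auto intro!: leading_last[OF gp refl, of _ _ _ _ 2])
  ultimately show ?thesis
    using leading_common[OF gp] unfolding gens_I_def by auto
qed

lemma gens_II_leading:
  assumes gp: "general_position g" and "\<not> type_I_position g"
  shows "gens_II \<subseteq> leading_mons I"
proof -
  have "mon4 (1 + a) b (2 + c) 0 \<in> leading_mons I" if "a + b + c = 1" for a b c
  proof (cases c)
    case 0
    then show ?thesis using that leading_1[OF gp, of a b] by simp
  next
    case (Suc c')
    then show ?thesis using that leading_type_II[OF assms] by simp
  qed
  moreover have "mon4 0 2 3 0 \<in> leading_mons I" "mon4 0 1 4 0 \<in> leading_mons I" "mon4 0 0 5 0 \<in> leading_mons I"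
    "mon4 0 2 2 1 \<in> leading_mons I" "mon4 0 1 3 1 \<in> leading_mons I" "mon4 0 0 4 1 \<in> leading_mons I"
    by (auto intro!: leading_last[OF gp refl, of _ _ _ _ 2])
  ultimately show ?thesis
    using leading_common[OF gp] unfolding gens_II_def by auto
qed

lemma initial_ideal_cases:
  assumes "dim_bounded I" "general_position g"
  shows "initial_ideal I = (if type_I_position g then form_I else form_II)"
  using initial_ideal_eqI[OF sub mult assms(1) gens_I_leading[OF assms(2)] standard_mons_I]
    initial_ideal_eqI[OF sub mult assms(1) gens_II_leading[OF assms(2)] standard_mons_II]
  by (simp add: form_I_eq form_II_eq)

end

section \<open>The strong Lefschetz property of the ideal of cubes\<close>

definition lin_ext :: "(mon \<Rightarrow> 'k::field S) \<Rightarrow> 'k S \<Rightarrow> 'k S" where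
  "lin_ext \<phi> p = (\<Sum>m\<in>Poly_Mapping.keys p. smul (Poly_Mapping.lookup p m) (\<phi> m))"

lemma lin_ext_superset:
  assumes "finite A" "Poly_Mapping.keys p \<subseteq> A"
  shows "lin_ext \<phi> p = (\<Sum>m\<in>A. smul (Poly_Mapping.lookup p m) (\<phi> m))"
  unfolding lin_ext_def using assms
  by (intro sum.mono_neutral_left) (auto simp: in_keys_iff)

lemma lin_ext_linear: "module_hom smul smul (lin_ext \<phi>)"
proof unfold_locales
  fix p q :: "'a S" and r
  have "lin_ext \<phi> (p + q) = (\<Sum>m\<in>Poly_Mapping.keys p \<union> Poly_Mapping.keys q. smul (Poly_Mapping.lookup (p + q) m) (\<phi> m))"
    using keys_add[of p q] by (intro lin_ext_superset) auto
  also have "\<dots> = lin_ext \<phi> p + lin_ext \<phi> q"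
    by (simp add: lin_ext_superset[of "Poly_Mapping.keys p \<union> Poly_Mapping.keys q"] lookup_add
        pm.scale_left_distrib sum.distrib)
  finally show "lin_ext \<phi> (p + q) = lin_ext \<phi> p + lin_ext \<phi> q" .
  have "lin_ext \<phi> (smul r p) = (\<Sum>m\<in>Poly_Mapping.keys p. smul (Poly_Mapping.lookup (smul r p) m) (\<phi> m))"
    by (intro lin_ext_superset) (auto simp: in_keys_iff)
  also have "\<dots> = smul r (lin_ext \<phi> p)"
    by (simp add: lin_ext_def pm.scale_sum_right)
  finally show "lin_ext \<phi> (smul r p) = smul r (lin_ext \<phi> p)" .
qed

lemma lin_ext_monomial [simp]: "lin_ext \<phi> (monomial m) = \<phi> m"
  by (simp add: lin_ext_def lookup_monomial)

text \<open>The lowering operator of the representation of sl2 on K[x]/(x^3), tensored four times;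
  multiplication by the sum of the variables is the raising operator.\<close>
definition lower_coeff :: "mon \<Rightarrow> 4 \<Rightarrow> 'k::field" where
  "lower_coeff m i = of_nat (Poly_Mapping.lookup m i) * (3 - of_nat (Poly_Mapping.lookup m i))"

definition lower :: "'k::field S \<Rightarrow> 'k S" where
  "lower = lin_ext (\<lambda>m. \<Sum>i\<in>UNIV. smul (lower_coeff m i) (monomial (m - Poly_Mapping.single i 1)))"

abbreviation var_sum :: "'k::field S" where
  "var_sum \<equiv> \<Sum>i\<in>UNIV. X i"

lemma lower_linear: "module_hom smul smul lower"
  unfolding lower_def by (rule lin_ext_linear)

lemmas lower_add = module_hom.add[OF lower_linear]
lemmas lower_smul = module_hom.scale[OF lower_linear]
lemmas lower_sum = module_hom.sum[OF lower_linear]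

lemma lower_monomial:
  "lower (monomial m) = (\<Sum>i\<in>UNIV. smul (lower_coeff m i) (monomial (m - Poly_Mapping.single i 1)))"
  by (simp add: lower_def)

text \<open>In one variable (a + 1)(2 - a) - a(3 - a) = 2 - 2a, and operators at different variables
  commute. Summing over four variables gives the sl2 weight 8 - 2 deg m.\<close>

lemma lower_var_sum_monomial:
  "lower (var_sum * monomial m) = var_sum * lower (monomial m) +
     smul (8 - 2 * of_nat (mon_degree m)) (monomial m :: 'k::field S)"
proof -
  let ?s = "\<lambda>i. Poly_Mapping.single i 1 :: mon"
  have summand: "smul (lower_coeff (?s i + m) j) (monomial (?s i + m - ?s j)) =
      smul (lower_coeff m j) (monomial (?s i + (m - ?s j))) +
      (if j = i then smul (2 - 2 * of_nat (Poly_Mapping.lookup m i)) (monomial m :: 'k S) else 0)" for i j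
  proof (cases "Poly_Mapping.lookup m j = 0")
    \<comment> \<open>Exponent subtraction is truncated; where it would be inaccurate,
      \<open>lower_coeff m j\<close> is 0.\<close>
    case True
    show ?thesis
    proof (cases "i = j")
      case True': True
      then show ?thesis using True by (simp add: lower_coeff_def lookup_add)
    next
      case False
      then show ?thesis using True by (simp add: lower_coeff_def lookup_add lookup_single)
    qed
  next
    case False
    then have eq: "?s i + (m - ?s j) = ?s i + m - ?s j"
      by (intro poly_mapping_eqI) (auto simp: lookup_add lookup_minus lookup_single when_def)
    show ?thesis
    proof (cases "i = j")
      case True
      have "?s i + m - ?s i = m" by simp
      moreover have "lower_coeff (?s i + m) i = lower_coeff m i + (2 - 2 * of_nat (Poly_Mapping.lookup m i) :: 'k)"
        by (simp add: lower_coeff_def lookup_add algebra_simps)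
      ultimately show ?thesis using True eq by (simp add: pm.scale_left_distrib)
    next
      case False
      then show ?thesis unfolding eq by (simp add: lower_coeff_def lookup_add lookup_single)
    qed
  qed
  have "lower (var_sum * monomial m :: 'k S) =
      (\<Sum>i\<in>UNIV. \<Sum>j\<in>UNIV. smul (lower_coeff (?s i + m) j) (monomial (?s i + m - ?s j)))"
    by (simp add: sum_distrib_right X_eq_monomial monomial_add[symmetric] lower_sum lower_monomial)
  also have "\<dots> = (\<Sum>i\<in>UNIV. \<Sum>j\<in>UNIV. smul (lower_coeff m j) (monomial (?s i + (m - ?s j)))) +
      (\<Sum>i\<in>UNIV. smul (2 - 2 * of_nat (Poly_Mapping.lookup m i)) (monomial m))"
    unfolding summand sum.distrib by simp
  also have "(\<Sum>i\<in>UNIV. \<Sum>j\<in>UNIV. smul (lower_coeff m j) (monomial (?s i + (m - ?s j)))) =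
      var_sum * lower (monomial m :: 'k S)"
    by (simp add: sum_distrib_right sum_distrib_left X_eq_monomial monomial_add lower_monomial smul_mult_right pm.scale_sum_right)
      (rule sum.swap)
  also have "(\<Sum>i\<in>(UNIV :: 4 set). smul (2 - 2 * of_nat (Poly_Mapping.lookup m i)) (monomial m :: 'k S)) =
      smul (8 - 2 * of_nat (mon_degree m)) (monomial m)"
    by (simp add: pm.scale_sum_left[symmetric] mon_degree_def sum_subtractf sum_distrib_left[symmetric])
  finally show ?thesis .
qed

lemma lower_var_sum:
  assumes "homogeneous d (u :: 'k::field S)"
  shows "lower (var_sum * u) = var_sum * lower u + smul (8 - 2 * of_nat d) u"
proof -
  have "u \<in> pm.span (monomial ` hmons d)" using assms by (simp add: homogeneous_iff_span)
  then show ?thesis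
  proof (induction rule: pm.span_induct_alt)
    case base
    then show ?case by (simp add: module_hom.zero[OF lower_linear])
  next
    case (step c x y)
    then obtain m where m: "x = monomial m" "mon_degree m = d" by (auto simp: hmons_def)
    show ?case
      using lower_var_sum_monomial[of m, where ?'k='k] step.IH
      by (simp add: distrib_left smul_mult_right lower_add lower_smul m pm.scale_right_distrib mult.commute)
  qed
qed

lemma homogeneous_var_sum: "homogeneous 1 var_sum"
  by (intro homogeneous_sum homogeneous_X)

lemma homogeneous_var_sum_power: "homogeneous d u \<Longrightarrow> homogeneous (k + d) (var_sum ^ k * u)"
  using homogeneous_mult[OF homogeneous_power[OF homogeneous_var_sum, of k]] by simp

text \<open>The weights 8 - 2(d + l) met at l = 0, ..., k add up to (k + 1)(8 - 2d - k).\<close>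

lemma lower_var_sum_power:
  assumes u: "homogeneous d (u :: 'k::field S)"
  shows "lower (var_sum ^ Suc k * u) = var_sum ^ Suc k * lower u +
    smul (of_nat (Suc k) * (8 - 2 * of_nat d - of_nat k)) (var_sum ^ k * u)"
proof (induction k)
  case 0
  then show ?case using lower_var_sum[OF u] by simp
next
  case (Suc k)
  have "lower (var_sum ^ Suc (Suc k) * u) = lower (var_sum * (var_sum ^ Suc k * u))"
    by (simp add: mult.assoc)
  also have "\<dots> = var_sum * lower (var_sum ^ Suc k * u) + smul (8 - 2 * of_nat (Suc k + d)) (var_sum ^ Suc k * u)"
    by (rule lower_var_sum[OF homogeneous_var_sum_power[OF u]])
  also have "var_sum * lower (var_sum ^ Suc k * u) = var_sum ^ Suc (Suc k) * lower u +
      smul (of_nat (Suc k) * (8 - 2 * of_nat d - of_nat k)) (var_sum ^ Suc k * u)"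
    unfolding Suc.IH by (simp add: distrib_left smul_mult_right mult.assoc)
  finally have "lower (var_sum ^ Suc (Suc k) * u) = var_sum ^ Suc (Suc k) * lower u +
      smul (of_nat (Suc k) * (8 - 2 * of_nat d - of_nat k) + (8 - 2 * of_nat (Suc k + d))) (var_sum ^ Suc k * u)"
    by (simp only: add.assoc pm.scale_left_distrib)
  also have "of_nat (Suc k) * (8 - 2 * of_nat d - of_nat k) + (8 - 2 * of_nat (Suc k + d)) =
      (of_nat (Suc (Suc k)) * (8 - 2 * of_nat d - of_nat (Suc k)) :: 'k)"
    by (simp add: algebra_simps)
  finally show ?case .
qed

lemma lower_mem_span:
  assumes "u \<in> pm.span (monomial ` A)"
    and "\<And>m i. m \<in> A \<Longrightarrow> lower_coeff m i \<noteq> (0 :: 'k) \<Longrightarrow> m - Poly_Mapping.single i 1 \<in> B"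
  shows "lower u \<in> pm.span (monomial ` B :: 'k::field S set)"
proof (rule linear_span_into[OF lower_linear assms(1)])
  fix b :: "'k S" assume "b \<in> monomial ` A"
  then obtain m where m: "m \<in> A" "b = monomial m" by auto
  have "smul (lower_coeff m i) (monomial (m - Poly_Mapping.single i 1)) \<in> pm.span (monomial ` B :: 'k S set)" for i
    using assms(2)[OF m(1), of i]
    by (cases "lower_coeff m i = (0 :: 'k)") (auto intro: pm.span_scale pm.span_base pm.span_zero)
  then show "lower b \<in> pm.span (monomial ` B)"
    unfolding m(2) lower_monomial by (intro pm.span_sum)
qed

lemma mon_degree_minus_single:
  assumes "Poly_Mapping.lookup m i \<noteq> 0" "mon_degree m = Suc d"
  shows "mon_degree (m - Poly_Mapping.single i 1) = d"
proof -
  have "m - Poly_Mapping.single i 1 + Poly_Mapping.single i 1 = m"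
    by (rule poly_mapping_eqI) (use assms in \<open>auto simp: lookup_add lookup_minus lookup_single when_def\<close>)
  from arg_cong[OF this, of mon_degree] show ?thesis using assms(2) by simp
qed

lemma lower_coeff_nonzeroD:
  assumes "lower_coeff m i \<noteq> (0 :: 'k::field)"
  shows "Poly_Mapping.lookup m i \<noteq> 0" "Poly_Mapping.lookup m i \<noteq> 3"
  using assms by (auto simp: lower_coeff_def intro!: Nat.gr0I)

lemma homogeneous_lower:
  assumes "homogeneous (Suc d) (u :: 'k::field S)"
  shows "homogeneous d (lower u)"
  using assms unfolding homogeneous_iff_span
  by (rule lower_mem_span) (simp add: hmons_def mon_degree_minus_single[OF lower_coeff_nonzeroD(1), simplified])

text \<open>Stated for the product because there is no degree d - 1 for d = 0; in that case
  \<open>lower u\<close> is zero.\<close>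

lemma homogeneous_var_sum_lower:
  assumes "homogeneous d (u :: 'k::field S)"
  shows "homogeneous d (var_sum * lower u)"
proof (cases d)
  case 0
  have "lower u \<in> pm.span (monomial ` {})"
    using assms unfolding homogeneous_iff_span
    by (rule lower_mem_span) (auto simp: hmons_def lower_coeff_def 0 mon_degree_def)
  then show ?thesis by simp
next
  case (Suc e)
  then show ?thesis
    using homogeneous_lower[of e u] homogeneous_mult[OF homogeneous_var_sum, of e "lower u"] assms by simp
qed

text \<open>The factor 3 - a in \<open>lower_coeff\<close> vanishes at a = 3, so an exponent 3 is
  never lowered to 2. Hence the lowering operator acts on the quotient by the cubes.\<close>

lemma lower_cube_mons:
  assumes "u \<in> pm.span (monomial ` cube_mons (Suc d) :: 'k::field S set)"
  shows "lower u \<in> pm.span (monomial ` cube_mons d :: 'k S set)"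
  using assms
proof (rule lower_mem_span)
  fix m i assume m: "m \<in> cube_mons (Suc d)" and c: "lower_coeff m i \<noteq> (0 :: 'k)"
  obtain j where j: "3 \<le> Poly_Mapping.lookup m j" using m by (auto simp: cube_mons_def)
  note lower_coeff_nonzeroD[OF c]
  then show "m - Poly_Mapping.single i 1 \<in> cube_mons d"
    using m j unfolding cube_mons_def hmons_def
    by (auto simp: lookup_minus lookup_single when_def mon_degree_minus_single[unfolded One_nat_def] intro!: exI[of _ j])
qed

lemma hmons_9_eq: "hmons 9 = cube_mons 9"
  unfolding cube_mons_def hmons_def using mon_degree_cube_free by (force simp flip: not_less)

text \<open>The strong Lefschetz property of the monomial complete intersection, in the upper half of
  the degrees. Applying the commutation relation to a preimage under a lower power of the raising
  operator trades it for one under the next power.\<close>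
lemma strong_lefschetz:
  assumes "n \<le> 5" "k \<le> 2 * (9 - n) - 8" "homogeneous (9 - n) (v :: 'k::field_char_0 S)"
  shows "\<exists>i\<in>pm.span (monomial ` cube_mons (9 - n)). \<exists>q. homogeneous (9 - n - k) q \<and> v = i + var_sum ^ k * q"
  using assms
proof (induction n arbitrary: k v)
  case 0
  then have "v \<in> pm.span (monomial ` cube_mons 9)"
    by (simp add: homogeneous_iff_span hmons_9_eq)
  \<comment> \<open>The zero polynomial is homogeneous of every degree, which covers exponents k up
    to 10 in degree 9.\<close>
  then show ?case by (intro bexI[of _ v] exI[of _ 0]) auto
next
  case (Suc n)
  define e where "e = 9 - Suc n"
  have e: "9 - n = Suc e" "4 \<le> e" "e \<le> 8" using Suc.prems(1) by (auto simp: e_def)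
  have step: "\<exists>i\<in>pm.span (monomial ` cube_mons (Suc e)). \<exists>q. homogeneous (Suc e - k) q \<and> v = i + var_sum ^ k * q"
    if "k \<le> 2 * Suc e - 8" "homogeneous (Suc e) v" for k and v :: "'k S"
    using Suc.IH[of k v] that Suc.prems(1) e by simp
  have "\<exists>i\<in>pm.span (monomial ` cube_mons e). \<exists>q. homogeneous (e - k) q \<and> v = i + var_sum ^ k * q"
    if "k \<le> 2 * e - 8" "homogeneous e v" for k and v :: "'k S"
    using that
  proof (induction k)
    case 0
    then show ?case by (intro bexI[of _ 0] exI[of _ v]) (auto intro: pm.span_zero)
  next
    case (Suc k)
    obtain i u where u: "i \<in> pm.span (monomial ` cube_mons e)" "homogeneous (e - k) u" "v = i + var_sum ^ k * u"
      using Suc by auto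
    define d where "d = e - k - 1"
    have d: "e - k = Suc d" "e - Suc k = d" "Suc e - Suc (Suc k) = d" "Suc k + Suc d = Suc e"
      using Suc.prems(1) e by (auto simp: d_def)
    have "homogeneous (Suc e) (var_sum ^ Suc k * u)"
      using homogeneous_var_sum_power[of "Suc d" u "Suc k"] u(2) d by simp
    then obtain i' z where z: "i' \<in> pm.span (monomial ` cube_mons (Suc e))" "homogeneous d z"
      "var_sum ^ Suc k * u = i' + var_sum ^ Suc (Suc k) * z"
      using step[of "Suc (Suc k)" "var_sum ^ Suc k * u"] Suc.prems(1) e(2) unfolding d(3) by fastforce
    define c :: 'k where "c = of_nat (Suc k) * (8 - 2 * of_nat (Suc d) - of_nat k)"
    define c' :: 'k where "c' = of_nat (Suc (Suc k)) * (8 - 2 * of_nat d - of_nat (Suc k))"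
    \<comment> \<open>The degree of u is e - k and k + 1 \<le> 2e - 8, so 2(e - k) + k = 2e - k is
      at least 9. In characteristic zero this makes c invertible.\<close>
    have "8 < 2 * Suc d + k" using Suc.prems(1) e(2) d(4) by presburger
    then have "of_nat 8 \<noteq> (of_nat (2 * Suc d + k) :: 'k)" unfolding of_nat_eq_iff by simp
    moreover have "8 - 2 * of_nat (Suc d) - of_nat k = (of_nat 8 - of_nat (2 * Suc d + k) :: 'k)"
      by simp
    ultimately have "8 - 2 * of_nat (Suc d) - of_nat k \<noteq> (0 :: 'k)"
      by (simp only: right_minus_eq not_False_eq_True)
    then have "c \<noteq> 0" unfolding c_def mult_eq_0_iff of_nat_eq_0_iff by simp
    have "smul c (var_sum ^ k * u) = lower (var_sum ^ Suc k * u) - var_sum ^ Suc k * lower u"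
      using lower_var_sum_power[of "Suc d" u k] u(2) d by (simp add: c_def)
    also have "lower (var_sum ^ Suc k * u) = lower i' + (var_sum ^ Suc (Suc k) * lower z + smul c' (var_sum ^ Suc k * z))"
      unfolding z(3) lower_add lower_var_sum_power[OF z(2)] c'_def ..
    \<comment> \<open>All terms but the one in question now lie in the ideal of cubes or carry one
      more power of the raising operator.\<close>
    finally have "smul c (var_sum ^ k * u) = lower i' + var_sum ^ Suc k * (var_sum * lower z + smul c' z - lower u)"
      by (simp add: algebra_simps smul_mult_left smul_mult_right)
    then have "smul (1 / c) (smul c (var_sum ^ k * u)) =
        smul (1 / c) (lower i' + var_sum ^ Suc k * (var_sum * lower z + smul c' z - lower u))" by simp
    then have "var_sum ^ k * u = smul (1 / c) (lower i') +
        var_sum ^ Suc k * smul (1 / c) (var_sum * lower z + smul c' z - lower u)"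
      using \<open>c \<noteq> 0\<close> by (simp add: pm.scale_right_distrib smul_mult_right)
    then have "v = (i + smul (1 / c) (lower i')) +
        var_sum ^ Suc k * smul (1 / c) (var_sum * lower z + smul c' z - lower u)"
      using u(3) by (simp add: add.assoc)
    moreover have "homogeneous d (smul (1 / c) (var_sum * lower z + smul c' z - lower u))"
      using u(2) d z(2) by (intro homogeneous_smul homogeneous_diff homogeneous_add homogeneous_var_sum_lower
        homogeneous_lower) auto
    moreover have "i + smul (1 / c) (lower i') \<in> pm.span (monomial ` cube_mons e)"
      using u(1) lower_cube_mons[OF z(1)] by (intro pm.span_add pm.span_scale)
    ultimately show ?case unfolding d by blast
  qed
  then show ?case using Suc.prems unfolding e_def by blast
qed

section \<open>A special coordinate change\<close>

text \<open>The linear change sending x1, x2, x3, x4 to x1, x1 + 2 x2 - x3, x2, x4 - 2 x1 - 3 x2 + x3, and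
  its inverse. It maps the sum of the variables to x4, and the cubes of the variables to four cubes
  of linear forms in general position.\<close>
definition special_change :: "'k::field^4^4" where
  "special_change = (\<chi> i j.
     if j = 0 then (if i = 0 then 1 else 0)
     else if j = 1 then (if i = 0 then 1 else if i = 1 then 2 else if i = 2 then -1 else 0)
     else if j = 2 then (if i = 1 then 1 else 0)
     else (if i = 0 then -2 else if i = 1 then -3 else 1))"

definition special_change_inv :: "'k::field^4^4" where
  "special_change_inv = (\<chi> i j.
     if j = 0 then (if i = 0 then 1 else 0)
     else if j = 1 then (if i = 2 then 1 else 0)
     else if j = 2 then (if i = 0 then 1 else if i = 1 then -1 else if i = 2 then 2 else 0)
     else 1)"

lemma special_change_inverse: "special_change ** special_change_inv = (mat 1 :: 'k::field^4^4)"
  by (simp add: vec_eq_iff all_type_4 matrix_matrix_mult_def sum_type_4 mat_def special_change_def special_change_inv_def)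

lemma special_change_GL4: "(special_change :: 'k::field^4^4) \<in> GL4"
  unfolding GL4_def mem_Collect_eq invertible_right_inverse using special_change_inverse by blast

lemma special_change_X:
  "lin_change special_change x1 = (x1 :: 'k::field S)"
  "lin_change special_change x2 = (x1 + 2 * x2 - x3 :: 'k S)"
  "lin_change special_change x3 = (x2 :: 'k S)"
  "lin_change special_change x4 = (x4 - (2 * x1 + 3 * x2 - x3) :: 'k S)"
  by (simp_all add: lin_change_X sum_type_4 special_change_def single_uminus const_hom.c_0
      algebra_simps)

lemma special_change_var_sum: "lin_change special_change var_sum = (x4 :: 'k::field S)"
  by (simp add: lin_change_sum sum_type_4 special_change_X algebra_simps)

definition special_cubics :: "4 \<Rightarrow> 'k::field S" where
  "special_cubics i = lin_change special_change (X i ^ 3)"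

lemma special_cubics_in: "special_cubics \<in> cubics4"
  unfolding cubics4_def special_cubics_def
  using homogeneous_power[OF homogeneous_X, of 3] homogeneous_lin_change by fastforce

lemma special_cubics_eq:
  "special_cubics 0 = (x1 ^ 3 :: 'k::field S)"
  "special_cubics 1 = ((x1 + 2 * x2 - x3) ^ 3 :: 'k S)"
  "special_cubics 2 = (x2 ^ 3 :: 'k S)"
  "special_cubics 3 = ((x4 - (2 * x1 + 3 * x2 - x3)) ^ 3 :: 'k S)"
  by (simp_all add: special_cubics_def special_change_X)

section \<open>General position of the special cubics, degree by degree\<close>

lemma mem_span_monomials:
  fixes p :: "'k::field S"
  assumes "Poly_Mapping.keys p \<subseteq> A"
  shows "p \<in> pm.span (monomial ` A)"
proof -
  have "(\<Sum>m\<in>Poly_Mapping.keys p. smul (Poly_Mapping.lookup p m) (monomial m)) \<in> pm.span (monomial ` A)"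
    by (intro pm.span_sum pm.span_scale pm.span_base) (use assms in auto)
  then show ?thesis by (simp flip: as_sum_monomials)
qed

text \<open>A factorisation shows at once that every monomial of p involves one of the two
  variables; p is never expanded.\<close>

lemma X_mult_mem_cubic_span:
  fixes p :: "'k::field S"
  assumes "homogeneous d p" "p = X i * r + X j * s"
    "\<And>n. n \<in> hmons d \<Longrightarrow> 1 \<le> Poly_Mapping.lookup n i \<or> 1 \<le> Poly_Mapping.lookup n j \<Longrightarrow> n \<in> V"
  shows "p \<in> cubic_span e V g"
proof -
  have X: "1 \<le> Poly_Mapping.lookup n i" if n: "n \<in> Poly_Mapping.keys (X i * r)" for n i and r :: "'k S"
  proof -
    obtain k where "n = Poly_Mapping.single i 1 + k"
      using n keys_mult[of "X i :: 'k S" r] by (auto simp: X_eq_monomial)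
    then show ?thesis by (simp add: lookup_add)
  qed
  have "n \<in> V" if n: "n \<in> Poly_Mapping.keys p" for n
  proof (rule assms(3))
    show "n \<in> hmons d" using assms(1) n by (auto simp: homogeneous_def hmons_def)
    show "1 \<le> Poly_Mapping.lookup n i \<or> 1 \<le> Poly_Mapping.lookup n j"
      using n keys_add[of "X i * r" "X j * s"] X unfolding assms(2) by blast
  qed
  then have "p \<in> pm.span (monomial ` V)" by (intro mem_span_monomials) auto
  then show ?thesis unfolding cubic_span_def using pm.span_mono[OF Un_upper2] by blast
qed

lemma cubic_span_subspace: "pm.subspace (cubic_span d V g)"
  by (simp add: cubic_span_def)

lemma monomial_mem_cubic_span: "n \<in> V \<Longrightarrow> monomial n \<in> cubic_span d V g"
  unfolding cubic_span_def by (intro pm.span_base) auto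

lemma mult_mem_cubic_span: "n \<in> hmons d \<Longrightarrow> monomial n * g i \<in> cubic_span d V g"
  unfolding cubic_span_def by (intro pm.span_base) auto

lemma subspace_numeral_mult:
  "pm.subspace U \<Longrightarrow> p \<in> U \<Longrightarrow> numeral n * p \<in> U"
  unfolding numeral_eq_smul by (rule pm.subspace_scale)

lemma subspace_numeral_cancel:
  assumes "pm.subspace U" "numeral n * p \<in> (U :: 'k::field_char_0 S set)"
  shows "p \<in> U"
proof -
  have "smul (1 / numeral n) (smul (numeral n) p) \<in> U"
    using assms(2) unfolding numeral_eq_smul by (rule pm.subspace_scale[OF assms(1)])
  then show ?thesis by simp
qed

lemmas subspace_intros = pm.subspace_add pm.subspace_diff subspace_numeral_mult

text \<open>The coefficients solve the linear system that expresses the six remaining quartic monomials in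
  x, y, z by the multiples of the two cubes and the nine quartic monomials known to be in the span.\<close>
lemma special_identities:
  fixes x y z :: "'a::comm_ring_1"
  shows
  "2 * (x * z^3) = 21 * (x * (x + 2 * y - z)^3) + 30 * (y * (x + 2 * y - z)^3) - 3 * (z * (x + 2 * y - z)^3) - 2 * (x * (2 * x + 3 * y - z)^3) - 9 * (y * (2 * x + 3 * y - z)^3) + 5 * (z * (2 * x + 3 * y - z)^3) - 5 * (x^4) - 12 * (x^3 * y) + 2 * (x^3 * z) + 12 * (x * y^3) + 3 * (y^4) + 6 * (y^3 * z) - 6 * (y * z^3) + 2 * (z^4)"
  "12 * (x * y * z^2) = 32 * (x * (x + 2 * y - z)^3) + 56 * (y * (x + 2 * y - z)^3) - 8 * (z * (x + 2 * y - z)^3) - 2 * (x * (2 * x + 3 * y - z)^3) - 17 * (y * (2 * x + 3 * y - z)^3) + 9 * (z * (2 * x + 3 * y - z)^3) - 16 * (x^4) - 40 * (x^3 * y) + 8 * (x^3 * z) + 44 * (x * y^3) + 11 * (y^4) + 34 * (y^3 * z) - 36 * (y^2 * z^2) + 6 * (y * z^3) + (z^4)"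
  "6 * (x * y^2 * z) = 3 * (x * (x + 2 * y - z)^3) + 6 * (y * (x + 2 * y - z)^3) - (z * (x + 2 * y - z)^3) - 2 * (y * (2 * x + 3 * y - z)^3) + (z * (2 * x + 3 * y - z)^3) - 3 * (x^4) - 8 * (x^3 * y) + 2 * (x^3 * z) + 12 * (x * y^3) + 6 * (y^4) - (y^3 * z) - 3 * (y^2 * z^2) + (y * z^3)"
  "6 * (x^2 * z^2) = 39 * (x * (x + 2 * y - z)^3) + 30 * (y * (x + 2 * y - z)^3) - 3 * (z * (x + 2 * y - z)^3) - 6 * (x * (2 * x + 3 * y - z)^3) - 9 * (y * (2 * x + 3 * y - z)^3) + 7 * (z * (2 * x + 3 * y - z)^3) + 9 * (x^4) + 24 * (x^3 * y) - 8 * (x^3 * z) - 24 * (x * y^3) + 3 * (y^4) - 48 * (y^3 * z) + 54 * (y^2 * z^2) - 24 * (y * z^3) + 4 * (z^4)"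
  "6 * (x^2 * y * z) = 14 * (x * (x + 2 * y - z)^3) + 14 * (y * (x + 2 * y - z)^3) - 2 * (z * (x + 2 * y - z)^3) - 2 * (x * (2 * x + 3 * y - z)^3) - 4 * (y * (2 * x + 3 * y - z)^3) + 3 * (z * (2 * x + 3 * y - z)^3) + 2 * (x^4) + 6 * (x^3 * y) - 4 * (x^3 * z) - 10 * (x * y^3) - 4 * (y^4) - 5 * (y^3 * z) + 9 * (y^2 * z^2) - 5 * (y * z^3) + (z^4)"
  "24 * (x^2 * y^2) = 20 * (x * (x + 2 * y - z)^3) + 24 * (y * (x + 2 * y - z)^3) - 4 * (z * (x + 2 * y - z)^3) - 2 * (x * (2 * x + 3 * y - z)^3) - 7 * (y * (2 * x + 3 * y - z)^3) + 5 * (z * (2 * x + 3 * y - z)^3) - 4 * (x^4) - 16 * (x^3 * y) - 16 * (x * y^3) - 3 * (y^4) - 4 * (y^3 * z) + 6 * (y^2 * z^2) - 4 * (y * z^3) + (z^4)"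
  by (simp_all add: algebra_simps power2_eq_square power3_eq_cube power4_eq_xxxx)

lemma homogeneous_special_cubics: "homogeneous 3 (special_cubics i)"
  using special_cubics_in by (auto simp: cubics4_def)

text \<open>The first two right-hand sides have the shape required by
  \<open>X_mult_mem_cubic_span\<close>, whence the term w * 0. The third and fourth solve for x y^2
  and x^2 y: six times the binary cube (x + 2y)^3 minus (2x + 3y)^3 eliminates x^2 y.\<close>

lemma cube_identities:
  fixes x y z w :: "'a::comm_ring_1"
  shows "(x + 2 * y - z) ^ 3 - (x ^ 3 + 6 * (x ^ 2 * y) + 12 * (x * y ^ 2) + 8 * y ^ 3) =
      z * (3 * (x + 2 * y) * z - 3 * (x + 2 * y) ^ 2 - z ^ 2) + w * 0"
    and "(w - (2 * x + 3 * y - z)) ^ 3 + (8 * x ^ 3 + 36 * (x ^ 2 * y) + 54 * (x * y ^ 2) + 27 * y ^ 3) =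
      z * (3 * (2 * x + 3 * y) ^ 2 - 3 * (2 * x + 3 * y) * z + z ^ 2) +
      w * (3 * (2 * x + 3 * y - z) ^ 2 - 3 * w * (2 * x + 3 * y - z) + w ^ 2)"
    and "18 * (x * y ^ 2) = 6 * (x ^ 3 + 6 * (x ^ 2 * y) + 12 * (x * y ^ 2) + 8 * y ^ 3) -
      (8 * x ^ 3 + 36 * (x ^ 2 * y) + 54 * (x * y ^ 2) + 27 * y ^ 3) + 2 * x ^ 3 - 21 * y ^ 3"
    and "6 * (x ^ 2 * y) = (x ^ 3 + 6 * (x ^ 2 * y) + 12 * (x * y ^ 2) + 8 * y ^ 3) -
      12 * (x * y ^ 2) - x ^ 3 - 8 * y ^ 3"
    and "(w - (2 * x + 3 * y - z)) ^ 3 = w * (3 * (2 * x + 3 * y - z) ^ 2 - 3 * w * (2 * x + 3 * y - z) + w ^ 2) -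
      (2 * x + 3 * y - z) ^ 3"
  by (simp_all add: algebra_simps power2_eq_square power3_eq_cube)

text \<open>Modulo x3 and x4 the special cubics are, up to sign, the cubes of x1, x1 + 2 x2, x2 and
  2 x1 + 3 x2. Cubes of four pairwise nonproportional binary linear forms are a basis of the binary
  cubics in characteristic zero.\<close>

lemma special_position_3:
  "monomial ` hmons 3 \<subseteq> cubic_span 0 {n \<in> hmons 3. 0 < Poly_Mapping.lookup n 2 + Poly_Mapping.lookup n 3}
     (special_cubics :: 4 \<Rightarrow> 'k::field_char_0 S)"
proof -
  define V where "V = {n \<in> hmons 3. 0 < Poly_Mapping.lookup n 2 + Poly_Mapping.lookup n 3}"
  define U where "U = cubic_span 0 V (special_cubics :: 4 \<Rightarrow> 'k S)"
  have U: "pm.subspace U" unfolding U_def by (rule cubic_span_subspace)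
  have g: "special_cubics i \<in> U" for i
    using mult_mem_cubic_span[of 0 0 special_cubics i] by (simp add: hmons_def U_def)
  have hm: "homogeneous 3 (x1 ^ 3 :: 'k S)" "homogeneous 3 (x1 ^ 2 * x2 :: 'k S)"
    "homogeneous 3 (x1 * x2 ^ 2 :: 'k S)" "homogeneous 3 (x2 ^ 3 :: 'k S)"
    using homogeneous_monomial[of "mon4 3 0 0 0" 3, where ?'k='k] homogeneous_monomial[of "mon4 2 1 0 0" 3, where ?'k='k]
      homogeneous_monomial[of "mon4 1 2 0 0" 3, where ?'k='k] homogeneous_monomial[of "mon4 0 3 0 0" 3, where ?'k='k]
    by (simp_all add: monomial_mon4 mon_degree_eq)
  have in_U: "p \<in> U" if "homogeneous 3 p" "p = x3 * r + x4 * s" for p r s :: "'k S"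
    unfolding U_def by (rule X_mult_mem_cubic_span[OF that]) (auto simp: V_def)
  have cubes: "x1 ^ 3 \<in> U" "x2 ^ 3 \<in> U"
    using g[of 0] g[of 2] by (simp_all add: special_cubics_eq)
  let ?B = "x1 ^ 3 + 6 * (x1 ^ 2 * x2) + 12 * (x1 * x2 ^ 2) + 8 * x2 ^ 3 :: 'k S"
  let ?C = "8 * x1 ^ 3 + 36 * (x1 ^ 2 * x2) + 54 * (x1 * x2 ^ 2) + 27 * x2 ^ 3 :: 'k S"
  have "homogeneous 3 (special_cubics 1 - ?B)"
    unfolding numeral_eq_smul
    by (intro homogeneous_diff homogeneous_special_cubics homogeneous_add homogeneous_smul hm)
  then have "special_cubics 1 - ?B \<in> U"
    by (rule in_U) (unfold special_cubics_eq, rule cube_identities(1))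
  from pm.subspace_diff[OF U g[of 1] this] have B: "?B \<in> U" by (simp only: diff_diff_eq2 add_diff_cancel_left')
  have "homogeneous 3 (special_cubics 3 + ?C)"
    unfolding numeral_eq_smul
    by (intro homogeneous_special_cubics homogeneous_add homogeneous_smul hm)
  then have "special_cubics 3 + ?C \<in> U"
    by (rule in_U) (unfold special_cubics_eq, rule cube_identities(2))
  from pm.subspace_diff[OF U this g[of 3]] have C: "?C \<in> U" by (simp only: add_diff_cancel_left')
  have m12: "x1 * x2 ^ 2 \<in> U"
    by (rule subspace_numeral_cancel[OF U], subst cube_identities(3))
      (intro subspace_intros[OF U] B C cubes)
  have m21: "x1 ^ 2 * x2 \<in> U"
    by (rule subspace_numeral_cancel[OF U], subst cube_identities(4))
      (intro subspace_intros[OF U] B m12 cubes)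
  have "monomial m \<in> U" if "m \<in> hmons 3" for m
  proof (cases "m \<in> V")
    case True
    then show ?thesis unfolding U_def by (rule monomial_mem_cubic_span)
  next
    case False
    define a b where ab: "a = Poly_Mapping.lookup m 0" "b = Poly_Mapping.lookup m 1"
    have m: "m = mon4 a b 0 0" "a + b = 3"
      using that False mon4_lookup[of m] unfolding V_def hmons_def by (auto simp: mon_degree_eq ab)
    then have b: "b = 3 - a" by simp
    have "a = 0 \<or> a = 1 \<or> a = 2 \<or> a = 3" using m(2) by presburger
    then show ?thesis
      using cubes m12 m21 unfolding m(1) b by (elim disjE) (simp_all add: monomial_mon4)
  qed
  then show ?thesis by (auto simp: U_def V_def)
qed

text \<open>The count is tight: modulo x4 the four cubics have 12 multiples by x1, x2, x3, which
  together with three monomials must span the 15 quartics in three variables. The linear forms are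
  chosen so that this square system is invertible.\<close>

lemma special_position_4:
  "monomial ` hmons 4 \<subseteq> cubic_span 1 (insert (mon4 0 2 2 0) (insert (mon4 0 1 3 0) (insert (mon4 0 0 4 0) (last_mons 1 4))))
     (special_cubics :: 4 \<Rightarrow> 'k::field_char_0 S)"
proof -
  define V where "V = insert (mon4 0 2 2 0) (insert (mon4 0 1 3 0) (insert (mon4 0 0 4 0) (last_mons 1 4)))"
  define U where "U = cubic_span 1 V (special_cubics :: 4 \<Rightarrow> 'k S)"
  have U: "pm.subspace U" unfolding U_def by (rule cubic_span_subspace)
  have g: "X j * special_cubics i \<in> U" for i j
    using mult_mem_cubic_span[of "Poly_Mapping.single j 1" 1 special_cubics i] by (simp add: hmons_def U_def X_eq_monomial)
  have in_U: "p \<in> U" if "homogeneous 4 p" "p = x4 * r + x4 * 0" for p r :: "'k S"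
    unfolding U_def by (rule X_mult_mem_cubic_span[OF that]) (auto simp: V_def last_mons_def)
  have B: "X j * (x1 + 2 * x2 - x3) ^ 3 \<in> U" for j using g[of j 1] by (simp add: special_cubics_eq)
  \<comment> \<open>Modulo x4 the fourth cubic is -(2 x1 + 3 x2 - x3)^3, and all multiples of x4 in
    degree 4 are in U.\<close>
  have C: "X j * (2 * x1 + 3 * x2 - x3) ^ 3 \<in> U" for j
  proof -
    have "homogeneous 1 (2 * x1 + 3 * x2 - x3 :: 'k S)"
      unfolding numeral_eq_smul by (intro homogeneous_diff homogeneous_add homogeneous_smul homogeneous_X)
    from homogeneous_mult[OF homogeneous_X[of j] homogeneous_power[OF this, of 3]]
    have "homogeneous 4 (X j * (2 * x1 + 3 * x2 - x3) ^ 3 :: 'k S)" by simp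
    moreover have "homogeneous 4 (X j * special_cubics 3 :: 'k S)"
      using homogeneous_mult[OF homogeneous_X[of j] homogeneous_special_cubics[of 3]] by simp
    ultimately have "homogeneous 4 (X j * special_cubics 3 + X j * (2 * x1 + 3 * x2 - x3) ^ 3 :: 'k S)"
      by (rule homogeneous_add[rotated])
    moreover have "X j * special_cubics 3 + X j * (2 * x1 + 3 * x2 - x3) ^ 3 =
        x4 * (X j * (3 * (2 * x1 + 3 * x2 - x3) ^ 2 - 3 * x4 * (2 * x1 + 3 * x2 - x3) + x4 ^ 2) :: 'k S) + x4 * 0"
      unfolding special_cubics_eq cube_identities(5)
      by (simp only: distrib_left[symmetric] diff_add_cancel mult.left_commute mult_zero_right add_0_right)
    ultimately have "X j * special_cubics 3 + X j * (2 * x1 + 3 * x2 - x3) ^ 3 \<in> U" by (rule in_U)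
    from pm.subspace_diff[OF U this g[of j 3]] show ?thesis by (simp only: add_diff_cancel_left')
  qed
  have cubes: "x1 ^ 4 \<in> U" "x1 ^ 3 * x2 \<in> U" "x1 ^ 3 * x3 \<in> U" "x1 * x2 ^ 3 \<in> U" "x2 ^ 4 \<in> U" "x2 ^ 3 * x3 \<in> U"
  proof -
    have "X i * X i ^ 3 = (X i ^ 4 :: 'k S)" for i by (simp add: eval_nat_numeral)
    then show "x1 ^ 4 \<in> U" "x2 ^ 4 \<in> U" using g[of 0 0] g[of 1 2] by (simp_all add: special_cubics_eq)
    show "x1 ^ 3 * x2 \<in> U" using g[of 1 0] unfolding special_cubics_eq by (subst mult.commute)
    show "x1 ^ 3 * x3 \<in> U" using g[of 2 0] unfolding special_cubics_eq by (subst mult.commute)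
    show "x1 * x2 ^ 3 \<in> U" using g[of 0 2] unfolding special_cubics_eq .
    show "x2 ^ 3 * x3 \<in> U" using g[of 2 2] unfolding special_cubics_eq by (subst mult.commute)
  qed
  have known: "monomial n \<in> U" if "n \<in> V" for n
    unfolding U_def using that by (rule monomial_mem_cubic_span)
  have low: "x2 ^ 2 * x3 ^ 2 \<in> U" "x2 * x3 ^ 3 \<in> U" "x3 ^ 4 \<in> U"
    using known[of "mon4 0 2 2 0"] known[of "mon4 0 1 3 0"] known[of "mon4 0 0 4 0"]
    by (simp_all add: V_def monomial_mon4)
  have cancel: "p \<in> U" if "numeral n * p = q" "q \<in> U" for n p q
    using subspace_numeral_cancel[OF U, of n p] that by simp
  have rest: "x1 * x3 ^ 3 \<in> U" "x1 * x2 * x3 ^ 2 \<in> U" "x1 * x2 ^ 2 * x3 \<in> U" "x1 ^ 2 * x3 ^ 2 \<in> U" "x1 ^ 2 * x2 * x3 \<in> U" "x1 ^ 2 * x2 ^ 2 \<in> U"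
  proof -
    show "x1 * x3 ^ 3 \<in> U"
      by (rule cancel[OF special_identities(1)[where x=x1 and y=x2 and z=x3]], intro subspace_intros[OF U] B C cubes low)
    show "x1 * x2 * x3 ^ 2 \<in> U"
      by (rule cancel[OF special_identities(2)[where x=x1 and y=x2 and z=x3]], intro subspace_intros[OF U] B C cubes low)
    show "x1 * x2 ^ 2 * x3 \<in> U"
      by (rule cancel[OF special_identities(3)[where x=x1 and y=x2 and z=x3]], intro subspace_intros[OF U] B C cubes low)
    show "x1 ^ 2 * x3 ^ 2 \<in> U"
      by (rule cancel[OF special_identities(4)[where x=x1 and y=x2 and z=x3]], intro subspace_intros[OF U] B C cubes low)
    show "x1 ^ 2 * x2 * x3 \<in> U"
      by (rule cancel[OF special_identities(5)[where x=x1 and y=x2 and z=x3]], intro subspace_intros[OF U] B C cubes low)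
    show "x1 ^ 2 * x2 ^ 2 \<in> U"
      by (rule cancel[OF special_identities(6)[where x=x1 and y=x2 and z=x3]], intro subspace_intros[OF U] B C cubes low)
  qed
  have "monomial m \<in> U" if "m \<in> hmons 4" for m
  proof (cases "m \<in> last_mons 1 4")
    case True
    then show ?thesis by (intro known) (simp add: V_def)
  next
    case False
    define a b c where abc: "a = Poly_Mapping.lookup m 0" "b = Poly_Mapping.lookup m 1" "c = Poly_Mapping.lookup m 2"
    have last: "Poly_Mapping.lookup m 3 = 0"
      using that False unfolding last_mons_def by simp
    have m: "m = mon4 a b c 0" "a + b + c = 4"
      using that mon4_lookup[of m] unfolding last hmons_def by (auto simp: mon_degree_eq abc last)
    then have c: "c = 4 - a - b" by simp
    have "a = 0 \<or> a = 1 \<or> a = 2 \<or> a = 3 \<or> a = 4" "b = 0 \<or> b = 1 \<or> b = 2 \<or> b = 3 \<or> b = 4" using m(2) by presburger+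
    then show ?thesis
      using m(2) cubes low rest unfolding m(1) c by (elim disjE) (simp_all add: monomial_mon4)
  qed
  then show ?thesis by (auto simp: U_def V_def)
qed

lemma special_change_cube_mons:
  assumes "u \<in> pm.span (monomial ` cube_mons (e + 3) :: 'k::field S set)"
  shows "lin_change special_change u \<in> cubic_span e V special_cubics"
  using assms unfolding cubic_span_def
proof (rule linear_span_into[OF lin_change_linear])
  fix b :: "'k S" assume "b \<in> monomial ` cube_mons (e + 3)"
  then obtain n i where n: "b = monomial n" "mon_degree n = e + 3" "3 \<le> Poly_Mapping.lookup n i"
    by (auto simp: cube_mons_def hmons_def)
  let ?k = "n - Poly_Mapping.single i 3"
  have eq: "?k + Poly_Mapping.single i 3 = n" using n(3) by (rule minus_single_add)
  have "mon_degree ?k = e" using arg_cong[OF eq, of mon_degree] n(2) by simp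
  then have "homogeneous e (lin_change special_change (monomial ?k) :: 'k S)"
    by (intro homogeneous_lin_change homogeneous_monomial)
  then have "lin_change special_change (monomial ?k) * special_cubics i \<in>
      pm.span {monomial n * special_cubics i :: 'k S | n i. n \<in> hmons e}"
    unfolding homogeneous_iff_span
    by (rule linear_span_into[OF mult_linear_right]) (auto intro: pm.span_base)
  moreover have "lin_change special_change b = lin_change special_change (monomial ?k) * special_cubics i"
    unfolding n(1) special_cubics_def lin_change_simps(2)[symmetric] monomial_single_power[symmetric]
      monomial_add[symmetric] eq ..
  ultimately show "lin_change special_change b \<in>
      pm.span ({monomial n * special_cubics i | n i. n \<in> hmons e} \<union> monomial ` V)"
    using pm.span_mono[OF Un_upper1] by (metis (no_types, lifting) subsetD)
qed

text \<open>The Lefschetz property is known for the sum of the variables. Pulling x back by the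
  inverse change and pushing the decomposition forward turns that sum into x4 and the cube part into
  multiples of the special cubics.\<close>

lemma special_position_last:
  assumes e: "e \<in> {2..6}"
  shows "monomial ` hmons (e + 3) \<subseteq>
    cubic_span e (last_mons (2 * e - 2) (e + 3)) (special_cubics :: 4 \<Rightarrow> 'k::field_char_0 S)"
proof
  let ?U = "cubic_span e (last_mons (2 * e - 2) (e + 3)) (special_cubics :: 4 \<Rightarrow> 'k S)"
  fix x :: "'k S" assume "x \<in> monomial ` hmons (e + 3)"
  then have "homogeneous (e + 3) x" by (auto simp: hmons_def intro: homogeneous_monomial)
  then have v: "homogeneous (e + 3) (lin_change special_change_inv x)" by (rule homogeneous_lin_change)
  have x: "x = lin_change special_change (lin_change special_change_inv x)"
    by (simp add: lin_change_inverse[OF special_change_inverse])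
  show "x \<in> ?U"
  \<comment> \<open>Degree 9 is separate: the exponent 2e - 2 = 10 exceeds it, and everything lies
    in the ideal already.\<close>
  proof (cases "e = 6")
    case True
    then have "lin_change special_change_inv x \<in> pm.span (monomial ` cube_mons (e + 3))"
      using v hmons_9_eq by (simp add: homogeneous_iff_span)
    then show ?thesis by (subst x) (rule special_change_cube_mons)
  next
    case False
    have "9 - (6 - e) = e + 3" "6 - e \<le> 5" "2 * e - 2 \<le> 2 * (9 - (6 - e)) - 8" "2 * e - 2 \<le> e + 3"
      using e False by auto
    then obtain i q where iq: "i \<in> pm.span (monomial ` cube_mons (e + 3))"
      "homogeneous (e + 3 - (2 * e - 2)) q" "lin_change special_change_inv x = i + var_sum ^ (2 * e - 2) * q"
      using strong_lefschetz[of "6 - e" "2 * e - 2" "lin_change special_change_inv x"] v by metis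
    have "homogeneous (e + 3 - (2 * e - 2)) (lin_change special_change q)"
      using iq(2) by (rule homogeneous_lin_change)
    then have "x4 ^ (2 * e - 2) * lin_change special_change q \<in> ?U"
      unfolding homogeneous_iff_span cubic_span_def
    proof (rule linear_span_into[OF mult_linear])
      fix b :: "'k S" assume "b \<in> monomial ` hmons (e + 3 - (2 * e - 2))"
      then obtain n where n: "b = monomial n" "mon_degree n = e + 3 - (2 * e - 2)" by (auto simp: hmons_def)
      have "Poly_Mapping.single 3 (2 * e - 2) + n \<in> last_mons (2 * e - 2) (e + 3)"
        using n(2) \<open>2 * e - 2 \<le> e + 3\<close> by (simp add: last_mons_def hmons_def lookup_add)
      then show "x4 ^ (2 * e - 2) * b \<in> pm.span ({monomial n * special_cubics i | n i. n \<in> hmons e} \<union>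
          monomial ` last_mons (2 * e - 2) (e + 3))"
        unfolding n(1) monomial_single_power[symmetric] monomial_add[symmetric]
        by (intro pm.span_base) auto
    qed
    then have "lin_change special_change i + x4 ^ (2 * e - 2) * lin_change special_change q \<in> ?U"
      by (intro pm.subspace_add[OF cubic_span_subspace] special_change_cube_mons iq(1))
    then show ?thesis
      by (subst x) (simp add: iq(3) special_change_var_sum)
  qed
qed

lemma general_position_special: "general_position (special_cubics :: 4 \<Rightarrow> 'k::field_char_0 S)"
  unfolding general_position_def
  using special_position_3 special_position_4 special_position_last by blast

section \<open>Generic cubics\<close>

lemma coeffs_polyfun_on_imp_coords:
  assumes "\<And>i. coeffs_polyfun_on coords V 3 (\<lambda>b. g b i)"
  shows "polyfun_on coords V (\<lambda>b. cubic_coords (g b) v)"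
  using assms by (cases v) (simp add: cubic_coords_def coeffs_polyfun_on_def)

lemma coeffs_polyfun_on_compose:
  assumes "polyfun_on cubic_coords cubics4 D" "\<And>i. coeffs_polyfun_on coords V 3 (\<lambda>b. g b i)"
  shows "polyfun_on coords V (\<lambda>b. D (g b))"
  using assms(1)
proof (rule polyfun_on_compose)
  show "g b \<in> cubics4" if "b \<in> V" for b
    using assms(2) that by (simp add: cubics4_def coeffs_polyfun_on_def)
qed (rule coeffs_polyfun_on_imp_coords[OF assms(2)])

text \<open>The right inverse makes the substitution surjective, so a multiplier can be pulled back
  and the image of an ideal is again an ideal.\<close>

lemma ideal_gen_lin_change:
  fixes f :: "4 \<Rightarrow> 'k::field S"
  assumes "a ** b = mat 1"
  shows "ideal_gen (range (\<lambda>i. lin_change a (f i))) = lin_change a ` ideal_gen (range f)"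
proof
  have sub: "idl.subspace (lin_change a ` ideal_gen (range f))"
  proof (rule idl.subspaceI)
    show "0 \<in> lin_change a ` ideal_gen (range f)"
      by (rule image_eqI[of _ _ 0]) (simp_all add: idl.span_zero)
    show "x + y \<in> lin_change a ` ideal_gen (range f)"
      if "x \<in> lin_change a ` ideal_gen (range f)" "y \<in> lin_change a ` ideal_gen (range f)" for x y
      using that by (auto simp flip: lin_change_simps(1) intro: idl.span_add)
    show "c * x \<in> lin_change a ` ideal_gen (range f)"
      if x: "x \<in> lin_change a ` ideal_gen (range f)" for c x
    proof -
      obtain p where p: "p \<in> ideal_gen (range f)" "x = lin_change a p" using x by auto
      show ?thesis
        by (rule image_eqI[of _ _ "lin_change b c * p"])
          (simp_all add: p idl.span_scale lin_change_inverse[OF assms])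
    qed
  qed
  show "ideal_gen (range (\<lambda>i. lin_change a (f i))) \<subseteq> lin_change a ` ideal_gen (range f)"
    using sub by (intro idl.span_minimal) (auto intro: idl.span_base)
  have "p \<in> {p. lin_change a p \<in> ideal_gen (range (\<lambda>i. lin_change a (f i)))}" if "p \<in> ideal_gen (range f)" for p
    using that
  proof (rule subsetD[OF idl.span_minimal, rotated 2])
    show "idl.subspace {p. lin_change a p \<in> ideal_gen (range (\<lambda>i. lin_change a (f i)))}"
      by (rule idl.subspaceI) (auto intro: idl.span_zero idl.span_add idl.span_scale)
  qed (auto intro: idl.span_base)
  then show "lin_change a ` ideal_gen (range f) \<subseteq> ideal_gen (range (\<lambda>i. lin_change a (f i)))"
    by auto
qed

lemma GL4_inverse:
  assumes "a \<in> GL4"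
  shows "\<exists>b. a ** b = (mat 1 :: 'k::field^4^4)"
  using assms unfolding GL4_def invertible_def by blast

lemma lin_change_cubics4:
  "f \<in> cubics4 \<Longrightarrow> (\<lambda>i. lin_change a (f i :: 'k::field S)) \<in> cubics4"
  by (auto simp: cubics4_def intro: homogeneous_lin_change)

text \<open>Every coordinate change with D nonzero gives one of the two forms. A single one in type
  I position spreads form I over an open neighbourhood; if there is none, form II occurs on the
  whole set where D is nonzero.\<close>

lemma gin_cases:
  fixes f :: "4 \<Rightarrow> 'k::field S"
  assumes f: "f \<in> cubics4" and dim: "dim_bounded (ideal_gen (range f))"
    and D: "polyfun_on cubic_coords cubics4 D" "\<And>g. g \<in> cubics4 \<Longrightarrow> D g \<noteq> 0 \<Longrightarrow> general_position g"
    and a0: "a0 \<in> GL4" "D (\<lambda>i. lin_change a0 (f i)) \<noteq> 0"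
  shows "\<exists>J. is_gin (ideal_gen (range f)) J \<and> (J = form_I \<or> J = form_II)"
proof -
  let ?g = "\<lambda>a i. lin_change a (f i)"
  let ?coords = "\<lambda>(a :: 'k^4^4) (i, j). a $ i $ j"
  have init: "initial_ideal (lin_change a ` ideal_gen (range f)) = (if type_I_position (?g a) then form_I else form_II)"
    if a: "a \<in> GL4" "D (?g a) \<noteq> 0" for a
  proof -
    obtain b where b: "a ** b = mat 1" using GL4_inverse[OF a(1)] by blast
    have eq: "lin_change a ` ideal_gen (range f) = ideal_gen (range (?g a))"
      by (rule ideal_gen_lin_change[OF b, symmetric])
    interpret cubic_ideal "ideal_gen (range (?g a))" "?g a"
      by unfold_locales (auto intro: ideal_gen_subspace idl.span_scale idl.span_base)
    show ?thesis
      unfolding eq using dim_bounded_lin_change[OF dim, of a] D(2)[OF lin_change_cubics4[OF f] a(2)]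
      by (intro initial_ideal_cases) (simp_all add: eq)
  qed
  have pf: "polyfun_on ?coords GL4 (\<lambda>a. D' (?g a))" if "polyfun_on cubic_coords cubics4 D'" for D'
    using that
    by (rule coeffs_polyfun_on_compose) (use f in \<open>auto simp: cubics4_def intro: coeffs_polyfun_on_lin_change\<close>)
  show ?thesis
  proof (cases "\<exists>a1\<in>GL4. D (?g a1) \<noteq> 0 \<and> type_I_position (?g a1)")
    case True
    then obtain a1 where a1: "a1 \<in> GL4" "D (?g a1) \<noteq> 0" "type_I_position (?g a1)" by blast
    obtain E where E: "polyfun_on cubic_coords cubics4 E" "E (?g a1) \<noteq> 0"
      "\<forall>g\<in>cubics4. E g \<noteq> 0 \<longrightarrow> type_I_position g"
      using type_I_position_is_open[OF lin_change_cubics4[OF f] a1(3)] by blast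
    let ?U = "{a \<in> GL4. D (?g a) * E (?g a) \<noteq> 0}"
    have "zariski_open_in ?coords GL4 ?U"
      by (intro zariski_open_in_polyfun polyfun_on_mult pf D E)
    moreover have "a1 \<in> ?U" using a1 E by simp
    moreover have "\<forall>a\<in>?U. initial_ideal (lin_change a ` ideal_gen (range f)) = form_I"
      using init E(3) lin_change_cubics4[OF f] by simp
    ultimately have "is_gin (ideal_gen (range f)) form_I" unfolding is_gin_def by blast
    then show ?thesis by blast
  next
    case False
    let ?U = "{a \<in> GL4. D (?g a) \<noteq> 0}"
    have "zariski_open_in ?coords GL4 ?U"
      by (intro zariski_open_in_polyfun pf D)
    moreover have "a0 \<in> ?U" using a0 by simp
    moreover have "\<forall>a\<in>?U. initial_ideal (lin_change a ` ideal_gen (range f)) = form_II"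
      using init False by auto
    ultimately have "is_gin (ideal_gen (range f)) form_II" unfolding is_gin_def by blast
    then show ?thesis by blast
  qed
qed

definition cubes :: "4 \<Rightarrow> 'k::field S" where
  "cubes i = X i ^ 3"

lemma cubes_in: "cubes \<in> cubics4"
  using homogeneous_power[OF homogeneous_X, of 3] by (auto simp: cubics4_def cubes_def)

text \<open>General position depends on the coordinates and is tested after the special change;
  \<open>cube_like\<close> is tested on the cubes themselves, where the substitution changes
  nothing.\<close>

lemma generic_polynomial:
  "\<exists>(D :: (4 \<Rightarrow> 'k S) \<Rightarrow> 'k) T. polyfun_on cubic_coords cubics4 D \<and> polyfun_on cubic_coords cubics4 T \<and>
     D (\<lambda>i. lin_change special_change (cubes i)) \<noteq> 0 \<and> T cubes \<noteq> 0 \<and>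
     (\<forall>g\<in>cubics4. D g \<noteq> 0 \<longrightarrow> general_position g) \<and>
     (\<forall>f\<in>(cubics4 :: (4 \<Rightarrow> 'k::field_char_0 S) set). T f \<noteq> 0 \<longrightarrow> cube_like f)"
proof -
  have "special_cubics = (\<lambda>i. lin_change special_change (cubes i :: 'k S))"
    by (simp add: special_cubics_def cubes_def fun_eq_iff)
  then obtain D :: "(4 \<Rightarrow> 'k S) \<Rightarrow> 'k" where D: "polyfun_on cubic_coords cubics4 D"
    "D (\<lambda>i. lin_change special_change (cubes i)) \<noteq> 0" "\<forall>g\<in>cubics4. D g \<noteq> 0 \<longrightarrow> general_position g"
    using general_position_is_open[OF special_cubics_in general_position_special] by auto
  have "cube_like (cubes :: 4 \<Rightarrow> 'k S)"
    using cube_like_cubes unfolding cubes_def[abs_def] .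
  then obtain T :: "(4 \<Rightarrow> 'k S) \<Rightarrow> 'k" where T: "polyfun_on cubic_coords cubics4 T"
    "T cubes \<noteq> 0" "\<forall>f\<in>cubics4. T f \<noteq> 0 \<longrightarrow> cube_like f"
    using cube_like_is_open[OF cubes_in] by blast
  show ?thesis by (intro exI[of _ D] exI[of _ T]) (simp add: D T)
qed

lemma generic_cubics_gin:
  "holds_for_generic_cubics (\<lambda>f :: 4 \<Rightarrow> 'k::field_char_0 S.
     \<exists>J. is_gin (ideal_gen (range f)) J \<and> (J = form_I \<or> J = form_II))"
proof -
  obtain D T where DT: "polyfun_on cubic_coords cubics4 D" "polyfun_on cubic_coords cubics4 T"
     "D (\<lambda>i. lin_change special_change (cubes i :: 'k S)) \<noteq> 0" "T (cubes :: 4 \<Rightarrow> 'k S) \<noteq> 0"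
     "\<And>g. g \<in> cubics4 \<Longrightarrow> D g \<noteq> 0 \<Longrightarrow> general_position g"
     "\<And>f. f \<in> cubics4 \<Longrightarrow> T f \<noteq> 0 \<Longrightarrow> cube_like f"
    using generic_polynomial[where ?'k='k] by blast
  \<comment> \<open>The coordinate change is fixed here and f varies. For f in this set it then
    serves as the starting point \<open>a0\<close> of \<open>gin_cases\<close>, where f is fixed and
    the coordinates vary.\<close>
  let ?U = "{f \<in> cubics4. T f * D (\<lambda>i. lin_change special_change (f i)) \<noteq> 0}"
  have "polyfun_on cubic_coords cubics4 (\<lambda>f. D (\<lambda>i. lin_change special_change (f i)))"
    by (intro coeffs_polyfun_on_compose[OF DT(1)] coeffs_polyfun_on_linear[OF lin_change_linear _ coeffs_polyfun_on_cubic]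
        homogeneous_lin_change)
  then have "zariski_open_in cubic_coords cubics4 ?U"
    by (intro zariski_open_in_polyfun polyfun_on_mult DT)
  moreover have "cubes \<in> ?U" using DT(3,4) cubes_in by simp
  moreover have "\<forall>f\<in>?U. \<exists>J. is_gin (ideal_gen (range f)) J \<and> (J = form_I \<or> J = form_II)"
    using gin_cases[OF _ dim_bounded_ideal_gen DT(1,5) special_change_GL4] DT(6) by simp
  ultimately show ?thesis
    unfolding holds_for_generic_cubics_def cubic_coords_def by blast
qed

section \<open>Triangular regular sequences\<close>

definition rad_ideal :: "'r::comm_ring_1 set \<Rightarrow> 'r set" where
  "rad_ideal J = {p. \<exists>n. p ^ n \<in> J}"

lemma rad_ideal_subspace:
  assumes J: "idl.subspace (J :: 'k::comm_ring_1 S set)"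
  shows "idl.subspace (rad_ideal J)"
proof (rule idl.subspaceI)
  have "(0 :: 'k S) ^ 1 \<in> J" using idl.subspace_0[OF J] by simp
  then show "0 \<in> rad_ideal J" unfolding rad_ideal_def by blast
  show "x + y \<in> rad_ideal J" if "x \<in> rad_ideal J" "y \<in> rad_ideal J" for x y
  proof -
    obtain m n where mn: "x ^ m \<in> J" "y ^ n \<in> J" using \<open>x \<in> _\<close> \<open>y \<in> _\<close> by (auto simp: rad_ideal_def)
    have "(x + y) ^ (m + n) = (\<Sum>k\<le>m + n. of_nat ((m + n) choose k) * x ^ k * y ^ (m + n - k))"
      by (rule binomial_ring)
    also have "\<dots> \<in> J"
    proof (rule idl.subspace_sum[OF J])
      fix k assume "k \<in> {..m + n}"
      show "of_nat ((m + n) choose k) * x ^ k * y ^ (m + n - k) \<in> J"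
      proof (cases "m \<le> k")
        case True
        then have "x ^ k = x ^ (k - m) * x ^ m" by (simp flip: power_add)
        then have "of_nat ((m + n) choose k) * x ^ k * y ^ (m + n - k) =
            (of_nat ((m + n) choose k) * x ^ (k - m) * y ^ (m + n - k)) * x ^ m"
          by (simp add: mult.assoc mult.left_commute mult.commute)
        then show ?thesis using idl.subspace_scale[OF J mn(1)] by metis
      next
        case False
        then have "m + n - k = (m - k) + n" by simp
        then have "y ^ (m + n - k) = y ^ (m - k) * y ^ n" by (simp flip: power_add)
        then have "of_nat ((m + n) choose k) * x ^ k * y ^ (m + n - k) =
            (of_nat ((m + n) choose k) * x ^ k * y ^ (m - k)) * y ^ n"
          by (simp add: mult.assoc)
        then show ?thesis using idl.subspace_scale[OF J mn(2)] by metis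
      qed
    qed
    finally show ?thesis by (auto simp: rad_ideal_def)
  qed
  show "c * x \<in> rad_ideal J" if x: "x \<in> rad_ideal J" for c x
  proof -
    obtain m where "x ^ m \<in> J" using x by (auto simp: rad_ideal_def)
    then have "(c * x) ^ m \<in> J" unfolding power_mult_distrib by (rule idl.subspace_scale[OF J])
    then show ?thesis by (auto simp: rad_ideal_def)
  qed
qed

lemma smul_mem_ideal: "idl.subspace J \<Longrightarrow> p \<in> J \<Longrightarrow> smul c p \<in> J"
  unfolding smul_def by (rule idl.subspace_scale)

lemma X_dvd_monomial:
  assumes "Poly_Mapping.lookup m k \<noteq> 0"
  shows "\<exists>q. monomial m = q * (X k :: 'k::comm_ring_1 S)"
proof -
  have "m = (m - Poly_Mapping.single k 1) + Poly_Mapping.single k 1"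
    by (rule poly_mapping_eqI) (use assms in \<open>auto simp: lookup_add lookup_minus lookup_single when_def\<close>)
  then have "monomial m = monomial (m - Poly_Mapping.single k 1) * (X k :: 'k S)"
    unfolding X_eq_monomial monomial_add[symmetric] by simp
  then show ?thesis ..
qed

lemma cubic_mon_later_var:
  assumes "mon_degree m = 3" "Poly_Mapping.keys m \<subseteq> {i..}" "m \<noteq> Poly_Mapping.single i 3"
  shows "\<exists>k>i. Poly_Mapping.lookup m k \<noteq> 0"
proof (rule ccontr)
  assume none: "\<not> ?thesis"
  have zero: "Poly_Mapping.lookup m k = 0" if "k \<noteq> i" for k
    using none assms(2) that by (cases i k rule: linorder_cases) (auto simp: in_keys_iff)
  have "mon_degree m = Poly_Mapping.lookup m i"
    using sum.remove[of UNIV i "Poly_Mapping.lookup m"] zero by (simp add: mon_degree_def)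
  then have "m = Poly_Mapping.single i 3"
    using assms(1) zero by (intro poly_mapping_eqI) (auto simp: lookup_single when_def)
  then show False using assms(3) by simp
qed

lemma mem_ideal_of_later_vars:
  fixes p :: "'k::field S"
  assumes J: "idl.subspace J" and X: "\<And>k. k > i \<Longrightarrow> X k \<in> J"
    and m: "\<And>m. m \<in> Poly_Mapping.keys p \<Longrightarrow> \<exists>k>i. Poly_Mapping.lookup m k \<noteq> 0"
  shows "p \<in> J"
proof -
  have "monomial m \<in> J" if key: "m \<in> Poly_Mapping.keys p" for m
  proof -
    obtain k where "k > i" "Poly_Mapping.lookup m k \<noteq> 0" using m[OF key] by blast
    then obtain q where "monomial m = q * (X k :: 'k S)" using X_dvd_monomial by blast
    then show ?thesis using idl.subspace_scale[OF J X[OF \<open>k > i\<close>]] by simp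
  qed
  then have "(\<Sum>m\<in>Poly_Mapping.keys p. smul (Poly_Mapping.lookup p m) (monomial m)) \<in> J"
    by (intro idl.subspace_sum[OF J] smul_mem_ideal[OF J])
  then show ?thesis by (simp flip: as_sum_monomials)
qed

text \<open>Moving one member of a regular sequence past later ones, one at a time.\<close>
lemma regular_sequence_cancel_aux:
  fixes f :: "4 \<Rightarrow> 'k::field S"
  assumes reg: "regular_sequence f" and "finite B" "B \<subseteq> {i<..}" "\<forall>b\<in>B. {i<..<b} \<subseteq> B"
    and "f i * g \<in> ideal_gen (f ` ({..<i} \<union> B))"
  shows "g \<in> ideal_gen (f ` ({..<i} \<union> B))"
  using assms(2-)
proof (induction B arbitrary: g rule: finite_linorder_max_induct)
  case empty
  then show ?case using reg unfolding regular_sequence_def by (simp add: mult.commute)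
next
  case (insert b A)
  have A: "A = {i<..<b}" using insert.prems(1,2) insert.hyps(2) by auto
  let ?C = "f ` ({..<i} \<union> A)"
  \<comment> \<open>Regularity applies to f b because f i together with C makes up exactly the
    members before b.\<close>
  have lower: "f ` {..<b} = Set.insert (f i) ?C"
  proof -
    have "{..<b} = Set.insert i ({..<i} \<union> A)" using insert.prems(1) unfolding A by auto
    then show ?thesis by simp
  qed
  have ins: "f ` ({..<i} \<union> Set.insert b A) = Set.insert (f b) ?C" by auto
  have IH: "g \<in> ideal_gen ?C" if "f i * g \<in> ideal_gen ?C" for g
    using that
  proof (rule insert.IH[rotated 2])
    show "A \<subseteq> {i<..}" "\<forall>b\<in>A. {i<..<b} \<subseteq> A" unfolding A by auto
  qed
  obtain h where h: "f i * g - h * f b \<in> ideal_gen ?C"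
    using insert.prems(3) unfolding ins idl.span_breakdown_eq by blast
  have "h * f b = f i * g - (f i * g - h * f b)" by simp
  also have "\<dots> \<in> ideal_gen (Set.insert (f i) ?C)"
  proof (rule idl.span_diff)
    show "f i * g \<in> ideal_gen (Set.insert (f i) ?C)"
      by (subst mult.commute) (intro idl.span_scale idl.span_base, simp)
    show "f i * g - h * f b \<in> ideal_gen (Set.insert (f i) ?C)"
      using h idl.span_mono[OF subset_insertI] by blast
  qed
  finally have "h \<in> ideal_gen (Set.insert (f i) ?C)"
    using reg unfolding regular_sequence_def lower[symmetric] by blast
  then obtain u where u: "h - u * f i \<in> ideal_gen ?C"
    unfolding idl.span_breakdown_eq by blast
  \<comment> \<open>Modulo C one has f_i g = h f_b and h = u f_i, so f_i annihilates g - u f_b, and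
    the induction hypothesis for C applies.\<close>
  have "f i * (g - u * f b) = (f i * g - h * f b) + f b * (h - u * f i)"
    by (simp add: algebra_simps)
  also have "\<dots> \<in> ideal_gen ?C" by (intro idl.span_add idl.span_scale h u)
  finally have "g - u * f b \<in> ideal_gen ?C" by (rule IH)
  then show ?case unfolding ins idl.span_breakdown_eq by blast
qed

lemma regular_sequence_cancel:
  fixes f :: "4 \<Rightarrow> 'k::field S"
  assumes "regular_sequence f" "f i * g \<in> ideal_gen (f ` (- {i}))"
  shows "g \<in> ideal_gen (f ` (- {i}))"
proof -
  have eq: "- {i} = {..<i} \<union> {i<..}" by auto
  show ?thesis
    unfolding eq
  proof (rule regular_sequence_cancel_aux[OF assms(1)])
    show "f i * g \<in> ideal_gen (f ` ({..<i} \<union> {i<..}))" using assms(2) unfolding eq .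
  qed auto
qed

text \<open>The member f i cancels modulo the others, so a power of it in their ideal could be
  cancelled down to 1.\<close>

lemma regular_sequence_not_nilpotent:
  fixes f :: "4 \<Rightarrow> 'k::field S"
  assumes reg: "regular_sequence f"
  shows "f i ^ n \<notin> ideal_gen (f ` (- {i}))"
proof (induction n)
  case 0
  show ?case
  proof
    assume "f i ^ 0 \<in> ideal_gen (f ` (- {i}))"
    then have "1 \<in> ideal_gen (range f)" using idl.span_mono[of "f ` (- {i})" "range f"] by auto
    then have "p \<in> ideal_gen (range f)" for p using idl.span_scale[of 1 _ p] by simp
    then show False using reg unfolding regular_sequence_def by blast
  qed
next
  case (Suc n)
  then show ?case using regular_sequence_cancel[OF reg, of i "f i ^ n"] by auto
qed

text \<open>Let k be the last index whose f_k lacks the cube of its own variable, and J the ideal of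
  the other members. From the last variable backwards, the cubes present in f_j for j > k put x_j
  into the radical of J. Every term of f_k involves such an x_j, so f_k would be nilpotent modulo
  J.\<close>

lemma regular_triangular_coeff:
  fixes f :: "4 \<Rightarrow> 'k::field S"
  assumes h: "\<And>i. homogeneous 3 (f i)" and tri: "\<And>i. f i \<in> polys_in {i..}" and reg: "regular_sequence f"
  shows "Poly_Mapping.lookup (f i) (Poly_Mapping.single i 3) \<noteq> 0"
proof (rule ccontr)
  assume "\<not> ?thesis"
  define Z where "Z = {i. Poly_Mapping.lookup (f i) (Poly_Mapping.single i 3) = 0}"
  define k where "k = Max Z"
  have "Z \<noteq> {}" using \<open>\<not> _\<close> by (auto simp: Z_def)
  then have k: "k \<in> Z" unfolding k_def by (intro Max_in) auto
  have above: "j \<notin> Z" if "j > k" for j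
    using that Max_ge[of Z j] unfolding k_def by (auto simp: not_le[symmetric])
  define J where "J = ideal_gen (f ` (- {k}))"
  have R: "idl.subspace (rad_ideal J)" unfolding J_def by (intro rad_ideal_subspace) simp
  have later: "\<exists>l>j. Poly_Mapping.lookup m l \<noteq> 0"
    if "m \<in> Poly_Mapping.keys (f j)" "m \<noteq> Poly_Mapping.single j 3" for m j
    by (rule cubic_mon_later_var[OF _ _ that(2)])
      (use that(1) h[of j] tri[of j] in \<open>auto simp: homogeneous_def polys_in_def\<close>)
  have X: "X j \<in> rad_ideal J" if "j > k" for j
    using that
  \<comment> \<open>The induction descends from the last variable: modulo the later variables f_j is
    a nonzero multiple of the cube of x_j.\<close>
  proof (induction "card {j<..}" arbitrary: j rule: less_induct)
    case less
    let ?c = "Poly_Mapping.lookup (f j) (Poly_Mapping.single j 3)"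
    let ?r = "f j - smul ?c (monomial (Poly_Mapping.single j 3))"
    have c: "?c \<noteq> 0" using above[OF less.prems] by (simp add: Z_def)
    have "X l \<in> rad_ideal J" if "l > j" for l
    proof (rule less.hyps)
      show "card {l<..} < card {j<..}" using that by (intro psubset_card_mono) auto
    qed (use that less.prems in simp)
    moreover have "\<exists>l>j. Poly_Mapping.lookup m l \<noteq> 0" if "m \<in> Poly_Mapping.keys ?r" for m
      by (rule later) (use that in \<open>auto simp: in_keys_iff lookup_minus lookup_monomial split: if_splits\<close>)
    ultimately have r: "?r \<in> rad_ideal J"
      by (rule mem_ideal_of_later_vars[OF R])
    have "f j \<in> J" unfolding J_def using less.prems by (intro idl.span_base) auto
    then have "f j ^ 1 \<in> J" by simp
    then have "f j \<in> rad_ideal J" unfolding rad_ideal_def by blast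
    from idl.subspace_diff[OF R this r]
    have "smul ?c (monomial (Poly_Mapping.single j 3)) \<in> rad_ideal J" by simp
    from smul_mem_ideal[OF R this, of "1 / ?c"]
    have "X j ^ 3 \<in> rad_ideal J" using c by (simp add: monomial_single_power)
    then show ?case unfolding rad_ideal_def by (auto simp flip: power_mult)
  qed
  have "f k \<in> rad_ideal J"
  proof (rule mem_ideal_of_later_vars[OF R X])
    fix m assume m: "m \<in> Poly_Mapping.keys (f k)"
    then have "m \<noteq> Poly_Mapping.single k 3" using k by (auto simp: Z_def in_keys_iff)
    then show "\<exists>l>k. Poly_Mapping.lookup m l \<noteq> 0" using later m by blast
  qed
  then show False
    using regular_sequence_not_nilpotent[OF reg, of k] by (auto simp: rad_ideal_def J_def)
qed

section \<open>Torus weights and the degeneration to the cubes\<close>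

definition weight :: "4 \<Rightarrow> nat" where
  "weight i = card {..<i}"

definition mon_weight :: "mon \<Rightarrow> nat" where
  "mon_weight m = (\<Sum>i\<in>UNIV. Poly_Mapping.lookup m i * weight i)"

lemma weight_strict_mono: "i < j \<Longrightarrow> weight i < weight j"
  unfolding weight_def by (rule psubset_card_mono) auto

text \<open>Any cubic monomial in the variables from index i on, other than the pure cube, involves
  a variable of larger weight. The strict gap makes its term vanish at t = 0 in the
  degeneration.\<close>

lemma mon_weight_gt:
  assumes "mon_degree m = 3" "Poly_Mapping.keys m \<subseteq> {i..}" "m \<noteq> Poly_Mapping.single i 3"
  shows "3 * weight i < mon_weight m"
proof -
  obtain k where k: "k > i" "Poly_Mapping.lookup m k \<noteq> 0"
    using cubic_mon_later_var[OF assms] by blast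
  have "3 * weight i = (\<Sum>j\<in>UNIV. Poly_Mapping.lookup m j * weight i)"
    using assms(1) by (simp add: mon_degree_def sum_distrib_right[symmetric])
  also have "\<dots> < mon_weight m"
    unfolding mon_weight_def
  proof (rule sum_strict_mono_ex1)
    show "\<forall>j\<in>UNIV. Poly_Mapping.lookup m j * weight i \<le> Poly_Mapping.lookup m j * weight j"
    proof
      fix j
      show "Poly_Mapping.lookup m j * weight i \<le> Poly_Mapping.lookup m j * weight j"
      proof (cases "Poly_Mapping.lookup m j = 0")
        case False
        then have "i \<le> j" using assms(2) by (auto simp: in_keys_iff subset_iff)
        then have "weight i \<le> weight j" unfolding weight_def by (intro card_mono) auto
        then show ?thesis by simp
      qed simp
    qed
    show "\<exists>j\<in>UNIV. Poly_Mapping.lookup m j * weight i < Poly_Mapping.lookup m j * weight j"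
      using k weight_strict_mono[OF k(1)] by auto
  qed simp
  finally show ?thesis .
qed

lemma mon_weight_single: "mon_weight (Poly_Mapping.single i 3) = 3 * weight i"
proof -
  have "mon_weight (Poly_Mapping.single i 3) = (\<Sum>j\<in>UNIV. if j = i then 3 * weight j else 0)"
    unfolding mon_weight_def by (intro sum.cong) (auto simp: lookup_single when_def)
  then show ?thesis by simp
qed

definition torus :: "'k::field \<Rightarrow> 'k^4^4" where
  "torus t = (\<chi> i j. if i = j then t ^ weight j else 0)"

lemma torus_mult: "torus s ** torus t = torus (s * t)"
proof -
  have "(\<Sum>k\<in>UNIV. torus s $ i $ k * torus t $ k $ j) =
      (\<Sum>k\<in>UNIV. if k = i then (if i = j then (s * t) ^ weight j else 0) else 0)" for i j
    by (intro sum.cong) (auto simp: torus_def power_mult_distrib)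
  then show ?thesis by (simp add: matrix_matrix_mult_def vec_eq_iff) (simp add: torus_def)
qed

lemma torus_one: "torus 1 = mat 1"
  by (simp add: torus_def mat_def vec_eq_iff)

lemma torus_inverse: "t \<noteq> 0 \<Longrightarrow> torus t ** torus (1 / t) = mat 1"
  by (simp add: torus_mult torus_one)

lemma torus_inverse': "t \<noteq> 0 \<Longrightarrow> torus (1 / t) ** torus t = mat 1"
  by (simp add: torus_mult torus_one)

lemma lin_change_torus_X: "lin_change (torus t) (X j) = smul (t ^ weight j) (X j :: 'k::field S)"
proof -
  have "lin_change (torus t) (X j :: 'k S) = (\<Sum>i\<in>UNIV. if i = j then smul (t ^ weight j) (X j) else 0)"
    unfolding lin_change_X torus_def smul_def by (intro sum.cong) (auto simp: const_hom.c_0)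
  then show ?thesis by simp
qed

lemma smul_power: "smul c p ^ n = smul (c ^ n) (p ^ n :: 'k::field S)"
proof (induction n)
  case 0
  then show ?case by (simp add: smul_def)
next
  case (Suc n)
  then show ?case by (simp add: smul_mult_left smul_mult_right mult.commute)
qed

lemma smul_prod: "(\<Prod>i\<in>A. smul (c i) (p i)) = smul (prod c A) (prod p A :: 'k::field S)"
proof -
  have "smul 1 1 = (1 :: 'k S)" by (simp add: smul_def)
  then show ?thesis
    by (induction A rule: infinite_finite_induct) (simp_all add: smul_mult_left smul_mult_right mult.commute)
qed

lemma lin_change_torus_monomial:
  "lin_change (torus t) (monomial m) = smul (t ^ mon_weight m) (monomial m :: 'k::field S)"
  by (simp add: lin_change_monomial lin_change_torus_X smul_power smul_prod monomial_eq_prod[symmetric]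
      power_mult[symmetric] power_sum[symmetric] mon_weight_def mult.commute)

text \<open>A one-parameter family of triangular sequences that specialises to the cubes of the variables
  at t = 0; for nonzero t it is a rescaled torus translate of f.\<close>
definition degeneration :: "(4 \<Rightarrow> 'k::field S) \<Rightarrow> 'k \<Rightarrow> 4 \<Rightarrow> 'k S" where
  "degeneration f t i = (\<Sum>m\<in>hmons 3. smul (Poly_Mapping.lookup (f i) m /
     Poly_Mapping.lookup (f i) (Poly_Mapping.single i 3) * t ^ (mon_weight m - 3 * weight i)) (monomial m))"

lemma degeneration_0:
  assumes h: "\<And>i. homogeneous 3 (f i)" and tri: "\<And>i. f i \<in> polys_in {i..}"
    and c: "\<And>i. Poly_Mapping.lookup (f i) (Poly_Mapping.single i 3) \<noteq> 0"
  shows "degeneration f 0 = (cubes :: 4 \<Rightarrow> 'k::field S)"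
proof
  fix i
  have "degeneration f 0 i = (\<Sum>m\<in>hmons 3. if m = Poly_Mapping.single i 3 then monomial m else 0)"
    unfolding degeneration_def
  proof (intro sum.cong refl)
    fix m assume m: "m \<in> hmons 3"
    show "smul (Poly_Mapping.lookup (f i) m / Poly_Mapping.lookup (f i) (Poly_Mapping.single i 3) *
        0 ^ (mon_weight m - 3 * weight i)) (monomial m) =
        (if m = Poly_Mapping.single i 3 then monomial m else 0 :: 'k S)"
    proof (cases "m = Poly_Mapping.single i 3")
      case True
      \<comment> \<open>The exponent of t is 0 here and 0 ^ 0 = 1, so this term survives with
        coefficient 1.\<close>
      then show ?thesis using c[of i] by (simp add: mon_weight_single)
    next
      case False
      show ?thesis
      proof (cases "Poly_Mapping.lookup (f i) m = 0")
        case nz: False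
        then have "Poly_Mapping.keys m \<subseteq> {i..}" using tri[of i] by (auto simp: polys_in_def in_keys_iff)
        then have "3 * weight i < mon_weight m" using False m by (intro mon_weight_gt) (auto simp: hmons_def)
        then show ?thesis using False by simp
      qed (use False in simp)
    qed
  qed
  also have "\<dots> = monomial (Poly_Mapping.single i 3)"
    using mon_degree_single[of i 3] by (simp add: hmons_def[symmetric]) (simp add: hmons_def)
  finally show "degeneration f 0 i = cubes i" by (simp add: cubes_def monomial_single_power)
qed

lemma degeneration_torus:
  assumes h: "\<And>i. homogeneous 3 (f i)" and tri: "\<And>i. f i \<in> polys_in {i..}" and t: "t \<noteq> 0"
  shows "degeneration f t i = lin_change (torus t)
    (smul (1 / (Poly_Mapping.lookup (f i) (Poly_Mapping.single i 3) * t ^ (3 * weight i))) (f i :: 'k::field S))"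
proof -
  let ?c = "Poly_Mapping.lookup (f i) (Poly_Mapping.single i 3)"
  have "lin_change (torus t) (smul (1 / (?c * t ^ (3 * weight i))) (f i)) =
      (\<Sum>m\<in>hmons 3. smul (1 / (?c * t ^ (3 * weight i)) * (Poly_Mapping.lookup (f i) m * t ^ mon_weight m)) (monomial m))"
    by (subst (2) homogeneous_as_sum[OF h[of i]])
      (simp add: lin_change_sum lin_change_torus_monomial pm.scale_sum_right)
  also have "\<dots> = degeneration f t i"
    unfolding degeneration_def
  proof (intro sum.cong refl)
    fix m assume m: "m \<in> hmons 3"
    have "1 / (?c * t ^ (3 * weight i)) * (Poly_Mapping.lookup (f i) m * t ^ mon_weight m) =
        Poly_Mapping.lookup (f i) m / ?c * t ^ (mon_weight m - 3 * weight i)"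
    proof (cases "Poly_Mapping.lookup (f i) m = 0")
      case False
      then have "Poly_Mapping.keys m \<subseteq> {i..}" using tri[of i] by (auto simp: polys_in_def in_keys_iff)
      \<comment> \<open>On the support of f i the truncated difference of weights in
        \<open>degeneration\<close> is an exact one.\<close>
      then have "3 * weight i \<le> mon_weight m"
        using mon_weight_gt[of m i] m by (cases "m = Poly_Mapping.single i 3") (auto simp: hmons_def mon_weight_single)
      then have "t ^ mon_weight m = t ^ (mon_weight m - 3 * weight i) * t ^ (3 * weight i)"
        by (simp flip: power_add)
      then show ?thesis using t by simp
    qed simp
    then show "smul (1 / (?c * t ^ (3 * weight i)) * (Poly_Mapping.lookup (f i) m * t ^ mon_weight m)) (monomial m) =
        (smul (Poly_Mapping.lookup (f i) m / ?c * t ^ (mon_weight m - 3 * weight i)) (monomial m) :: 'k S)"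
      by simp
  qed
  finally show ?thesis ..
qed

lemma coeffs_polyfun_on_degeneration:
  "coeffs_polyfun_on (\<lambda>t (_::unit). t) UNIV 3 (\<lambda>t. degeneration f t i :: 'k::field S)"
  unfolding degeneration_def using polyfun_on_coord[of "\<lambda>t (_::unit). t" UNIV "()"]
  by (intro coeffs_polyfun_on_sum coeffs_polyfun_on_smul polyfun_on_mult polyfun_on_const polyfun_on_power
      coeffs_polyfun_on_const) (auto simp: hmons_def intro: homogeneous_monomial)

lemma ideal_gen_smul:
  assumes "\<And>i. c i \<noteq> (0 :: 'k::field)"
  shows "ideal_gen (range (\<lambda>i. smul (c i) (f i))) = ideal_gen (range f)"
proof (rule idl.span_eq[THEN iffD2], intro conjI)
  show "range (\<lambda>i. smul (c i) (f i)) \<subseteq> ideal_gen (range f)"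
    by (auto simp: smul_def intro: idl.span_scale idl.span_base)
  show "range f \<subseteq> ideal_gen (range (\<lambda>i. smul (c i) (f i)))"
  proof
    fix x assume "x \<in> range f"
    then obtain i where i: "x = f i" by auto
    have "f i = smul (1 / c i) (smul (c i) (f i))" using assms[of i] by simp
    also have "\<dots> \<in> ideal_gen (range (\<lambda>i. smul (c i) (f i)))"
      unfolding smul_def[of "1 / c i"] by (intro idl.span_scale idl.span_base) auto
    finally show "x \<in> ideal_gen (range (\<lambda>i. smul (c i) (f i)))" by (simp add: i)
  qed
qed

text \<open>The cubes, reached at t = 0, make both test polynomials nonzero there. A nonzero t then
  transfers both conditions to the given ideal: the dimension bound back through the torus, general
  position through the composite coordinate change.\<close>

lemma triangular_cubics_gin:
  fixes f :: "4 \<Rightarrow> 'k::field_char_0 S"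
  assumes h: "\<And>i. homogeneous 3 (f i)" and tri: "\<And>i. f i \<in> polys_in {i..}" and reg: "regular_sequence f"
  shows "\<exists>J. is_gin (ideal_gen (range f)) J \<and> (J = form_I \<or> J = form_II)"
proof -
  obtain D T where DT: "polyfun_on cubic_coords cubics4 D" "polyfun_on cubic_coords cubics4 T"
     "D (\<lambda>i. lin_change special_change (cubes i :: 'k S)) \<noteq> 0" "T (cubes :: 4 \<Rightarrow> 'k S) \<noteq> 0"
     "\<And>g. g \<in> cubics4 \<Longrightarrow> D g \<noteq> 0 \<Longrightarrow> general_position g"
     "\<And>f. f \<in> cubics4 \<Longrightarrow> T f \<noteq> 0 \<Longrightarrow> cube_like f"
    using generic_polynomial[where ?'k='k] by blast
  note c = regular_triangular_coeff[OF h tri reg]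
  note cp = coeffs_polyfun_on_degeneration[of f]
  have "polyfun_on (\<lambda>t (_::unit). t) UNIV (\<lambda>t. T (degeneration f t))"
    by (rule coeffs_polyfun_on_compose[OF DT(2) cp])
  moreover have "polyfun_on (\<lambda>t (_::unit). t) UNIV (\<lambda>t. D (\<lambda>i. lin_change special_change (degeneration f t i)))"
    by (rule coeffs_polyfun_on_compose[OF DT(1) coeffs_polyfun_on_linear[OF lin_change_linear homogeneous_lin_change cp]])
  ultimately have "polyfun_on (\<lambda>t (_::unit). t) UNIV
      (\<lambda>t. T (degeneration f t) * D (\<lambda>i. lin_change special_change (degeneration f t i)))"
    by (rule polyfun_on_mult)
  moreover have "T (degeneration f 0) * D (\<lambda>i. lin_change special_change (degeneration f 0 i)) \<noteq> 0"
    using DT(3,4) by (simp add: degeneration_0[OF h tri c])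
  ultimately have "\<exists>t. t \<noteq> 0 \<and> T (degeneration f t) * D (\<lambda>i. lin_change special_change (degeneration f t i)) \<noteq> 0"
    by (rule polyfun_on_line_nonzero)
  then obtain t where t: "t \<noteq> 0" "T (degeneration f t) \<noteq> 0"
      "D (\<lambda>i. lin_change special_change (degeneration f t i)) \<noteq> 0"
    by auto
  \<comment> \<open>This scaling gives the cube of the variable i coefficient 1 after the torus has
    acted, and it leaves the ideal unchanged.\<close>
  define s where "s i = 1 / (Poly_Mapping.lookup (f i) (Poly_Mapping.single i 3) * t ^ (3 * weight i))" for i
  define f' where "f' i = smul (s i) (f i)" for i
  have f': "f' \<in> cubics4" using h by (auto simp: f'_def cubics4_def intro: homogeneous_smul)
  have ideal: "ideal_gen (range f') = ideal_gen (range f)"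
    unfolding f'_def using c t(1) by (intro ideal_gen_smul) (simp add: s_def)
  have deg: "degeneration f t i = lin_change (torus t) (f' i)" for i
    using degeneration_torus[OF h tri t(1)] by (simp add: f'_def s_def)
  have "degeneration f t \<in> cubics4"
    using cp by (simp add: cubics4_def coeffs_polyfun_on_def)
  then have "dim_bounded (ideal_gen (range (degeneration f t)))"
    using DT(6) t(2) by (intro dim_bounded_ideal_gen) auto
  \<comment> \<open>\<open>cube_like\<close> is known only for the degenerated sequence; its
    consequence \<open>dim_bounded\<close> survives coordinate changes and can be carried
    back.\<close>
  then have "dim_bounded (lin_change (torus (1 / t)) ` lin_change (torus t) ` ideal_gen (range f'))"
    unfolding ideal_gen_lin_change[OF torus_inverse[OF t(1)], symmetric] deg[symmetric, abs_def]
    by (intro dim_bounded_lin_change) simp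
  then have dim: "dim_bounded (ideal_gen (range f'))"
    by (simp add: image_image lin_change_inverse[OF torus_inverse'[OF t(1)]])
  have "invertible (torus t)"
    unfolding invertible_def using torus_inverse[OF t(1)] torus_inverse'[OF t(1)] by blast
  then have "special_change ** torus t \<in> GL4"
    using special_change_GL4 invertible_mult unfolding GL4_def by blast
  moreover have "D (\<lambda>i. lin_change (special_change ** torus t) (f' i)) \<noteq> 0"
    using t(3) by (simp add: deg lin_change_lin_change)
  ultimately show ?thesis
    using gin_cases[OF f' dim DT(1,5)] unfolding ideal by blast
qed

theorem proposition2p5p3:
  shows
    "holds_for_generic_cubics
       (\<lambda>f :: 4 \<Rightarrow> ('k::{alg_closed_field, field_char_0}) S.
          \<exists>J. is_gin (ideal_gen (range f)) J \<and> (J = form_I \<or> J = form_II)) \<and>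
     (\<forall>f :: 4 \<Rightarrow> 'k S.
        (\<forall>i. homogeneous 3 (f i)) \<longrightarrow> (\<forall>i. f i \<in> polys_in {i..}) \<longrightarrow> regular_sequence f \<longrightarrow>
        (\<exists>J. is_gin (ideal_gen (range f)) J \<and> (J = form_I \<or> J = form_II)))"
  using generic_cubics_gin triangular_cubics_gin by blast

end
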